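(* Let $\mathcal{F}$ be a nontrivial minor-closed family of graphs. Then there exist a constant $C$ and a function $f$ with $f(t)/t\to 0$ as $t\to\infty$ (both depending only on $\mathcal{F}$) such that every $F\in\mathcal{F}$ with $t$ vertices satisfies \[2t-2\alpha(F)-C\leq d_{\succ}(F)\leq 2t-\alpha_2(F)+f(t).\]
   Context: Graphs are finite and simple; the average degree of $G$ is $d(G)=2e(G)/|G|$. $H$ is a minor of $G$ ($G\succ H$) if $H$ can be obtained from $G$ by vertex deletions, edge deletions and edge contractions. A family of graphs is minor-closed if it is closed under taking minors, and nontrivial if it does not contain all graphs. For a graph $H$, $d_{\succ}(H):=\inf\{c:\ \text{every graph } G \text{ with } d(G)\geq c \text{ satisfies } G\succ H\}$. $\alpha(F)$ denotes the independence number of $F$, and $\alpha_2(F):=\max\{|U|: U\subseteq V(F),\ \chi(F[U])=2\}$, the maximum size of the union of two independent sets. *)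

theory Defs
  imports Complex_Main
begin

datatype 'a sgraph = SGraph (verts: "'a set") (edges: "'a set set")

definition simple_graph :: "'a sgraph \<Rightarrow> bool" where
  "simple_graph G \<longleftrightarrow>
     finite (verts G) \<and> (\<forall>e\<in>edges G. e \<subseteq> verts G \<and> card e = 2)"

text \<open>The graph without vertices gets average degree 0 (from division by 0).\<close>

definition avg_degree :: "'a sgraph \<Rightarrow> real" where
  "avg_degree G = 2 * real (card (edges G)) / real (card (verts G))"

definition graph_iso :: "'a sgraph \<Rightarrow> 'b sgraph \<Rightarrow> bool" where
  "graph_iso G H \<longleftrightarrow>
     (\<exists>f. bij_betw f (verts G) (verts H) \<and> edges H = (\<lambda>e. f ` e) ` edges G)"

definition del_vertex :: "'a sgraph \<Rightarrow> 'a \<Rightarrow> 'a sgraph" where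
  "del_vertex G v = SGraph (verts G - {v}) {e \<in> edges G. v \<notin> e}"

definition del_edge :: "'a sgraph \<Rightarrow> 'a set \<Rightarrow> 'a sgraph" where
  "del_edge G e = SGraph (verts G) (edges G - {e})"

text \<open>The edge between \<open>u\<close> and \<open>v\<close> is contracted to the vertex \<open>u\<close>. The result is simple:
  the loop is dropped, and parallel edges are identified because edges form a set.\<close>

definition contract_edge :: "'a sgraph \<Rightarrow> 'a \<Rightarrow> 'a \<Rightarrow> 'a sgraph" where
  "contract_edge G u v =
     SGraph (verts G - {v})
       ({e \<in> edges G. v \<notin> e} \<union> {{u, w} | w. {v, w} \<in> edges G \<and> w \<noteq> u})"

inductive minor_step :: "'a sgraph \<Rightarrow> 'a sgraph \<Rightarrow> bool" where
  vertex_deletion: "v \<in> verts G \<Longrightarrow> minor_step G (del_vertex G v)"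
| edge_deletion: "e \<in> edges G \<Longrightarrow> minor_step G (del_edge G e)"
| edge_contraction: "{u, v} \<in> edges G \<Longrightarrow> minor_step G (contract_edge G u v)"

definition has_minor :: "'a sgraph \<Rightarrow> 'b sgraph \<Rightarrow> bool"  (infix "\<succ>" 50) where
  "G \<succ> H \<longleftrightarrow> (\<exists>H'. minor_step\<^sup>*\<^sup>* G H' \<and> graph_iso H' H)"

text \<open>Every finite graph is isomorphic to one with vertices in \<open>nat\<close>, so families of graphs
  are sets of such graphs. Since \<open>\<succ>\<close> absorbs isomorphism, minor-closed families are
  closed under isomorphism.\<close>

definition minor_closed :: "nat sgraph set \<Rightarrow> bool" where
  "minor_closed \<F> \<longleftrightarrow> (\<forall>G\<in>\<F>. \<forall>H::nat sgraph. simple_graph H \<longrightarrow> G \<succ> H \<longrightarrow> H \<in> \<F>)"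

definition nontrivial_family :: "nat sgraph set \<Rightarrow> bool" where
  "nontrivial_family \<F> \<longleftrightarrow> (\<exists>G. simple_graph G \<and> G \<notin> \<F>)"

text \<open>The infimum is over nonnegative \<open>c\<close>. The sign restriction matters only for graphs \<open>H\<close> that
  are minors of every graph, where the infimum over all reals would not exist.\<close>

definition d_minor :: "'a sgraph \<Rightarrow> real" where
  "d_minor H =
     Inf {c. 0 \<le> c \<and> (\<forall>G::nat sgraph. simple_graph G \<longrightarrow> c \<le> avg_degree G \<longrightarrow> G \<succ> H)}"

definition indep_set :: "'a sgraph \<Rightarrow> 'a set \<Rightarrow> bool" where
  "indep_set G A \<longleftrightarrow> A \<subseteq> verts G \<and> (\<forall>u\<in>A. \<forall>v\<in>A. {u, v} \<notin> edges G)"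

definition indep_number :: "'a sgraph \<Rightarrow> nat" where
  "indep_number G = Max {card A | A. indep_set G A}"

text \<open>The maximum size of the union of two independent sets; the lemma \<open>alpha2_eq_chromatic\<close>
  below identifies it with the maximum size of an induced subgraph of chromatic number 2.
  Without edges there is no such subgraph, but the union of two independent sets
  still makes sense.\<close>

definition alpha2 :: "'a sgraph \<Rightarrow> nat" where
  "alpha2 G = Max {card (A \<union> B) | A B. indep_set G A \<and> indep_set G B}"

definition induced :: "'a sgraph \<Rightarrow> 'a set \<Rightarrow> 'a sgraph" where
  "induced G U = SGraph (verts G \<inter> U) {e \<in> edges G. e \<subseteq> U}"

definition colorable :: "'a sgraph \<Rightarrow> nat \<Rightarrow> bool" where
  "colorable G k \<longleftrightarrow>
     (\<exists>c. c ` verts G \<subseteq> {..<k} \<and> (\<forall>u v. {u, v} \<in> edges G \<longrightarrow> c u \<noteq> c v))"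

definition chromatic_number :: "'a sgraph \<Rightarrow> nat" where
  "chromatic_number G = (LEAST k. colorable G k)"

lemma colorable_mono: "colorable G k \<Longrightarrow> k \<le> l \<Longrightarrow> colorable G l"
  unfolding colorable_def by (meson lessThan_subset_iff subset_trans)

lemma colorable_2_induced:
  assumes "simple_graph G" "U \<subseteq> verts G"
  shows "colorable (induced G U) 2 \<longleftrightarrow> (\<exists>A B. indep_set G A \<and> indep_set G B \<and> U = A \<union> B)"
proof
  assume "colorable (induced G U) 2"
  then obtain c :: "'a \<Rightarrow> nat" where c: "c ` U \<subseteq> {..<2}"
      "\<And>u v. {u, v} \<in> edges G \<Longrightarrow> u \<in> U \<Longrightarrow> v \<in> U \<Longrightarrow> c u \<noteq> c v"
    using assms unfolding colorable_def induced_def by (auto simp: Int_absorb1)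
  have "indep_set G {u \<in> U. c u = 0}" "indep_set G {u \<in> U. c u = 1}"
    using c(2) assms(2) unfolding indep_set_def by fastforce+
  moreover have "U = {u \<in> U. c u = 0} \<union> {u \<in> U. c u = 1}"
    using c(1) by (auto simp: less_2_cases_iff)
  ultimately show "\<exists>A B. indep_set G A \<and> indep_set G B \<and> U = A \<union> B" by blast
next
  assume "\<exists>A B. indep_set G A \<and> indep_set G B \<and> U = A \<union> B"
  then obtain A B where AB: "indep_set G A" "indep_set G B" "U = A \<union> B" by blast
  let ?c = "\<lambda>x. if x \<in> A then 0 else 1 :: nat"
  have "?c ` verts (induced G U) \<subseteq> {..<2}" by auto
  moreover have "?c u \<noteq> ?c v" if "{u, v} \<in> edges (induced G U)" for u v
    using that AB unfolding induced_def indep_set_def by auto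
  ultimately show "colorable (induced G U) 2" unfolding colorable_def by blast
qed

lemma colorable_1_induced:
  assumes "simple_graph G" "U \<subseteq> verts G" "colorable (induced G U) 1"
  shows "indep_set G U"
proof -
  obtain c :: "'a \<Rightarrow> nat" where c: "c ` (verts G \<inter> U) \<subseteq> {..<1}"
      "\<And>u v. {u, v} \<in> edges G \<Longrightarrow> {u, v} \<subseteq> U \<Longrightarrow> c u \<noteq> c v"
    using assms(3) unfolding colorable_def induced_def by auto
  have "c u = 0" if "u \<in> U" for u using c(1) assms(2) that by auto
  then have "{u, v} \<notin> edges G" if "u \<in> U" "v \<in> U" for u v using c(2)[of u v] that by auto
  then show ?thesis using assms(2) unfolding indep_set_def by blast
qed

lemma indep_set_singleton:
  assumes "simple_graph G" "x \<in> verts G"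
  shows "indep_set G {x}"
  using assms unfolding simple_graph_def indep_set_def by fastforce

lemma alpha2_eq_chromatic:
  assumes G: "simple_graph G" and ne: "edges G \<noteq> {}"
  shows "alpha2 G = Max {card U | U. U \<subseteq> verts G \<and> chromatic_number (induced G U) = 2}"
proof -
  let ?T = "{card (A \<union> B) | A B. indep_set G A \<and> indep_set G B}"
  let ?S = "{card U | U. U \<subseteq> verts G \<and> chromatic_number (induced G U) = 2}"
  have fin: "finite (verts G)" using G by (simp add: simple_graph_def)
  have le: "card U \<le> card (verts G)" if "U \<subseteq> verts G" for U
    using that fin by (rule card_mono[rotated])
  have finT: "finite ?T"
    by (rule finite_subset[of _ "{..card (verts G)}"]) (auto simp: indep_set_def intro!: le)
  have finS: "finite ?S"
    by (rule finite_subset[of _ "{..card (verts G)}"]) (auto intro!: le)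
  have neT: "?T \<noteq> {}"
    by (auto intro!: exI[of _ "{}"] simp: indep_set_def)
  have col: "colorable H (chromatic_number H)" if "colorable H k" for H :: "'a sgraph" and k
    using that unfolding chromatic_number_def by (rule LeastI)
  have exk: "\<exists>k. colorable (induced G U) k" for U
  proof -
    obtain c :: "'a \<Rightarrow> nat" where c: "inj_on c (verts G)" "c ` verts G = {..<card (verts G)}"
      using ex_bij_betw_finite_nat[OF fin] by (auto simp: bij_betw_def atLeast0LessThan)
    have "c u \<noteq> c v" if e: "{u, v} \<in> edges G" for u v
    proof -
      have "u \<noteq> v" "u \<in> verts G" "v \<in> verts G"
        using G e unfolding simple_graph_def by fastforce+
      then show ?thesis using c(1) by (auto dest: inj_onD)
    qed
    moreover have "c ` verts (induced G U) \<subseteq> {..<card (verts G)}"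
      using c(2) unfolding induced_def by auto
    moreover have "edges (induced G U) \<subseteq> edges G" unfolding induced_def by auto
    ultimately show ?thesis unfolding colorable_def by (meson subsetD)
  qed
  have ST: "?S \<subseteq> ?T"
  proof
    fix n assume "n \<in> ?S"
    then obtain U where U: "n = card U" "U \<subseteq> verts G" "chromatic_number (induced G U) = 2" by blast
    have "colorable (induced G U) 2" using exk col U(3) by metis
    then show "n \<in> ?T" using colorable_2_induced[OF G U(2)] U(1) by blast
  qed
  have "Max ?T \<in> ?T" using finT neT by (rule Max_in)
  then obtain A B where AB: "Max ?T = card (A \<union> B)" "indep_set G A" "indep_set G B" by blast
  let ?U = "A \<union> B"
  have Us: "?U \<subseteq> verts G" using AB unfolding indep_set_def by auto
  have c2: "colorable (induced G ?U) 2" using colorable_2_induced[OF G Us] AB by blast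
  have "chromatic_number (induced G ?U) \<le> 2"
    using c2 unfolding chromatic_number_def by (rule Least_le)
  moreover have "\<not> chromatic_number (induced G ?U) \<le> 1"
  proof
    assume "chromatic_number (induced G ?U) \<le> 1"
    then have "colorable (induced G ?U) 1" using col[OF c2] colorable_mono by blast
    then have i: "indep_set G ?U" by (rule colorable_1_induced[OF G Us])
    obtain e where e: "e \<in> edges G" using ne by blast
    then obtain u v where uv: "e = {u, v}" using G by (auto simp: simple_graph_def card_2_iff)
    have "\<not> e \<subseteq> ?U" using i e unfolding uv indep_set_def by auto
    then obtain x where x: "x \<in> verts G" "x \<notin> ?U"
      using G e unfolding simple_graph_def by blast
    have "card (?U \<union> {x}) \<in> ?T" using i indep_set_singleton[OF G x(1)] by blast
    from Max_ge[OF finT this] have "card (?U \<union> {x}) \<le> card ?U" by (simp only: AB(1))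
    moreover have "card (?U \<union> {x}) = Suc (card ?U)"
      using x finite_subset[OF Us fin] by simp
    ultimately show False by simp
  qed
  ultimately have "chromatic_number (induced G ?U) = 2" by linarith
  then have inS: "Max ?T \<in> ?S" using AB(1) Us by blast
  have "Max ?S = Max ?T"
    by (rule Max_eqI[OF finS _ inS]) (rule Max_ge[OF finT subsetD[OF ST]])
  then show ?thesis unfolding alpha2_def by simp
qed

end

theory Submission
  imports Defs "HOL-Real_Asymp.Real_Asymp"
begin

text \<open>
  Lower bound: if \<open>F\<close> is a minor of the complete bipartite graph with parts of size \<open>s\<close> and \<open>n\<close>, then the
  branch sets avoiding the part of size \<open>s\<close> belong to an independent set of \<open>F\<close>, so
  \<open>t - \<alpha>(F) \<le> s\<close>; its average degree tends to \<open>2s\<close>.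

  Upper bound: replacing every vertex outside a maximum union of two independent sets by an edge
  turns \<open>F\<close> into a bipartite graph with \<open>m = 2t - \<alpha>\<^sub>2(F)\<close> vertices. As \<open>F\<close> has no large clique minor, deleting
  few vertices leaves components of bounded size. Let \<open>G\<close> have average degree at least \<open>2k\<close>,
  slightly more than \<open>m\<close>. A minor-minimal graph with about that density is highly connected and each of its
  edges lies in at least \<open>k\<close> triangles, so neighbourhoods of low-degree vertices induce subgraphs of
  minimum degree at least \<open>k\<close>. Joining two such pieces by disjoint paths if they hardly intersect, or
  taking a union of them otherwise, yields a minor of bounded size relative to \<open>k\<close>, with at
  least about \<open>2k\<close> vertices, minimum degree about \<open>k\<close> and linear connectivity. Almost \<open>2k\<close> of its vertices can be tiled
  by complete bipartite graphs of constant size, which accommodate the bounded components; the few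
  deleted vertices of \<open>F\<close> become small connected sets dominating almost all vertices.
\<close>

section \<open>Connected vertex sets\<close>

text \<open>Average degree 2k only guarantees minimum degree about k, and a graph with about 2k
  vertices and minimum degree k may be no more than a balanced complete bipartite graph. Hence F is
  embedded as if the host were bipartite, and 2t - alpha2(F) is the space this takes. The branch
  sets of the separator vertices are kept small, so they dominate the host only up to a fraction
  \<open>\<zeta>\<close>. A part of F has to avoid the tiles spoilt by the separator vertices it is
  adjacent to. For this reason parts with more than D such neighbours are moved into the separator
  beforehand. This dictates how the constants depend on each other: \<open>\<delta>\<close> comes
  from \<open>\<epsilon>\<close>; the neighbour bound D and the tile side R are polynomial in the
  part size r; 1 / \<open>\<zeta>\<close> is of order D R / \<open>\<delta>\<close>; a dominating
  set has M vertices, about 16 ln (1 / \<open>\<zeta>\<close>). The separator has at most about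
  \<open>\<eta>\<close> t vertices with \<open>\<eta>\<close> of order r^(-1/4), and its branch sets
  cost about M \<open>\<eta>\<close> t vertices. So M is only logarithmic in r, and any power saving
  in the separator theorem beats it. The error f(t) is o(t) because the resulting bound is uniform
  over all members of the family with t vertices.\<close>

definition conn :: "('a \<Rightarrow> 'a \<Rightarrow> bool) \<Rightarrow> 'a set \<Rightarrow> bool" where
  "conn E U \<longleftrightarrow> (\<forall>X. X \<subseteq> U \<longrightarrow> X \<noteq> {} \<longrightarrow> X \<noteq> U \<longrightarrow> (\<exists>x\<in>X. \<exists>y\<in>U - X. E x y))"

lemma connD: "conn E U \<Longrightarrow> X \<subseteq> U \<Longrightarrow> X \<noteq> {} \<Longrightarrow> X \<noteq> U \<Longrightarrow> \<exists>x\<in>X. \<exists>y\<in>U - X. E x y"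
  unfolding conn_def by blast

lemma conn_singleton [simp]: "conn E {x}"
  unfolding conn_def by auto

lemma conn_edge: "E x y \<Longrightarrow> E y x \<Longrightarrow> conn E {x, y}"
  unfolding conn_def by blast

lemma conn_mono: "conn E U \<Longrightarrow> (\<And>x y. x \<in> U \<Longrightarrow> y \<in> U \<Longrightarrow> E x y \<Longrightarrow> E' x y) \<Longrightarrow> conn E' U"
  unfolding conn_def by (meson DiffD1 subsetD)

text \<open>A pair p = q never crosses a cut. This allows an edge to be collapsed to a point when
  branch sets are followed through a contraction.\<close>

lemma conn_irrefl:
  assumes "conn (\<lambda>p q. E p q \<or> p = q) U"
  shows "conn E U"
  unfolding conn_def
proof (intro allI impI)
  fix X assume "X \<subseteq> U" "X \<noteq> {}" "X \<noteq> U"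
  from connD[OF assms this] obtain x y where "x \<in> X" "y \<in> U - X" "E x y \<or> x = y" by blast
  then show "\<exists>x\<in>X. \<exists>y\<in>U - X. E x y" by blast
qed

text \<open>With connectivity phrased by cuts, a set X without an outgoing edge contains each
  connected piece or misses it. The choice made for the core is forced on every piece, because each
  piece meets the core.\<close>

lemma conn_UN_core:
  assumes C: "conn E C" and I: "\<And>i. i \<in> I \<Longrightarrow> conn E (D i)" "\<And>i. i \<in> I \<Longrightarrow> D i \<inter> C \<noteq> {}"
  shows "conn E (C \<union> (\<Union>i\<in>I. D i))"
  unfolding conn_def
proof (intro allI impI)
  fix X assume X: "X \<subseteq> C \<union> (\<Union>i\<in>I. D i)" "X \<noteq> {}" "X \<noteq> C \<union> (\<Union>i\<in>I. D i)"
  let ?U = "C \<union> (\<Union>i\<in>I. D i)"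
  have split: "\<exists>x\<in>X. \<exists>y\<in>?U - X. E x y" if "conn E A" "A \<subseteq> ?U" "X \<inter> A \<noteq> {}" "\<not> A \<subseteq> X" for A
  proof -
    have "\<exists>x\<in>X \<inter> A. \<exists>y\<in>A - (X \<inter> A). E x y" by (rule connD[OF that(1)]) (use that in auto)
    then show ?thesis using that(2) by blast
  qed
  show "\<exists>x\<in>X. \<exists>y\<in>?U - X. E x y"
  proof (rule ccontr)
    assume n: "\<not> ?thesis"
    have all: "A \<subseteq> X \<or> X \<inter> A = {}" if "conn E A" "A \<subseteq> ?U" for A using split[OF that] n by blast
    have c: "C \<subseteq> X \<or> X \<inter> C = {}" using all C by blast
    have d: "D i \<subseteq> X \<or> X \<inter> D i = {}" if "i \<in> I" for i using all[of "D i"] I(1) that by blast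
    show False
    proof (cases "C \<subseteq> X")
      case True
      then have "D i \<subseteq> X" if "i \<in> I" for i using d[OF that] I(2)[OF that] by blast
      then show False using X True by blast
    next
      case False
      then have "X \<inter> C = {}" using c by blast
      then have "X \<inter> D i = {}" if "i \<in> I" for i using d[OF that] I(2)[OF that] by blast
      then show False using X \<open>X \<inter> C = {}\<close> by blast
    qed
  qed
qed

lemma conn_Un:
  assumes "conn E A" "conn E B" "A \<inter> B \<noteq> {}"
  shows "conn E (A \<union> B)"
  using conn_UN_core[of E A "{()}" "\<lambda>_. B"] assms by (simp add: Int_commute)

lemma conn_Un_edge:
  assumes "conn E A" "conn E B" "a \<in> A" "b \<in> B" "E a b" "E b a"
  shows "conn E (A \<union> B)"
proof -
  have "conn E (A \<union> {a, b})"
    by (rule conn_Un[OF assms(1) conn_edge[of E a b, OF assms(5,6)]]) (use assms(3) in auto)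
  from conn_Un[OF this assms(2)] have "conn E ((A \<union> {a, b}) \<union> B)" using assms(4) by auto
  moreover have "(A \<union> {a, b}) \<union> B = A \<union> B" using assms by auto
  ultimately show ?thesis by simp
qed

lemma conn_add_vertices:
  assumes "conn E Z" "symp E" "\<And>x. x \<in> L \<Longrightarrow> \<exists>z\<in>Z. E x z"
  shows "conn E (Z \<union> L)"
proof -
  obtain f where f: "\<And>x. x \<in> L \<Longrightarrow> f x \<in> Z \<and> E x (f x)" using assms(3) by metis
  have "conn E {x, f x}" if "x \<in> L" for x using f[OF that] assms(2) by (intro conn_edge) (auto dest: sympD)
  moreover have "{x, f x} \<inter> Z \<noteq> {}" if "x \<in> L" for x using f[OF that] by auto
  ultimately have "conn E (Z \<union> (\<Union>x\<in>L. {x, f x}))" using assms(1) by (intro conn_UN_core)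
  moreover have "Z \<union> (\<Union>x\<in>L. {x, f x}) = Z \<union> L" using f by auto
  ultimately show ?thesis by simp
qed

text \<open>A cut X either splits some \<open>\<psi> y\<close>, which is connected, or it is a union
  of whole sets \<open>\<psi> y\<close> and so induces a cut of A. Applied to composition of models
  and to contraction of an edge.\<close>

lemma conn_UN_blowup:
  assumes A: "conn E' A" and ne: "\<And>y. y \<in> A \<Longrightarrow> \<psi> y \<noteq> {}" and c: "\<And>y. y \<in> A \<Longrightarrow> conn E (\<psi> y)"
    and e: "\<And>y z. y \<in> A \<Longrightarrow> z \<in> A \<Longrightarrow> E' y z \<Longrightarrow> \<exists>u\<in>\<psi> y. \<exists>v\<in>\<psi> z. E u v"
  shows "conn E (\<Union>y\<in>A. \<psi> y)"
  unfolding conn_def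
proof (intro allI impI)
  fix X assume X: "X \<subseteq> (\<Union>y\<in>A. \<psi> y)" "X \<noteq> {}" "X \<noteq> (\<Union>y\<in>A. \<psi> y)"
  let ?U = "\<Union>y\<in>A. \<psi> y"
  show "\<exists>x\<in>X. \<exists>y\<in>?U - X. E x y"
  proof (cases "\<exists>y\<in>A. X \<inter> \<psi> y \<noteq> {} \<and> \<not> \<psi> y \<subseteq> X")
    case True
    then obtain y where y: "y \<in> A" "X \<inter> \<psi> y \<noteq> {}" "\<not> \<psi> y \<subseteq> X" by blast
    have "\<exists>x\<in>X \<inter> \<psi> y. \<exists>z\<in>\<psi> y - (X \<inter> \<psi> y). E x z" by (rule connD[OF c[OF y(1)]]) (use y in auto)
    then show ?thesis using y(1) by blast
  next
    case False
    let ?Y = "{y \<in> A. \<psi> y \<subseteq> X}"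
    have "\<exists>x\<in>?Y. \<exists>y\<in>A - ?Y. E' x y"
    proof (rule connD[OF A])
      show "?Y \<noteq> {}" using X False by blast
      show "?Y \<noteq> A" using X by blast
    qed auto
    then obtain y z where yz: "y \<in> A" "\<psi> y \<subseteq> X" "z \<in> A" "\<not> \<psi> z \<subseteq> X" "E' y z" by blast
    then have "X \<inter> \<psi> z = {}" using False by blast
    with e[OF yz(1,3,5)] yz show ?thesis by blast
  qed
qed

section \<open>Balls and connected sets of bounded size\<close>

primrec nball :: "('a \<Rightarrow> 'a \<Rightarrow> bool) \<Rightarrow> 'a set \<Rightarrow> 'a \<Rightarrow> nat \<Rightarrow> 'a set" where
  "nball E U x 0 = {x}"
| "nball E U x (Suc i) = nball E U x i \<union> {z \<in> U. \<exists>y\<in>nball E U x i. E y z}"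

lemma nball_subset: "x \<in> U \<Longrightarrow> nball E U x i \<subseteq> U"
  by (induction i) auto

lemma nball_centre: "x \<in> nball E U x i"
  by (induction i) auto

lemma nball_conn:
  assumes "symp E" "x \<in> U" "y \<in> nball E U x i"
  shows "\<exists>P\<subseteq>U. finite P \<and> conn E P \<and> x \<in> P \<and> y \<in> P \<and> card P \<le> Suc i"
  using assms(3)
proof (induction i arbitrary: y)
  case 0
  then show ?case using assms(2) by (intro exI[of _ "{x}"]) auto
next
  case (Suc i)
  show ?case
  proof (cases "y \<in> nball E U x i")
    case True
    from Suc.IH[OF this] show ?thesis by (meson le_SucI)
  next
    case False
    then obtain z where z: "y \<in> U" "z \<in> nball E U x i" "E z y" using Suc.prems by auto
    from Suc.IH[OF z(2)] obtain P where
      P: "P \<subseteq> U" "finite P" "conn E P" "x \<in> P" "z \<in> P" "card P \<le> Suc i" by blast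
    have "conn E (P \<union> {y})"
      by (rule conn_Un_edge[OF P(3) conn_singleton P(5) _ z(3)]) (use assms(1) z in \<open>auto dest: sympD\<close>)
    moreover have "card (P \<union> {y}) \<le> Suc (Suc i)" using P by (simp add: card_insert_if)
    ultimately show ?thesis using P z by (intro exI[of _ "P \<union> {y}"]) auto
  qed
qed

text \<open>The bound b counts the vertices of a connecting set instead of the length of a path,
  because the sets obtained here become branch sets and their total number of vertices is what has
  to be paid for.\<close>

definition diam_le :: "('a \<Rightarrow> 'a \<Rightarrow> bool) \<Rightarrow> 'a set \<Rightarrow> nat \<Rightarrow> bool" where
  "diam_le E U b \<longleftrightarrow>
     (\<forall>x\<in>U. \<forall>y\<in>U. \<exists>P\<subseteq>U. finite P \<and> conn E P \<and> x \<in> P \<and> y \<in> P \<and> card P \<le> b)"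

lemma diam_le_join:
  assumes "diam_le E U b" "finite Y" "Y \<noteq> {}" "Y \<subseteq> U"
  shows "\<exists>C\<subseteq>U. Y \<subseteq> C \<and> finite C \<and> conn E C \<and> card C \<le> b * card Y"
  using assms(2-4)
proof (induction rule: finite_ne_induct)
  case (singleton x)
  then have "x \<in> U" by simp
  then obtain P where "P \<subseteq> U" "finite P" "conn E P" "x \<in> P" "card P \<le> b"
    using assms(1) unfolding diam_le_def by metis
  then show ?case by (intro exI[of _ P]) auto
next
  case (insert x F)
  then obtain C where C: "C \<subseteq> U" "F \<subseteq> C" "finite C" "conn E C" "card C \<le> b * card F" by auto
  obtain y where y: "y \<in> F" using insert by blast
  obtain P where P: "P \<subseteq> U" "finite P" "conn E P" "x \<in> P" "y \<in> P" "card P \<le> b"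
    using assms(1) y insert.prems unfolding diam_le_def by (meson insert_subset subsetD)
  have "conn E (C \<union> P)" using C P y by (intro conn_Un) auto
  moreover have "card (C \<union> P) \<le> b * card (insert x F)"
    using card_Un_le[of C P] C P insert by simp
  ultimately show ?case using C P by (intro exI[of _ "C \<union> P"]) auto
qed

text \<open>Every three steps the ball around x gains d vertices unless it is everything already, so
  radius 3(q + 1) reaches all of U, which has at most q d vertices. A connecting set then has at
  most 3(q + 1) + 1 = 3q + 4 vertices.\<close>

lemma diam_le_min_degree:
  fixes d :: real
  assumes "finite U" "symp E" "conn E U" "d > 0" and q: "real (card U) \<le> real q * d"
    and deg: "\<And>x. x \<in> U \<Longrightarrow> d \<le> card {y \<in> U. E x y}"
  shows "diam_le E U (3 * q + 4)"
  unfolding diam_le_def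
proof (intro ballI)
  fix x y assume xy: "x \<in> U" "y \<in> U"
  let ?B = "nball E U x"
  have fB: "finite (?B i)" for i using nball_subset[OF xy(1)] assms(1) finite_subset by metis
  have sub: "?B i \<subseteq> U" for i using nball_subset[OF xy(1)] by metis
  \<comment> \<open>A vertex z at distance exactly i + 2 has all its neighbours in the ball of
    radius i + 3 and none in the ball of radius i.\<close>
  have step: "?B (i + 3) = U \<or> card (?B i) + d \<le> card (?B (i + 3))" for i
  proof (cases "?B (i + 1) = U")
    case True
    moreover have "?B (i + 1) \<subseteq> ?B (i + 3)" by (auto simp: eval_nat_numeral)
    ultimately show ?thesis using sub[of "i + 3"] by blast
  next
    case False
    then obtain u z where uz: "u \<in> ?B (i + 1)" "z \<in> U" "z \<notin> ?B (i + 1)" "E u z"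
      using connD[OF assms(3) sub[of "i + 1"]] nball_centre[of x E U "i + 1"] by blast
    have z2: "z \<in> ?B (i + 2)" using uz by auto
    have N: "{w \<in> U. E z w} \<subseteq> ?B (i + 3)" using z2 by (auto simp: eval_nat_numeral)
    have disj: "{w \<in> U. E z w} \<inter> ?B i = {}"
    proof -
      have False if "E z w" "w \<in> ?B i" for w
        using uz that assms(2) by (auto dest: sympD)
      then show ?thesis by blast
    qed
    have "?B i \<union> {w \<in> U. E z w} \<subseteq> ?B (i + 3)" using N by (auto simp: eval_nat_numeral)
    from card_mono[OF fB this] have "card (?B i) + card {w \<in> U. E z w} \<le> card (?B (i + 3))"
      using disj fB assms(1) by (subst (asm) card_Un_disjoint) auto
    then show ?thesis using deg[OF uz(2)] by linarith
  qed
  have "?B (3 * j) = U \<or> real j * d \<le> card (?B (3 * j))" for j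
  proof (induction j)
    case (Suc j)
    show ?case
    proof (cases "?B (3 * j) = U")
      case True
      moreover have "?B (3 * j) \<subseteq> ?B (3 * Suc j)" by (auto simp: eval_nat_numeral)
      ultimately show ?thesis using sub[of "3 * Suc j"] by blast
    next
      case False
      then have *: "real j * d \<le> card (?B (3 * j))" using Suc by blast
      have "3 * j + 3 = 3 * Suc j" by simp
      with step[of "3 * j"] * show ?thesis by (auto simp: algebra_simps)
    qed
  qed auto
  from this[of "q + 1"] have "?B (3 * (q + 1)) = U"
  proof
    assume "real (q + 1) * d \<le> card (?B (3 * (q + 1)))"
    also have "\<dots> \<le> card U" using card_mono[OF assms(1) sub] by simp
    finally show ?thesis using q assms(4) by (simp add: algebra_simps)
  qed
  then have "y \<in> ?B (3 * (q + 1))" using xy by simp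
  from nball_conn[OF assms(2) xy(1) this]
  show "\<exists>P\<subseteq>U. finite P \<and> conn E P \<and> x \<in> P \<and> y \<in> P \<and> card P \<le> 3 * q + 4"
    by (simp add: algebra_simps)
qed

section \<open>Minor models\<close>

definition adj :: "'a sgraph \<Rightarrow> 'a \<Rightarrow> 'a \<Rightarrow> bool" where
  "adj G u v \<longleftrightarrow> {u, v} \<in> edges G"

lemma adj_sym: "adj G u v \<Longrightarrow> adj G v u"
  unfolding adj_def by (simp add: insert_commute)

lemma symp_adj [simp]: "symp (adj G)"
  by (rule sympI) (rule adj_sym)

lemma adj_simple:
  assumes "simple_graph G" "adj G u v"
  shows "u \<in> verts G" "v \<in> verts G" "u \<noteq> v"
  using assms unfolding adj_def simple_graph_def by fastforce+

text \<open>The usual branch sets. Nonemptiness is demanded separately because the empty set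
  satisfies \<open>conn\<close>. All minors are constructed in this form, and models compose by
  \<open>minor_model_trans\<close>, which makes it easier to handle than sequences of
  operations.\<close>

definition minor_model :: "'a sgraph \<Rightarrow> 'b sgraph \<Rightarrow> ('b \<Rightarrow> 'a set) \<Rightarrow> bool" where
  "minor_model G H \<phi> \<longleftrightarrow>
     (\<forall>x\<in>verts H. \<phi> x \<subseteq> verts G \<and> \<phi> x \<noteq> {} \<and> conn (adj G) (\<phi> x)) \<and>
     (\<forall>x\<in>verts H. \<forall>y\<in>verts H. x \<noteq> y \<longrightarrow> \<phi> x \<inter> \<phi> y = {}) \<and>
     (\<forall>x\<in>verts H. \<forall>y\<in>verts H. adj H x y \<longrightarrow> (\<exists>u\<in>\<phi> x. \<exists>v\<in>\<phi> y. adj G u v))"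

lemma minor_modelI:
  assumes "\<And>x. x \<in> verts H \<Longrightarrow> \<phi> x \<subseteq> verts G" "\<And>x. x \<in> verts H \<Longrightarrow> \<phi> x \<noteq> {}"
    "\<And>x. x \<in> verts H \<Longrightarrow> conn (adj G) (\<phi> x)"
    "\<And>x y. x \<in> verts H \<Longrightarrow> y \<in> verts H \<Longrightarrow> x \<noteq> y \<Longrightarrow> \<phi> x \<inter> \<phi> y = {}"
    "\<And>x y. x \<in> verts H \<Longrightarrow> y \<in> verts H \<Longrightarrow> adj H x y \<Longrightarrow> \<exists>u\<in>\<phi> x. \<exists>v\<in>\<phi> y. adj G u v"
  shows "minor_model G H \<phi>"
  using assms unfolding minor_model_def by blast

lemma minor_modelD:
  assumes "minor_model G H \<phi>"
  shows "\<And>x. x \<in> verts H \<Longrightarrow> \<phi> x \<subseteq> verts G" "\<And>x. x \<in> verts H \<Longrightarrow> \<phi> x \<noteq> {}"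
    "\<And>x. x \<in> verts H \<Longrightarrow> conn (adj G) (\<phi> x)"
    "\<And>x y. x \<in> verts H \<Longrightarrow> y \<in> verts H \<Longrightarrow> x \<noteq> y \<Longrightarrow> \<phi> x \<inter> \<phi> y = {}"
    "\<And>x y. x \<in> verts H \<Longrightarrow> y \<in> verts H \<Longrightarrow> adj H x y \<Longrightarrow> \<exists>u\<in>\<phi> x. \<exists>v\<in>\<phi> y. adj G u v"
  using assms unfolding minor_model_def by blast+

lemma minor_model_trans:
  assumes \<psi>: "minor_model G H \<psi>" and \<phi>: "minor_model H K \<phi>"
  shows "minor_model G K (\<lambda>x. \<Union>y\<in>\<phi> x. \<psi> y)"
proof (rule minor_modelI)
  fix x assume x: "x \<in> verts K"
  have s: "\<phi> x \<subseteq> verts H" using minor_modelD(1)[OF \<phi> x] .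
  show "(\<Union>y\<in>\<phi> x. \<psi> y) \<subseteq> verts G" using s minor_modelD(1)[OF \<psi>] by blast
  show "(\<Union>y\<in>\<phi> x. \<psi> y) \<noteq> {}" using s minor_modelD(2)[OF \<psi>] minor_modelD(2)[OF \<phi> x] by blast
  show "conn (adj G) (\<Union>y\<in>\<phi> x. \<psi> y)"
  proof (rule conn_UN_blowup[OF minor_modelD(3)[OF \<phi> x]])
    fix y z assume "y \<in> \<phi> x" "z \<in> \<phi> x" "adj H y z"
    then show "\<exists>u\<in>\<psi> y. \<exists>v\<in>\<psi> z. adj G u v" using s minor_modelD(5)[OF \<psi>] by blast
  qed (use s minor_modelD(2,3)[OF \<psi>] in blast)+
next
  fix x y assume xy: "x \<in> verts K" "y \<in> verts K" "x \<noteq> y"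
  have "\<psi> u \<inter> \<psi> v = {}" if "u \<in> \<phi> x" "v \<in> \<phi> y" for u v
  proof -
    have "u \<in> verts H" "v \<in> verts H" "u \<noteq> v"
      using that minor_modelD(1,4)[OF \<phi>] xy by blast+
    then show ?thesis by (rule minor_modelD(4)[OF \<psi>])
  qed
  then show "(\<Union>y\<in>\<phi> x. \<psi> y) \<inter> (\<Union>y\<in>\<phi> y. \<psi> y) = {}" by blast
next
  fix x y assume xy: "x \<in> verts K" "y \<in> verts K" "adj K x y"
  then obtain u v where uv: "u \<in> \<phi> x" "v \<in> \<phi> y" "adj H u v" using minor_modelD(5)[OF \<phi>] by blast
  then have "u \<in> verts H" "v \<in> verts H" using minor_modelD(1)[OF \<phi>] xy by blast+
  from minor_modelD(5)[OF \<psi> this uv(3)] uv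
  show "\<exists>u\<in>\<Union>y\<in>\<phi> x. \<psi> y. \<exists>v\<in>\<Union>y\<in>\<phi> y. \<psi> y. adj G u v" by blast
qed

section \<open>Branch sets versus deletions and contractions\<close>

lemma minor_model_subgraph:
  assumes "verts H \<subseteq> verts G" "edges H \<subseteq> edges G"
  shows "minor_model G H (\<lambda>x. {x})"
  using assms by (intro minor_modelI) (auto simp: adj_def)

lemma simple_contract:
  assumes "simple_graph G" "{u, v} \<in> edges G"
  shows "simple_graph (contract_edge G u v)"
proof -
  have uv: "u \<in> verts G" "v \<in> verts G" "u \<noteq> v" using adj_simple[OF assms(1)] assms(2) by (auto simp: adj_def)
  have "e \<subseteq> verts G - {v} \<and> card e = 2" if e: "e \<in> edges (contract_edge G u v)" for e
  proof -
    consider "e \<in> edges G" "v \<notin> e" | w where "e = {u, w}" "{v, w} \<in> edges G" "w \<noteq> u"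
      using e unfolding contract_edge_def by auto
    then show ?thesis
    proof cases
      case 1
      then show ?thesis using assms(1) unfolding simple_graph_def by blast
    next
      case 2
      then show ?thesis using adj_simple[OF assms(1), of v w] uv by (auto simp: adj_def)
    qed
  qed
  moreover have "finite (verts (contract_edge G u v))"
    using assms(1) by (simp add: contract_edge_def simple_graph_def)
  ultimately show ?thesis unfolding simple_graph_def by (simp add: contract_edge_def)
qed

lemma minor_model_contract:
  assumes "simple_graph G" "{u, v} \<in> edges G"
  shows "minor_model G (contract_edge G u v) (\<lambda>x. if x = u then {u, v} else {x})"
proof -
  have uv: "u \<in> verts G" "v \<in> verts G" "u \<noteq> v" "adj G u v"
    using adj_simple[OF assms(1)] assms(2) by (auto simp: adj_def)
  show ?thesis
  proof (rule minor_modelI)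
    fix x y assume "x \<in> verts (contract_edge G u v)" "y \<in> verts (contract_edge G u v)"
      "adj (contract_edge G u v) x y"
    then consider "adj G x y" | w where "{x, y} = {u, w}" "adj G v w"
      unfolding contract_edge_def adj_def by auto
    then show "\<exists>ua\<in>if x = u then {u, v} else {x}. \<exists>va\<in>if y = u then {u, v} else {y}. adj G ua va"
    proof cases
      case 1
      then show ?thesis by auto
    next
      case 2
      then have "x = u \<and> y = w \<or> x = w \<and> y = u" by (auto simp: doubleton_eq_iff)
      then show ?thesis using 2(2) by (auto intro: adj_sym)
    qed
  qed (use uv in \<open>auto simp: contract_edge_def intro!: conn_edge intro: adj_sym\<close>)
qed

lemma minor_step_model:
  assumes "minor_step G H" "simple_graph G"
  shows "simple_graph H \<and> (\<exists>\<phi>. minor_model G H \<phi>)"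
  using assms
proof cases
  case (vertex_deletion v)
  then show ?thesis using minor_model_subgraph[of H G] assms(2)
    by (auto simp: del_vertex_def simple_graph_def)
next
  case (edge_deletion e)
  then show ?thesis using minor_model_subgraph[of H G] assms(2)
    by (auto simp: del_edge_def simple_graph_def)
next
  case (edge_contraction u v)
  show ?thesis unfolding edge_contraction(1)
    using simple_contract[OF assms(2) edge_contraction(2)]
      minor_model_contract[OF assms(2) edge_contraction(2)] by (intro conjI exI)
qed

lemma minor_steps_model:
  assumes "minor_step\<^sup>*\<^sup>* G H" "simple_graph G"
  shows "simple_graph H \<and> (\<exists>\<phi>. minor_model G H \<phi>)"
  using assms
proof (induction rule: rtranclp_induct)
  case base
  then show ?case using minor_model_subgraph[of G G] by blast
next
  case (step y z)
  then show ?case using minor_step_model[of y z] minor_model_trans by blast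
qed

text \<open>This direction serves the lower bound, where a hypothetical minor of a complete
  bipartite graph has to be analysed through its branch sets.\<close>

lemma has_minor_imp_model:
  assumes "G \<succ> H" "simple_graph G"
  shows "\<exists>\<phi>. minor_model G H \<phi>"
proof -
  obtain H' f where H': "minor_step\<^sup>*\<^sup>* G H'" "bij_betw f (verts H') (verts H)"
      "edges H = (\<lambda>e. f ` e) ` edges H'"
    using assms(1) unfolding has_minor_def graph_iso_def by blast
  obtain \<psi> where s: "simple_graph H'" and \<psi>: "minor_model G H' \<psi>"
    using minor_steps_model[OF H'(1) assms(2)] by blast
  let ?g = "inv_into (verts H') f"
  have g: "?g (f a) = a" if "a \<in> verts H'" for a using H'(2) that by (simp add: bij_betw_def)
  have fg: "f (?g x) = x" "?g x \<in> verts H'" if "x \<in> verts H" for x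
    using H'(2) that by (auto simp: bij_betw_def f_inv_into_f inv_into_into)
  have "minor_model H' H (\<lambda>x. {?g x})"
  proof (rule minor_modelI)
    fix x y assume xy: "x \<in> verts H" "y \<in> verts H" "adj H x y"
    then obtain e where e: "e \<in> edges H'" "{x, y} = f ` e" using H'(3) by (auto simp: adj_def)
    have "e \<subseteq> verts H'" using e s unfolding simple_graph_def by blast
    then have "?g ` (f ` e) = e" using g by (force simp: image_iff)
    then have "{?g x, ?g y} = e" using e(2)[symmetric] by auto
    then show "\<exists>u\<in>{?g x}. \<exists>v\<in>{?g y}. adj H' u v" using e by (auto simp: adj_def)
  next
    fix x y assume "x \<in> verts H" "y \<in> verts H" "x \<noteq> y"
    then show "{?g x} \<inter> {?g y} = {}" using fg by (metis Int_empty_right Int_insert_right_if0 singletonD)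
  qed (use fg in auto)
  then show ?thesis using minor_model_trans[OF \<psi>] by blast
qed

text \<open>Renaming v to u maps the old edges onto a superset of the new ones. The contracted edge
  itself becomes \<open>{u}\<close>, which is harmless because only a covering is needed.\<close>

lemma card_edges_contract_le:
  assumes "simple_graph G"
  shows "card (edges (contract_edge G u v)) \<le> card (edges G)"
proof -
  have "finite (edges G)"
    using assms unfolding simple_graph_def by (auto intro: finite_subset[of _ "Pow (verts G)"])
  moreover have "edges (contract_edge G u v) \<subseteq> (\<lambda>e. if v \<in> e then insert u (e - {v}) else e) ` edges G"
  proof
    fix f assume "f \<in> edges (contract_edge G u v)"
    then consider "f \<in> edges G" "v \<notin> f" | w where "f = {u, w}" "{v, w} \<in> edges G" "w \<noteq> u"
      unfolding contract_edge_def by auto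
    then show "f \<in> (\<lambda>e. if v \<in> e then insert u (e - {v}) else e) ` edges G"
    proof cases
      case 1
      then show ?thesis by (intro image_eqI[of _ _ f]) auto
    next
      case 2
      moreover have "w \<noteq> v" using adj_simple[OF assms, of v w] 2 by (auto simp: adj_def)
      ultimately show ?thesis by (intro image_eqI[of _ _ "{v, w}"]) auto
    qed
  qed
  ultimately show ?thesis by (meson surj_card_le)
qed

text \<open>Induction on the number of vertices and edges of G. A vertex outside all branch sets can
  be deleted; a branch set with two vertices contains an edge, which can be contracted; if all
  branch sets are singletons covering G, an edge that does not come from H can be deleted. When
  nothing applies, G is isomorphic to H.\<close>

lemma minor_model_imp_has_minor:
  assumes "minor_model G H \<phi>" "simple_graph G" "simple_graph H"
  shows "G \<succ> H"
  using assms(1,2)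
proof (induction "card (verts G) + card (edges G)" arbitrary: G \<phi> rule: less_induct)
  case less
  note m = minor_modelD[OF less.prems(1)]
  have fV: "finite (verts G)" and fE: "finite (edges G)"
    using less.prems(2) unfolding simple_graph_def
    by (auto intro: finite_subset[of _ "Pow (verts G)"])
  have step: "G \<succ> H" if "minor_step G G'" "minor_model G' H \<phi>'"
      "card (verts G') + card (edges G') < card (verts G) + card (edges G)" for G' \<phi>'
  proof -
    have "G' \<succ> H" using less.hyps[OF that(3,2)] minor_step_model[OF that(1) less.prems(2)] by blast
    then show ?thesis using that(1) unfolding has_minor_def by (meson converse_rtranclp_into_rtranclp)
  qed
  consider v where "v \<in> verts G" "v \<notin> (\<Union>x\<in>verts H. \<phi> x)"
    | x u v where "x \<in> verts H" "u \<in> \<phi> x" "v \<in> \<phi> x" "u \<noteq> v"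
    | "verts G = (\<Union>x\<in>verts H. \<phi> x)" "\<And>x u v. x \<in> verts H \<Longrightarrow> u \<in> \<phi> x \<Longrightarrow> v \<in> \<phi> x \<Longrightarrow> u = v"
    using m(1) by blast
  then show ?case
  proof cases
    case 1
    let ?G = "del_vertex G v"
    have "v \<notin> \<phi> x" if "x \<in> verts H" for x using 1 that by blast
    then have "minor_model ?G H \<phi>"
    proof (intro minor_modelI)
      fix x assume x: "x \<in> verts H"
      show "conn (adj ?G) (\<phi> x)"
        by (rule conn_mono[OF m(3)[OF x]]) (use 1 x in \<open>auto simp: adj_def del_vertex_def\<close>)
    next
      fix x y assume xy: "x \<in> verts H" "y \<in> verts H" "adj H x y"
      then show "\<exists>u\<in>\<phi> x. \<exists>v\<in>\<phi> y. adj ?G u v"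
        using m(5)[OF xy] 1 by (force simp: adj_def del_vertex_def)
    next
      fix x assume "x \<in> verts H"
      then show "\<phi> x \<subseteq> verts ?G" using m(1)[of x] 1 by (auto simp: del_vertex_def)
    qed (use m in auto)
    moreover have "card (verts ?G) + card (edges ?G) < card (verts G) + card (edges G)"
      using card_mono[OF fE, of "edges ?G"] card_Diff1_less[OF fV 1(1)]
      by (simp add: del_vertex_def)
    ultimately show ?thesis using step minor_step.vertex_deletion[OF 1(1)] by blast
  next
    case 2
    have "\<exists>a\<in>{u}. \<exists>b\<in>\<phi> x - {u}. adj G a b" by (rule connD[OF m(3)[OF 2(1)]]) (use 2 in auto)
    then obtain b where b: "b \<in> \<phi> x" "b \<noteq> u" "adj G u b" by blast
    let ?G = "contract_edge G u b" and ?\<psi> = "\<lambda>y. \<phi> y - {b}"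
    have e: "{u, b} \<in> edges G" using b by (simp add: adj_def)
    have ub: "u \<in> verts G" "b \<in> verts G" using 2 b m(1) by blast+
    have bx: "b \<notin> \<phi> y" "u \<notin> \<phi> y" if "y \<in> verts H" "y \<noteq> x" for y using m(4)[OF that(1) 2(1)] that b 2 by auto
    have keep: "adj ?G p q" if "adj G p q" "p \<noteq> b" "q \<noteq> b" for p q
      using that by (auto simp: adj_def contract_edge_def)
    have moved: "adj ?G u q" if "adj G b q" "q \<noteq> u" for q
      using that by (auto simp: adj_def contract_edge_def)
    have "minor_model ?G H ?\<psi>"
    proof (rule minor_modelI)
      fix y assume y: "y \<in> verts H"
      show "?\<psi> y \<subseteq> verts ?G" using m(1)[OF y] by (auto simp: contract_edge_def)
      show "?\<psi> y \<noteq> {}"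
      proof (cases "y = x")
        case True then show ?thesis using b 2 by blast
      next
        case False then show ?thesis using bx[OF y] m(2)[OF y] by auto
      qed
      show "conn (adj ?G) (?\<psi> y)"
      proof (cases "y = x")
        case False
        then have "?\<psi> y = \<phi> y" using bx[OF y] by blast
        then show ?thesis using conn_mono[OF m(3)[OF y], of "adj ?G"] keep bx[OF y False] by metis
      next
        case True
        have "conn (adj ?G) (\<Union>z\<in>\<phi> x. {if z = b then u else z})"
        proof -
          \<comment> \<open>The edge between u and b is mapped to the pair (u, u), so connectivity
            is first shown for the reflexive closure.\<close>
          let ?E = "\<lambda>p q. adj ?G p q \<or> p = q"
          have "conn ?E (\<Union>z\<in>\<phi> x. {if z = b then u else z})"
          proof (rule conn_UN_blowup[OF m(3)[OF 2(1)]])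
            fix p q assume pq: "adj G p q"
            have "?E (if p = b then u else p) (if q = b then u else q)"
              using pq keep[OF pq] moved[of q] adj_sym[OF moved[of p]] adj_sym[OF pq]
              by (cases "p = b"; cases "q = b"; cases "q = u"; cases "p = u"; simp)
            then show "\<exists>ua\<in>{if p = b then u else p}. \<exists>v\<in>{if q = b then u else q}. ?E ua v" by blast
          qed auto
          then show ?thesis by (rule conn_irrefl)
        qed
        moreover have "(\<Union>z\<in>\<phi> x. {if z = b then u else z}) = ?\<psi> x"
          using 2 b by (auto split: if_splits)
        ultimately show ?thesis using True by simp
      qed
    next
      fix y z assume yz: "y \<in> verts H" "z \<in> verts H" "adj H y z"
      obtain p q where pq: "p \<in> \<phi> y" "q \<in> \<phi> z" "adj G p q" using m(5)[OF yz] by blast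
      have "y \<noteq> z" using adj_simple[OF assms(3) yz(3)] by blast
      show "\<exists>u\<in>?\<psi> y. \<exists>v\<in>?\<psi> z. adj ?G u v"
      proof (cases "p = b \<or> q = b")
        case False
        then show ?thesis using keep[OF pq(3)] pq by blast
      next
        case True
        then show ?thesis
        proof
          assume "p = b"
          then have "y = x" using bx pq yz by blast
          then have "q \<noteq> b" "q \<noteq> u" using bx[OF yz(2)] \<open>y \<noteq> z\<close> pq by auto
          then show ?thesis using moved[of q] pq \<open>p = b\<close> \<open>y = x\<close> 2 b by blast
        next
          assume "q = b"
          then have "z = x" using bx pq yz by blast
          then have "p \<noteq> b" "p \<noteq> u" using bx[OF yz(1)] \<open>y \<noteq> z\<close> pq by auto
          then show ?thesis using adj_sym[OF moved[of p]] adj_sym[OF pq(3)] pq \<open>q = b\<close> \<open>z = x\<close> 2 b by blast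
        qed
      qed
    next
      fix y z assume "y \<in> verts H" "z \<in> verts H" "y \<noteq> z"
      then show "?\<psi> y \<inter> ?\<psi> z = {}" using m(4) by blast
    qed
    moreover have "card (verts ?G) + card (edges ?G) < card (verts G) + card (edges G)"
    proof -
      have "card (verts ?G) < card (verts G)"
        using card_Diff1_less[OF fV ub(2)] by (simp add: contract_edge_def)
      then show ?thesis using card_edges_contract_le[OF less.prems(2), of u b] by linarith
    qed
    ultimately show ?thesis using step minor_step.edge_contraction[OF e] by blast
  next
    case 3
    have "\<forall>x\<in>verts H. \<exists>v. v \<in> \<phi> x" using m(2) by blast
    then obtain g where g: "\<And>x. x \<in> verts H \<Longrightarrow> g x \<in> \<phi> x" by (metis bchoice)
    have \<phi>g: "\<phi> x = {g x}" if "x \<in> verts H" for x using g[OF that] 3(2)[OF that] by auto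
    have inj: "inj_on g (verts H)" using m(4) \<phi>g by (auto intro!: inj_onI)
    have img: "g ` verts H = verts G" using 3(1) \<phi>g by auto
    have sub: "(\<lambda>e. g ` e) ` edges H \<subseteq> edges G"
    proof
      fix f assume "f \<in> (\<lambda>e. g ` e) ` edges H"
      then obtain e where e: "e \<in> edges H" "f = g ` e" by blast
      then obtain x y where xy: "e = {x, y}" "x \<in> verts H" "y \<in> verts H"
        using assms(3) unfolding simple_graph_def card_2_iff by (metis insert_subset)
      then have "adj G (g x) (g y)" using m(5)[of x y] e \<phi>g by (auto simp: adj_def)
      then show "f \<in> edges G" using e xy by (simp add: adj_def)
    qed
    show ?thesis
    proof (cases "edges G = (\<lambda>e. g ` e) ` edges H")
      case True
      let ?i = "inv_into (verts H) g"
      have "edges H = (\<lambda>e. ?i ` e) ` edges G"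
      proof -
        have "?i ` (g ` e) = e" if "e \<in> edges H" for e
          using that inj assms(3) unfolding simple_graph_def by (intro inv_into_image_cancel) auto
        then show ?thesis unfolding True by (force simp: image_iff)
      qed
      moreover have "bij_betw ?i (verts G) (verts H)"
        using inj img by (metis bij_betw_imageI bij_betw_inv_into)
      ultimately have "graph_iso G H" unfolding graph_iso_def by blast
      then show ?thesis unfolding has_minor_def by blast
    next
      case False
      then obtain f where f: "f \<in> edges G" "f \<notin> (\<lambda>e. g ` e) ` edges H" using sub by blast
      have "minor_model (del_edge G f) H \<phi>"
      proof (rule minor_modelI)
        fix x y assume xy: "x \<in> verts H" "y \<in> verts H" "adj H x y"
        then have "g ` {x, y} \<in> (\<lambda>e. g ` e) ` edges H" unfolding adj_def by blast
        then have "g ` {x, y} \<in> edges G - {f}" using sub f by blast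
        then show "\<exists>u\<in>\<phi> x. \<exists>v\<in>\<phi> y. adj (del_edge G f) u v"
          using \<phi>g xy by (simp add: adj_def del_edge_def)
      qed (use m \<phi>g in \<open>auto simp: del_edge_def\<close>)
      moreover have "card (verts (del_edge G f)) + card (edges (del_edge G f)) < card (verts G) + card (edges G)"
        using card_Diff1_less[OF fE f(1)] by (simp add: del_edge_def)
      ultimately show ?thesis using step minor_step.edge_deletion[OF f(1)] by blast
    qed
  qed
qed

section \<open>Menger's theorem\<close>

text \<open>Arcs are directed, since the induction for Menger's theorem removes one orientation at a
  time; an undirected graph enters through its symmetric set of arcs. Repeated vertices on a walk do
  no harm, as only distinct walks have to be disjoint.\<close>

definition walk :: "('a \<times> 'a) set \<Rightarrow> 'a list \<Rightarrow> bool" where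
  "walk E p \<longleftrightarrow> p \<noteq> [] \<and> successively (\<lambda>x y. (x, y) \<in> E) p"

definition walk_between :: "('a \<times> 'a) set \<Rightarrow> 'a set \<Rightarrow> 'a set \<Rightarrow> 'a list \<Rightarrow> bool" where
  "walk_between E A B p \<longleftrightarrow> walk E p \<and> hd p \<in> A \<and> last p \<in> B"

definition separates :: "('a \<times> 'a) set \<Rightarrow> 'a set \<Rightarrow> 'a set \<Rightarrow> 'a set \<Rightarrow> bool" where
  "separates E A B S \<longleftrightarrow> (\<forall>p. walk_between E A B p \<longrightarrow> set p \<inter> S \<noteq> {})"

definition disjoint_walks :: "('a \<times> 'a) set \<Rightarrow> 'a set \<Rightarrow> 'a set \<Rightarrow> 'a list set \<Rightarrow> bool" where
  "disjoint_walks E A B Ps \<longleftrightarrow> (\<forall>p\<in>Ps. walk_between E A B p) \<and>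
     (\<forall>p\<in>Ps. \<forall>q\<in>Ps. p \<noteq> q \<longrightarrow> set p \<inter> set q = {})"

text \<open>A shortest walk has this property. It keeps walks from meeting their end sets in inner
  vertices, which both the gluing in Menger's theorem and the later contraction of linking walks
  rely on.\<close>

definition trimmed :: "'a set \<Rightarrow> 'a set \<Rightarrow> 'a list \<Rightarrow> bool" where
  "trimmed A B p \<longleftrightarrow> set (tl p) \<inter> A = {} \<and> set (butlast p) \<inter> B = {}"

lemma walk_suffix: "walk E (p @ z # q) \<Longrightarrow> walk E (z # q)"
  unfolding walk_def by (simp add: successively_append_iff)

lemma walk_prefix: "walk E (p @ z # q) \<Longrightarrow> walk E (p @ [z])"
  unfolding walk_def by (cases p rule: rev_cases) (auto simp: successively_append_iff successively_Cons)

lemma walk_join: "walk E (p @ [z]) \<Longrightarrow> walk E (z # q) \<Longrightarrow> walk E (p @ z # q)"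
  unfolding walk_def by (auto simp: successively_append_iff)

lemma walk_append: "walk E p \<Longrightarrow> walk E q \<Longrightarrow> (last p, hd q) \<in> E \<Longrightarrow> walk E (p @ q)"
  unfolding walk_def by (auto simp: successively_append_iff)

lemma walk_mono: "walk E p \<Longrightarrow> E \<subseteq> E' \<Longrightarrow> walk E' p"
  unfolding walk_def by (auto intro: successively_mono)

lemma walk_trim:
  assumes "walk_between E A B p"
  shows "\<exists>q. walk_between E A B q \<and> set q \<subseteq> set p \<and> trimmed A B q"
proof -
  let ?P = "\<lambda>q. walk_between E A B q \<and> set q \<subseteq> set p"
  obtain q where q: "?P q" and min: "\<And>r. ?P r \<Longrightarrow> length q \<le> length r"
    using ex_has_least_nat[of ?P p length] assms by auto
  have ne: "q \<noteq> []" using q unfolding walk_between_def walk_def by blast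
  have "z \<notin> A" if z: "z \<in> set (tl q)" for z
  proof
    assume "z \<in> A"
    obtain a q' where aq: "q = a # q'" using ne by (cases q) auto
    then obtain q1 q2 where q12: "q' = q1 @ z # q2" using z split_list[of z q'] by auto
    have "?P (z # q2)"
      using q walk_suffix[of E "a # q1" z q2] \<open>z \<in> A\<close> unfolding walk_between_def aq q12 by auto
    from min[OF this] show False unfolding aq q12 by simp
  qed
  moreover have "z \<notin> B" if z: "z \<in> set (butlast q)" for z
  proof
    assume "z \<in> B"
    obtain a q' where aq: "q = q' @ [a]" using ne by (cases q rule: rev_cases) auto
    then obtain q1 q2 where q12: "q' = q1 @ z # q2" using z split_list[of z q'] by auto
    have "?P (q1 @ [z])"
      using q walk_prefix[of E q1 z "q2 @ [a]"] \<open>z \<in> B\<close> unfolding walk_between_def aq q12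
      by (cases q1) auto
    from min[OF this] show False unfolding aq q12 by simp
  qed
  ultimately show ?thesis using q unfolding trimmed_def by blast
qed

lemma disjoint_walks_trim:
  assumes "disjoint_walks E A B (r ` I)" "\<And>i j. i \<in> I \<Longrightarrow> j \<in> I \<Longrightarrow> i \<noteq> j \<Longrightarrow> set (r i) \<inter> set (r j) = {}"
    and "finite I"
  shows "\<exists>Ps. finite Ps \<and> card Ps = card I \<and> disjoint_walks E A B Ps \<and> (\<forall>p\<in>Ps. trimmed A B p)"
proof -
  have "\<forall>i\<in>I. \<exists>q. walk_between E A B q \<and> set q \<subseteq> set (r i) \<and> trimmed A B q"
    using assms(1) walk_trim unfolding disjoint_walks_def by (metis imageI)
  then obtain f where f: "\<And>i. i \<in> I \<Longrightarrow> walk_between E A B (f i) \<and> set (f i) \<subseteq> set (r i) \<and> trimmed A B (f i)"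
    by (metis bchoice)
  have ne: "f i \<noteq> []" if "i \<in> I" for i using f[OF that] unfolding walk_between_def walk_def by blast
  have disj: "set (f i) \<inter> set (f j) = {}" if "i \<in> I" "j \<in> I" "i \<noteq> j" for i j
    using f[OF that(1)] f[OF that(2)] assms(2)[OF that] by blast
  have "inj_on f I"
  proof (rule inj_onI, rule ccontr)
    fix i j assume "i \<in> I" "j \<in> I" "f i = f j" "i \<noteq> j"
    then show False using disj[of i j] ne[of j] by simp
  qed
  then have "card (f ` I) = card I" by (rule card_image)
  moreover have "disjoint_walks E A B (f ` I)"
    unfolding disjoint_walks_def using f disj by fastforce
  ultimately show ?thesis using assms(3) f by (intro exI[of _ "f ` I"]) auto
qed

text \<open>Induction on the arcs, after Goering: if deleting an arc \<open>(x, y)\<close> creates a separator \<open>S\<close> of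
  size \<open>k - 1\<close>, then walks from \<open>A\<close> to \<open>S \<union> {x}\<close> and from \<open>S \<union> {y}\<close> to \<open>B\<close> avoiding the arc are glued
  together along \<open>S\<close> and the arc.\<close>

theorem menger:
  assumes "finite E" "finite A" "finite B"
    and "\<And>S. finite S \<Longrightarrow> separates E A B S \<Longrightarrow> k \<le> card S"
  shows "\<exists>Ps. finite Ps \<and> card Ps = k \<and> disjoint_walks E A B Ps \<and> (\<forall>p\<in>Ps. trimmed A B p)"
  using assms
proof (induction "card E" arbitrary: E A B rule: less_induct)
  case less
  show ?case
  proof (cases "E = {}")
    case True
    have sing: "p = [hd p]" if "walk E p" for p
      using that True unfolding walk_def by (cases p rule: list.exhaust; cases "tl p") (auto simp: successively_Cons)
    \<comment> \<open>Without arcs every walk is a single vertex, so the common vertices form a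
      separator and also supply the disjoint walks.\<close>
    have "separates E A B (A \<inter> B)"
      unfolding separates_def walk_between_def
    proof (intro allI impI)
      fix p assume p: "walk E p \<and> hd p \<in> A \<and> last p \<in> B"
      have "p = [hd p]" using sing p by blast
      then have "last p = hd p" by (metis last.simps)
      moreover have "hd p \<in> set p" using p unfolding walk_def by simp
      ultimately show "set p \<inter> (A \<inter> B) \<noteq> {}" using p by auto
    qed
    then have "k \<le> card (A \<inter> B)" using less.prems by blast
    then obtain C where C: "C \<subseteq> A \<inter> B" "card C = k" "finite C" by (meson obtain_subset_with_card_n)
    have "disjoint_walks E A B ((\<lambda>x. [x]) ` C)"
      using C unfolding disjoint_walks_def walk_between_def walk_def by auto
    from disjoint_walks_trim[OF this _ C(3)] C show ?thesis by auto
  next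
    case False
    then obtain x y where xy: "(x, y) \<in> E" by auto
    define E' where "E' = E - {(x, y)}"
    have E': "finite E'" "card E' < card E" "E' \<subseteq> E"
      using less.prems(1) card_Diff1_less[OF less.prems(1) xy] unfolding E'_def by auto
    show ?thesis
    proof (cases "\<forall>S. finite S \<longrightarrow> separates E' A B S \<longrightarrow> k \<le> card S")
      case True
      then obtain Ps where Ps: "finite Ps" "card Ps = k" "disjoint_walks E' A B Ps" "\<forall>p\<in>Ps. trimmed A B p"
        using less.hyps[OF E'(2,1) less.prems(2,3)] by blast
      then have "disjoint_walks E A B Ps"
        using walk_mono[OF _ E'(3)] unfolding disjoint_walks_def walk_between_def by blast
      then show ?thesis using Ps by blast
    next
      case False
      then obtain S where S: "finite S" "separates E' A B S" "card S < k" by auto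
      \<comment> \<open>A walk destroyed by the deletion traverses the arc from x to y
        somewhere.\<close>
      have uses: "\<exists>p1 p2. p = p1 @ x # y # p2" if "walk E p" "\<not> walk E' p" for p
      proof -
        have "\<not> successively (\<lambda>u v. (u, v) \<in> E') p" "successively (\<lambda>u v. (u, v) \<in> E) p"
          using that unfolding walk_def by auto
        then show ?thesis
        proof (induction p)
          case (Cons a p)
          show ?case
          proof (cases p)
            case Nil then show ?thesis using Cons by simp
          next
            case (Cons b p')
            show ?thesis
            proof (cases "(a, b) = (x, y)")
              case True
              then have "a # p = [] @ x # y # p'" using Cons by simp
              then show ?thesis by blast
            next
              case False
              then have "\<not> successively (\<lambda>u v. (u, v) \<in> E') p" "successively (\<lambda>u v. (u, v) \<in> E) p"
                using Cons.prems Cons unfolding E'_def by auto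
              from Cons.IH[OF this] obtain p1 p2 where "p = p1 @ x # y # p2" by blast
              then have "a # p = (a # p1) @ x # y # p2" by simp
              then show ?thesis by blast
            qed
          qed
        qed simp
      qed
      \<comment> \<open>Every walk from A to B has an initial part that ends in S or in x. Once
        trimmed, this part can contain x only as its last vertex, so it does not use the deleted arc
        and must meet T. The mirror image gives \<open>sepy\<close>.\<close>
      have sepx: "separates E A B T" if T: "separates E' A (insert x S) T" for T
        unfolding separates_def
      proof (intro allI impI)
        fix p assume p: "walk_between E A B p"
        have "\<exists>q. walk_between E A (insert x S) q \<and> set q \<subseteq> set p"
        proof (cases "walk E' p")
          case True
          then have "set p \<inter> S \<noteq> {}" using S(2) p unfolding separates_def walk_between_def by blast
          then obtain s where s: "s \<in> set p" "s \<in> S" by blast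
          then obtain p1 p2 where p12: "p = p1 @ s # p2" using split_list by metis
          have "hd (p1 @ [s]) = hd p" unfolding p12 by (cases p1) auto
          then show ?thesis using p walk_prefix[of E p1 s p2] s unfolding walk_between_def p12
            by (intro exI[of _ "p1 @ [s]"]) auto
        next
          case False
          then obtain p1 p2 where p12: "p = p1 @ x # y # p2" using uses p unfolding walk_between_def by blast
          have "hd (p1 @ [x]) = hd p" unfolding p12 by (cases p1) auto
          then show ?thesis using p walk_prefix[of E p1 x "y # p2"] unfolding walk_between_def p12
            by (intro exI[of _ "p1 @ [x]"]) auto
        qed
        then obtain q0 where "walk_between E A (insert x S) q0" "set q0 \<subseteq> set p" by blast
        then obtain q where q: "walk_between E A (insert x S) q" "set q \<subseteq> set p" "trimmed A (insert x S) q"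
          using walk_trim by (metis subset_trans)
        have "walk E' q"
        proof (rule ccontr)
          assume "\<not> walk E' q"
          then obtain q1 q2 where "q = q1 @ x # y # q2" using uses q(1) unfolding walk_between_def by blast
          then show False using q(3) unfolding trimmed_def by (auto simp: butlast_append)
        qed
        then have "walk_between E' A (insert x S) q" using q(1) unfolding walk_between_def by blast
        then show "set p \<inter> T \<noteq> {}" using T q(2) unfolding separates_def by blast
      qed
      have sepy: "separates E A B T" if T: "separates E' (insert y S) B T" for T
        unfolding separates_def
      proof (intro allI impI)
        fix p assume p: "walk_between E A B p"
        have "\<exists>q. walk_between E (insert y S) B q \<and> set q \<subseteq> set p"
        proof (cases "walk E' p")
          case True
          then have "set p \<inter> S \<noteq> {}" using S(2) p unfolding separates_def walk_between_def by blast
          then obtain s where s: "s \<in> set p" "s \<in> S" by blast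
          then obtain p1 p2 where p12: "p = p1 @ s # p2" using split_list by metis
          then show ?thesis using p walk_suffix[of E p1 s p2] s unfolding walk_between_def p12
            by (intro exI[of _ "s # p2"]) auto
        next
          case False
          then obtain p1 p2 where p12: "p = p1 @ x # y # p2" using uses p unfolding walk_between_def by blast
          then show ?thesis using p walk_suffix[of E "p1 @ [x]" y p2] unfolding walk_between_def p12
            by (intro exI[of _ "y # p2"]) auto
        qed
        then obtain q0 where "walk_between E (insert y S) B q0" "set q0 \<subseteq> set p" by blast
        then obtain q where q: "walk_between E (insert y S) B q" "set q \<subseteq> set p" "trimmed (insert y S) B q"
          using walk_trim by (metis subset_trans)
        have "walk E' q"
        proof (rule ccontr)
          assume "\<not> walk E' q"
          then obtain q1 q2 where "q = q1 @ x # y # q2" using uses q(1) unfolding walk_between_def by blast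
          then show False using q(3) unfolding trimmed_def by (cases q1) auto
        qed
        then have "walk_between E' (insert y S) B q" using q(1) unfolding walk_between_def by blast
        then show "set p \<inter> T \<noteq> {}" using T q(2) unfolding separates_def by blast
      qed
      have self: "separates E' C D C" "separates E' C D D" for C D
        unfolding separates_def walk_between_def walk_def by (meson disjoint_iff hd_in_set last_in_set)+
      have "k \<le> card (insert x S)" "k \<le> card (insert y S)"
        using less.prems(4)[OF _ sepx[OF self(2)]] less.prems(4)[OF _ sepy[OF self(1)]] S(1) by auto
      \<comment> \<open>S has fewer than k elements, while S with x and S with y both have at least
        k. So S has exactly k - 1 elements, neither x nor y lies in it, and both families consist of
        exactly k walks.\<close>
      then have ck: "card (insert x S) = k" "card (insert y S) = k" and xS: "x \<notin> S" and yS: "y \<notin> S"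
        using S(1,3) by (auto simp: card_insert_if split: if_splits)
      have fin: "finite (insert x S)" "finite (insert y S)" using S by auto
      obtain Ps where Ps: "finite Ps" "card Ps = k" "disjoint_walks E' A (insert x S) Ps"
          "\<And>p. p \<in> Ps \<Longrightarrow> trimmed A (insert x S) p"
        using less.hyps[OF E'(2,1) less.prems(2) fin(1)] less.prems(4) sepx by blast
      obtain Qs where Qs: "finite Qs" "card Qs = k" "disjoint_walks E' (insert y S) B Qs"
          "\<And>q. q \<in> Qs \<Longrightarrow> trimmed (insert y S) B q"
        using less.hyps[OF E'(2,1) fin(2) less.prems(3)] less.prems(4) sepy by blast
      have P: "walk E' p" "hd p \<in> A" "last p \<in> insert x S" "p \<noteq> []" if "p \<in> Ps" for p
        using Ps(3) that unfolding disjoint_walks_def walk_between_def walk_def by auto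
      have Q: "walk E' q" "hd q \<in> insert y S" "last q \<in> B" "q \<noteq> []" if "q \<in> Qs" for q
        using Qs(3) that unfolding disjoint_walks_def walk_between_def walk_def by auto
      have Pd: "set p \<inter> set p' = {}" if "p \<in> Ps" "p' \<in> Ps" "p \<noteq> p'" for p p'
        using Ps(3) that unfolding disjoint_walks_def by blast
      have Qd: "set q \<inter> set q' = {}" if "q \<in> Qs" "q' \<in> Qs" "q \<noteq> q'" for q q'
        using Qs(3) that unfolding disjoint_walks_def by blast
      have injP: "inj_on last Ps"
      proof (rule inj_onI, rule ccontr)
        fix p q assume "p \<in> Ps" "q \<in> Ps" "last p = last q" "p \<noteq> q"
        then show False using Pd[of p q] P(4)[of p] P(4)[of q] by (metis disjoint_iff last_in_set)
      qed
      have injQ: "inj_on hd Qs"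
      proof (rule inj_onI, rule ccontr)
        fix p q assume "p \<in> Qs" "q \<in> Qs" "hd p = hd q" "p \<noteq> q"
        then show False using Qd[of p q] Q(4)[of p] Q(4)[of q] by (metis disjoint_iff hd_in_set)
      qed
      have onQ: "hd ` Qs = insert y S"
        by (rule card_subset_eq) (use Q(2) S(1) ck Qs card_image[OF injQ] in auto)
      \<comment> \<open>Where a walk ending in the given vertex is to be continued: at the same
        vertex of S, or across the deleted arc from x to y.\<close>
      define \<sigma> where "\<sigma> = (\<lambda>z. if z = x then y else z)"
      have \<sigma>: "\<sigma> z \<in> insert y S" if "z \<in> insert x S" for z using that unfolding \<sigma>_def by auto
      have \<sigma>inj: "inj_on \<sigma> (insert x S)" using yS unfolding \<sigma>_def by (auto intro!: inj_onI split: if_splits)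
      have "\<forall>p\<in>Ps. \<exists>q\<in>Qs. hd q = \<sigma> (last p)" using P(3) \<sigma> onQ by (metis imageE)
      then obtain \<tau> where \<tau>: "\<And>p. p \<in> Ps \<Longrightarrow> \<tau> p \<in> Qs \<and> hd (\<tau> p) = \<sigma> (last p)" by (metis bchoice)
      have \<tau>inj: "\<tau> p \<noteq> \<tau> p'" if "p \<in> Ps" "p' \<in> Ps" "p \<noteq> p'" for p p'
        using \<tau>[OF that(1)] \<tau>[OF that(2)] \<sigma>inj injP P(3) that by (metis inj_onD)
      \<comment> \<open>At a common vertex z the two walks combine to a walk from A to B that avoids
        the deleted arc and hence meets S. Trimming leaves z as the only place where this can
        happen.\<close>
      have meet: "z \<in> S \<and> z = last p \<and> z = hd q" if pq: "p \<in> Ps" "q \<in> Qs" "z \<in> set p" "z \<in> set q" for p q z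
      proof -
        obtain p1 p2 where p: "p = p1 @ z # p2" using split_list[OF pq(3)] by blast
        obtain q1 q2 where q: "q = q1 @ z # q2" using split_list[OF pq(4)] by blast
        have "walk E' (p1 @ [z])" using walk_prefix P(1)[OF pq(1)] p by metis
        moreover have "walk E' (z # q2)" using walk_suffix Q(1)[OF pq(2)] q by metis
        ultimately have "walk E' (p1 @ z # q2)" by (rule walk_join)
        moreover have "hd (p1 @ z # q2) = hd p" unfolding p by (cases p1) auto
        moreover have "last (p1 @ z # q2) = last q" unfolding q by simp
        ultimately have "walk_between E' A B (p1 @ z # q2)"
          using P(2)[OF pq(1)] Q(3)[OF pq(2)] unfolding walk_between_def by simp
        then obtain s where s: "s \<in> set (p1 @ z # q2)" "s \<in> S" using S(2) unfolding separates_def by blast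
        have p1S: "set p1 \<inter> insert x S = {}"
          using Ps(4)[OF pq(1)] unfolding p trimmed_def by (auto simp: butlast_append)
        have q2S: "set q2 \<inter> insert y S = {}"
          using Qs(4)[OF pq(2)] unfolding q trimmed_def by (cases q1) auto
        have "s = z" using s p1S q2S by auto
        then have zS: "z \<in> S" using s by blast
        have "p2 = []"
        proof (rule ccontr)
          assume "p2 \<noteq> []"
          then have "z \<in> set (butlast p)" unfolding p by (auto simp: butlast_append)
          then show False using Ps(4)[OF pq(1)] zS unfolding trimmed_def by blast
        qed
        moreover have "q1 = []"
        proof (rule ccontr)
          assume "q1 \<noteq> []"
          then have "z \<in> set (tl q)" unfolding q by (cases q1) auto
          then show False using Qs(4)[OF pq(2)] zS unfolding trimmed_def by blast
        qed
        ultimately show ?thesis using zS p q by simp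
      qed
      \<comment> \<open>If the first walk ends in x, the arc is traversed and nothing is shared;
        otherwise the second walk starts where the first one ends, and the duplicate vertex is
        dropped.\<close>
      define r where "r = (\<lambda>p. if last p = x then p @ \<tau> p else p @ tl (\<tau> p))"
      have set_r: "set (r p) \<subseteq> set p \<union> set (\<tau> p)" for p
        unfolding r_def by (cases "\<tau> p") auto
      have dis: "set (r p) \<inter> set (r p') = {}" if "p \<in> Ps" "p' \<in> Ps" "p \<noteq> p'" for p p'
      proof -
        have cross: "set a \<inter> set (\<tau> b) = {}" if ab: "a \<in> Ps" "b \<in> Ps" "a \<noteq> b" for a b
        proof (rule ccontr)
          assume "set a \<inter> set (\<tau> b) \<noteq> {}"
          then obtain z where z: "z \<in> set a" "z \<in> set (\<tau> b)" by blast
          from meet[OF ab(1) _ z] \<tau>[OF ab(2)] have m: "z \<in> S" "z = last a" "z = \<sigma> (last b)" by auto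
          have "\<sigma> (last a) = \<sigma> (last b)" using m xS unfolding \<sigma>_def by auto
          then show False using \<sigma>inj injP P(3) ab by (metis inj_onD)
        qed
        show ?thesis
          using cross[OF that] cross[OF that(2,1)] that(3) Pd[OF that] \<tau>inj[OF that]
            Qd[of "\<tau> p" "\<tau> p'"] \<tau>[OF that(1)] \<tau>[OF that(2)] set_r[of p] set_r[of p'] by blast
      qed
      have "walk_between E A B (r p)" if p: "p \<in> Ps" for p
      proof -
        have wp: "walk E p" and wq: "walk E (\<tau> p)"
          using walk_mono[OF _ E'(3)] P(1)[OF p] Q(1) \<tau>[OF p] by blast+
        have hq: "hd (\<tau> p) = \<sigma> (last p)" "\<tau> p \<noteq> []" "last (\<tau> p) \<in> B" using \<tau>[OF p] Q by auto
        show ?thesis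
        proof (cases "last p = x")
          case True
          then have "walk E (p @ \<tau> p)" using walk_append[OF wp wq] hq xy unfolding \<sigma>_def by simp
          then show ?thesis using True hq P(2,4)[OF p] unfolding r_def walk_between_def by simp
        next
          case False
          then have "hd (\<tau> p) = last p" using hq unfolding \<sigma>_def by simp
          then have e: "\<tau> p = last p # tl (\<tau> p)" using hq(2) by (metis list.collapse)
          have "walk E (butlast p @ last p # tl (\<tau> p))"
            by (rule walk_join) (use wp wq e P(4)[OF p] in auto)
          moreover have "butlast p @ last p # tl (\<tau> p) = p @ tl (\<tau> p)"
            using P(4)[OF p] by (metis append.assoc append_Cons append_Nil append_butlast_last_id)
          moreover have "last (p @ tl (\<tau> p)) = last (\<tau> p)" using e P(4)[OF p] by (metis last_append last.simps)
          ultimately show ?thesis using False hq P(2,4)[OF p] unfolding r_def walk_between_def by simp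
        qed
      qed
      then have "disjoint_walks E A B (r ` Ps)" using dis unfolding disjoint_walks_def by fastforce
      from disjoint_walks_trim[OF this dis Ps(1)] Ps(2) show ?thesis by simp
    qed
  qed
qed

lemma conn_set_walk:
  assumes "walk E p" "symp F" "\<And>u v. (u, v) \<in> E \<Longrightarrow> F u v"
  shows "conn F (set p)"
  using assms(1)
proof (induction p)
  case (Cons a p)
  show ?case
  proof (cases p)
    case Nil then show ?thesis by simp
  next
    case (Cons b p')
    have "conn F (set p)" using Cons.IH Cons.prems Cons unfolding walk_def by simp
    moreover have "F a b" using Cons.prems Cons assms(3) unfolding walk_def by simp
    ultimately have "conn F ({a} \<union> set p)"
      by (intro conn_Un_edge[of F "{a}" "set p" a b]) (use Cons assms(2) in \<open>auto dest: sympD\<close>)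
    then show ?thesis by simp
  qed
qed (simp add: walk_def)

text \<open>The vertices of U reachable from a would otherwise form a cut without an outgoing
  edge.\<close>

lemma conn_imp_walk:
  assumes "conn F U" "a \<in> U" "b \<in> U" "\<And>u v. u \<in> U \<Longrightarrow> v \<in> U \<Longrightarrow> F u v \<Longrightarrow> (u, v) \<in> E"
  shows "\<exists>p. walk E p \<and> hd p = a \<and> last p = b \<and> set p \<subseteq> U"
proof -
  let ?X = "{z \<in> U. \<exists>p. walk E p \<and> hd p = a \<and> last p = z \<and> set p \<subseteq> U}"
  have "walk E [a] \<and> hd [a] = a \<and> last [a] = a \<and> set [a] \<subseteq> U" using assms(2) by (simp add: walk_def)
  then have aX: "a \<in> ?X" using assms(2) by blast
  have "?X = U"
  proof (rule ccontr)
    assume "?X \<noteq> U"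
    then obtain x y where xy: "x \<in> ?X" "y \<in> U - ?X" "F x y" using connD[OF assms(1), of ?X] aX by blast
    then obtain p where p: "walk E p" "hd p = a" "last p = x" "set p \<subseteq> U" by blast
    have "walk E (p @ [y])" by (rule walk_append[OF p(1)]) (use p xy assms(4) in \<open>auto simp: walk_def\<close>)
    moreover have "hd (p @ [y]) = a" using p unfolding walk_def by simp
    ultimately have "y \<in> ?X" using p xy by (auto intro!: exI[of _ "p @ [y]"])
    then show False using xy by blast
  qed
  then show ?thesis using assms(3) by blast
qed

section \<open>Minor-minimal dense graphs\<close>

definition nbrs :: "'a sgraph \<Rightarrow> 'a \<Rightarrow> 'a set" where
  "nbrs G v = {u. adj G v u}"

lemma nbrs_subset: "simple_graph G \<Longrightarrow> nbrs G v \<subseteq> verts G - {v}"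
  unfolding nbrs_def by (auto dest: adj_simple(2,3))

lemma finite_simple_graph:
  assumes "simple_graph G"
  shows "finite (verts G)" "finite (edges G)" "finite (nbrs G v)"
proof -
  show f: "finite (verts G)" using assms unfolding simple_graph_def by blast
  show "finite (edges G)"
    by (rule finite_subset[of _ "Pow (verts G)"]) (use assms f in \<open>auto simp: simple_graph_def\<close>)
  show "finite (nbrs G v)" using nbrs_subset[OF assms] f by (meson finite_Diff finite_subset)
qed

lemma incident_edges:
  assumes "simple_graph G"
  shows "{e \<in> edges G. v \<in> e} = (\<lambda>u. {v, u}) ` nbrs G v"
proof
  show "{e \<in> edges G. v \<in> e} \<subseteq> (\<lambda>u. {v, u}) ` nbrs G v"
  proof
    fix e assume e: "e \<in> {e \<in> edges G. v \<in> e}"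
    then have "card e = 2" using assms unfolding simple_graph_def by blast
    then obtain u where "e = {v, u}" using e unfolding card_2_iff by auto
    then show "e \<in> (\<lambda>u. {v, u}) ` nbrs G v" using e unfolding nbrs_def adj_def by auto
  qed
qed (auto simp: nbrs_def adj_def)

lemma card_incident_edges:
  assumes "simple_graph G"
  shows "card {e \<in> edges G. v \<in> e} = card (nbrs G v)"
  unfolding incident_edges[OF assms] by (rule card_image) (auto simp: inj_on_def doubleton_eq_iff)

lemma handshake:
  assumes "simple_graph G"
  shows "(\<Sum>v\<in>verts G. card (nbrs G v)) = 2 * card (edges G)"
proof -
  have "{v \<in> verts G. v \<in> e} = e" "card e = 2" if "e \<in> edges G" for e
    using that assms unfolding simple_graph_def by auto
  then have "(\<Sum>v\<in>verts G. card {e \<in> edges G. v \<in> e}) = 2 * card (edges G)"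
    by (intro sum_multicount finite_simple_graph[OF assms]) auto
  then show ?thesis by (simp add: card_incident_edges[OF assms])
qed

lemma card_edges_le:
  assumes "simple_graph G"
  shows "2 * card (edges G) \<le> card (verts G) * (card (verts G) - 1)"
proof -
  have "card (nbrs G v) \<le> card (verts G) - 1" if "v \<in> verts G" for v
    using card_mono[OF _ nbrs_subset[OF assms, of v]] finite_simple_graph(1)[OF assms] that by simp
  then have "(\<Sum>v\<in>verts G. card (nbrs G v)) \<le> (\<Sum>v\<in>verts G. card (verts G) - 1)" by (intro sum_mono)
  then show ?thesis by (simp add: handshake[OF assms])
qed

lemma min_degree_card_edges:
  fixes k :: nat
  assumes "simple_graph G" "\<And>v. v \<in> verts G \<Longrightarrow> k \<le> card (nbrs G v)"
  shows "k * card (verts G) \<le> 2 * card (edges G)"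
proof -
  have "(\<Sum>v\<in>verts G. k) \<le> (\<Sum>v\<in>verts G. card (nbrs G v))" using assms(2) by (rule sum_mono)
  then show ?thesis by (simp add: handshake[OF assms(1)] mult.commute)
qed

lemma simple_induced: "simple_graph G \<Longrightarrow> simple_graph (induced G U)"
  unfolding simple_graph_def induced_def by auto

lemma adj_induced: "adj (induced G U) x y \<longleftrightarrow> adj G x y \<and> x \<in> U \<and> y \<in> U"
  unfolding adj_def induced_def by auto

lemma verts_induced [simp]: "verts (induced G U) = verts G \<inter> U"
  unfolding induced_def by simp

lemma minor_model_induced: "minor_model G (induced G U) (\<lambda>x. {x})"
  by (rule minor_model_subgraph) (auto simp: induced_def)

text \<open>Contraction loses the edge itself and, for each common neighbour, one of two edges that
  become parallel.\<close>

lemma card_edges_contract: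
  assumes "simple_graph G" "{u, v} \<in> edges G"
  shows "card (edges G) \<le> card (edges (contract_edge G u v)) + 1 + card (nbrs G u \<inter> nbrs G v)"
proof -
  note fin = finite_simple_graph[OF assms(1)]
  let ?A = "{e \<in> edges G. v \<notin> e}" and ?W = "nbrs G v - {u} - nbrs G u"
  have uv: "u \<in> nbrs G v" using assms(2) by (simp add: adj_def nbrs_def insert_commute)
  have "card (edges G) = card ?A + card {e \<in> edges G. v \<in> e}"
    by (subst card_Un_disjoint[symmetric]) (use fin in \<open>auto intro!: arg_cong[where f = card]\<close>)
  then have 1: "card (edges G) = card ?A + card (nbrs G v)" by (simp add: card_incident_edges[OF assms(1)])
  have "nbrs G v = insert u (?W \<union> (nbrs G u \<inter> nbrs G v))" using uv by auto
  then have "card (nbrs G v) \<le> Suc (card (?W \<union> (nbrs G u \<inter> nbrs G v)))"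
    using fin(3) by (metis card_insert_le_m1 card_insert_if finite_Un finite_Diff finite_Int le_SucI le_refl)
  also have "\<dots> \<le> Suc (card ?W + card (nbrs G u \<inter> nbrs G v))" using card_Un_le by simp
  finally have 2: "card (nbrs G v) \<le> 1 + card ?W + card (nbrs G u \<inter> nbrs G v)" by simp
  have "card ?A + card ?W = card (?A \<union> (\<lambda>w. {u, w}) ` ?W)"
  proof -
    have "card ((\<lambda>w. {u, w}) ` ?W) = card ?W" by (rule card_image) (auto simp: inj_on_def doubleton_eq_iff)
    moreover have "?A \<inter> (\<lambda>w. {u, w}) ` ?W = {}" by (auto simp: nbrs_def adj_def)
    ultimately show ?thesis using fin by (subst card_Un_disjoint) auto
  qed
  also have "\<dots> \<le> card (edges (contract_edge G u v))"
  proof (rule card_mono)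
    show "finite (edges (contract_edge G u v))"
      using finite_simple_graph(2)[OF simple_contract[OF assms]] .
    show "?A \<union> (\<lambda>w. {u, w}) ` ?W \<subseteq> edges (contract_edge G u v)"
      unfolding contract_edge_def nbrs_def adj_def by auto
  qed
  finally show ?thesis using 1 2 by linarith
qed

text \<open>The defect \<open>s\<close> in the density condition is Mader's device for connectivity: both
  sides of a separation of order at most \<open>s\<close> would have too few edges.\<close>

lemma dense_minimal_minor:
  fixes G :: "'a sgraph" and k :: nat and s :: real
  assumes G: "simple_graph G" "k \<le> card (verts G)" "real k * (real (card (verts G)) - s) < real (card (edges G))"
    and s: "0 < s" "2 * s \<le> real k"
  obtains H :: "'a sgraph" and \<phi> where "simple_graph H" "minor_model G H \<phi>" "k < card (verts H)"
    "real k * (real (card (verts H)) - s) < real (card (edges H))"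
    "real (card (edges H)) \<le> real k * (real (card (verts H)) - s) + 1"
    "\<And>v. v \<in> verts H \<Longrightarrow> k < card (nbrs H v)"
    "\<And>u v. adj H u v \<Longrightarrow> k \<le> card (nbrs H u \<inter> nbrs H v)"
    "\<And>X. X \<subseteq> verts H \<Longrightarrow> real (card X) \<le> s \<Longrightarrow> conn (adj H) (verts H - X)"
proof -
  \<comment> \<open>The condition on the order keeps the minimal graph from degenerating to very few
    vertices, where the density condition would lose its force.\<close>
  define dense where "dense = (\<lambda>H :: 'a sgraph. k \<le> card (verts H) \<and>
      real k * (real (card (verts H)) - s) < real (card (edges H)))"
  let ?P = "\<lambda>H. simple_graph H \<and> (\<exists>\<phi>. minor_model G H \<phi>) \<and> dense H"
  have "?P G" using G minor_model_subgraph[of G G] unfolding dense_def by blast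
  then obtain H where H: "?P H"
      and min: "\<And>K. ?P K \<Longrightarrow> card (verts H) + card (edges H) \<le> card (verts K) + card (edges K)"
    using ex_has_least_nat[of ?P G "\<lambda>K. card (verts K) + card (edges K)"] by blast
  obtain \<phi> where \<phi>: "minor_model G H \<phi>" using H by blast
  have sH: "simple_graph H" and dH: "dense H" using H by auto
  note fin = finite_simple_graph[OF sH]
  have no: "\<not> dense K" if "minor_model H K \<psi>" "simple_graph K"
      "card (verts K) + card (edges K) < card (verts H) + card (edges H)" for K \<psi>
    using min[of K] that minor_model_trans[OF \<phi> that(1)] by fastforce
  have k0: "real k > 0" using s by linarith
  \<comment> \<open>On exactly k vertices there are at most k^2 / 2 edges, which is no more than k
    (k - s) because 2 s is at most k.\<close>
  have big: "k < card (verts H)"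
  proof (rule ccontr)
    assume "\<not> ?thesis"
    then have eq: "card (verts H) = k" using dH unfolding dense_def by simp
    then have "real k * (real k - s) < real (card (edges H))" using dH unfolding dense_def by simp
    moreover have "2 * real (card (edges H)) \<le> real k * real k"
    proof -
      have "2 * card (edges H) \<le> k * (k - 1)" using card_edges_le[OF sH] eq by simp
      also have "\<dots> \<le> k * k" by simp
      finally show ?thesis by (metis of_nat_le_iff of_nat_mult of_nat_numeral)
    qed
    ultimately have "real k * (2 * real k - 2 * s) < real k * real k" by (simp add: algebra_simps)
    then have "2 * real k - 2 * s < real k" using k0 by simp
    then show False using s by simp
  qed
  have up: "real (card (edges H)) \<le> real k * (real (card (verts H)) - s) + 1"
  proof (rule ccontr)
    assume n: "\<not> ?thesis"
    have "edges H \<noteq> {}"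
    proof
      assume "edges H = {}"
      then have "real k * (real (card (verts H)) - s) < 0" using dH unfolding dense_def by simp
      moreover have "real (card (verts H)) - s > 0" using big s by linarith
      ultimately show False using k0 by (simp add: mult_less_0_iff)
    qed
    then obtain e where e: "e \<in> edges H" by blast
    have c: "card (edges (del_edge H e)) = card (edges H) - 1" "card (edges H) \<ge> 1"
      using e fin by (auto simp: del_edge_def Suc_le_eq card_gt_0_iff)
    have "\<not> dense (del_edge H e)"
    proof (rule no)
      show "minor_model H (del_edge H e) (\<lambda>x. {x})"
        by (rule minor_model_subgraph) (auto simp: del_edge_def)
      show "simple_graph (del_edge H e)" using sH by (auto simp: del_edge_def simple_graph_def)
      show "card (verts (del_edge H e)) + card (edges (del_edge H e)) < card (verts H) + card (edges H)"
        using c by (simp add: del_edge_def)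
    qed
    then have "real (card (edges H) - 1) \<le> real k * (real (card (verts H)) - s)"
      using dH c unfolding dense_def by (simp add: del_edge_def)
    then show False using n c by (simp add: of_nat_diff)
  qed
  have sub: "real (card (edges (induced H U))) \<le> real k * (real (card U) - s)"
    if U: "U \<subset> verts H" "k \<le> card U" for U
  proof -
    have eq: "verts (induced H U) = U" using U by auto
    have "card U < card (verts H)" using U fin by (simp add: psubset_card_mono)
    moreover have "card (edges (induced H U)) \<le> card (edges H)"
      using fin by (intro card_mono) (auto simp: induced_def)
    ultimately have "\<not> dense (induced H U)"
      using Int_absorb1[of U "verts H"] U by (intro no[OF minor_model_induced simple_induced[OF sH]]) auto
    then show ?thesis using U eq unfolding dense_def by simp
  qed
  have deg: "k < card (nbrs H v)" if v: "v \<in> verts H" for v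
  proof -
    have c: "card (verts H - {v}) = card (verts H) - 1" using v fin by simp
    have "real (card (edges (induced H (verts H - {v})))) \<le> real k * (real (card (verts H) - 1) - s)"
      using sub[of "verts H - {v}"] v big unfolding c by fastforce
    moreover have "edges H = edges (induced H (verts H - {v})) \<union> {e \<in> edges H. v \<in> e}"
      using sH by (auto simp: induced_def simple_graph_def)
    then have "card (edges H) \<le> card (edges (induced H (verts H - {v}))) + card (nbrs H v)"
      using card_Un_le card_incident_edges[OF sH] by metis
    moreover have "real (card (verts H) - 1) = real (card (verts H)) - 1" using big by simp
    ultimately have "real k * (real (card (verts H)) - s) < real k * (real (card (verts H)) - 1 - s) + card (nbrs H v)"
      using dH unfolding dense_def by simp
    then show ?thesis by (simp add: algebra_simps)
  qed
  \<comment> \<open>Contraction lowers the right side of the density condition by k and loses at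
    most 1 + c edges, where c is the number of common neighbours. By minimality k < 1 + c.\<close>
  have tri: "k \<le> card (nbrs H u \<inter> nbrs H v)" if uv: "adj H u v" for u v
  proof -
    have e: "{u, v} \<in> edges H" using uv by (simp add: adj_def)
    have v: "v \<in> verts H" using adj_simple[OF sH uv] by blast
    let ?K = "contract_edge H u v"
    have cv: "card (verts ?K) = card (verts H) - 1" using v fin by (simp add: contract_edge_def)
    have "\<not> dense ?K \<or> card (edges H) < card (edges ?K)"
      using no[OF minor_model_contract[OF sH e] simple_contract[OF sH e]] cv big by linarith
    moreover have ce: "card (edges H) \<le> card (edges ?K) + 1 + card (nbrs H u \<inter> nbrs H v)"
      by (rule card_edges_contract[OF sH e])
    moreover have "card (edges ?K) \<le> card (edges H)" by (rule card_edges_contract_le[OF sH])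
    ultimately have "real (card (edges ?K)) \<le> real k * (real (card (verts H) - 1) - s)"
      using cv big unfolding dense_def by auto
    moreover have "real (card (verts H) - 1) = real (card (verts H)) - 1" using big by simp
    ultimately have "real (card (edges H)) \<le> real k * (real (card (verts H)) - 1 - s) + 1 + card (nbrs H u \<inter> nbrs H v)"
      using of_nat_mono[OF ce, where ?'a = real] by simp
    then have "real k * (real (card (verts H)) - s) < real k * (real (card (verts H)) - 1 - s) + 1 + card (nbrs H u \<inter> nbrs H v)"
      using dH unfolding dense_def by linarith
    then show ?thesis by (simp add: algebra_simps)
  qed
  \<comment> \<open>Each side of the separation, together with X, contains the neighbourhood of one
    of its vertices and so has at least k vertices; by minimality it is not dense. Adding the two
    edge bounds gives at most k (n + card X - 2 s), which is at most k (n - s) and contradicts the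
    density of H.\<close>
  have con: "conn (adj H) (verts H - X)" if X: "X \<subseteq> verts H" "real (card X) \<le> s" for X
    unfolding conn_def
  proof (intro allI impI, rule ccontr)
    fix Y assume Y: "Y \<subseteq> verts H - X" "Y \<noteq> {}" "Y \<noteq> verts H - X"
      and n: "\<not> (\<exists>x\<in>Y. \<exists>y\<in>verts H - X - Y. adj H x y)"
    let ?Z = "verts H - X - Y"
    have ZY: "Y \<union> X \<subset> verts H" "?Z \<union> X \<subset> verts H" using Y X by auto
    have nY: "nbrs H y \<subseteq> Y \<union> X" if "y \<in> Y" for y
      using n that adj_simple[OF sH] unfolding nbrs_def by blast
    have nZ: "nbrs H y \<subseteq> ?Z \<union> X" if "y \<in> ?Z" for y
      using n that adj_simple[OF sH] adj_sym[of H] unfolding nbrs_def by blast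
    have fX: "finite X" "finite Y" using X Y fin finite_subset by blast+
    obtain y z where yz: "y \<in> Y" "z \<in> ?Z" using Y by blast
    have cY: "k \<le> card (Y \<union> X)" using card_mono[OF _ nY[OF yz(1)]] deg[of y] yz Y fX by fastforce
    have cZ: "k \<le> card (?Z \<union> X)"
      using card_mono[OF _ nZ[OF yz(2)]] deg[of z] yz fX fin by fastforce
    have "edges H \<subseteq> edges (induced H (Y \<union> X)) \<union> edges (induced H (?Z \<union> X))"
    proof
      fix e assume e: "e \<in> edges H"
      then obtain a b where ab: "e = {a, b}" "a \<in> verts H" "b \<in> verts H"
        using sH unfolding simple_graph_def card_2_iff by (metis insert_subset)
      then have "adj H a b" "adj H b a" using e by (auto simp: adj_def insert_commute)
      then have "e \<subseteq> Y \<union> X \<or> e \<subseteq> ?Z \<union> X" using n ab by blast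
      then show "e \<in> edges (induced H (Y \<union> X)) \<union> edges (induced H (?Z \<union> X))"
        using e by (auto simp: induced_def)
    qed
    then have "card (edges H) \<le> card (edges (induced H (Y \<union> X)) \<union> edges (induced H (?Z \<union> X)))"
      using finite_simple_graph(2)[OF simple_induced[OF sH]] by (intro card_mono) auto
    then have "card (edges H) \<le> card (edges (induced H (Y \<union> X))) + card (edges (induced H (?Z \<union> X)))"
      using card_Un_le le_trans by blast
    then have "real (card (edges H)) \<le> real k * (real (card (Y \<union> X)) - s) + real k * (real (card (?Z \<union> X)) - s)"
      using sub[OF ZY(1) cY] sub[OF ZY(2) cZ] by linarith
    moreover have "card (Y \<union> X) + card (?Z \<union> X) = card (verts H) + card X"
    proof -
      have "card (Y \<union> X) = card Y + card X" using Y fX by (intro card_Un_disjoint) auto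
      moreover have "card (?Z \<union> X) = card ?Z + card X" using fX fin by (intro card_Un_disjoint) auto
      moreover have "card (verts H) = card Y + card ?Z + card X"
      proof -
        have "verts H = (Y \<union> ?Z) \<union> X" using X Y by blast
        moreover have "card ((Y \<union> ?Z) \<union> X) = card (Y \<union> ?Z) + card X"
          using fX fin Y by (intro card_Un_disjoint) auto
        ultimately have "card (verts H) = card (Y \<union> ?Z) + card X" by metis
        moreover have "card (Y \<union> ?Z) = card Y + card ?Z" using fX fin by (intro card_Un_disjoint) auto
        ultimately show ?thesis by simp
      qed
      ultimately show ?thesis by simp
    qed
    then have "real (card (Y \<union> X)) + real (card (?Z \<union> X)) = real (card (verts H)) + real (card X)"
      by (metis of_nat_add)
    ultimately have "real (card (edges H)) \<le> real k * (real (card (verts H)) + real (card X) - 2 * s)"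
      by (simp add: algebra_simps) (metis distrib_left)
    also have "\<dots> \<le> real k * (real (card (verts H)) - s)" using X(2) by (intro mult_left_mono) auto
    finally show False using dH unfolding dense_def by simp
  qed
  show ?thesis
    by (rule that[OF sH \<phi> big _ up deg tri con]) (use dH in \<open>auto simp: dense_def\<close>)
qed

section \<open>Clique minors from edge density\<close>

definition clique_minor :: "('a \<Rightarrow> 'a \<Rightarrow> bool) \<Rightarrow> 'a set \<Rightarrow> nat \<Rightarrow> bool" where
  "clique_minor E V h \<longleftrightarrow> (\<exists>\<A>. finite \<A> \<and> card \<A> = h \<and> (\<forall>A\<in>\<A>. A \<subseteq> V \<and> A \<noteq> {} \<and> conn E A) \<and>
     (\<forall>A\<in>\<A>. \<forall>B\<in>\<A>. A \<noteq> B \<longrightarrow> A \<inter> B = {} \<and> (\<exists>a\<in>A. \<exists>b\<in>B. E a b)))"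

lemma clique_minor_model:
  assumes m: "minor_model G H \<phi>" and "clique_minor (adj H) (verts H) h"
  shows "clique_minor (adj G) (verts G) h"
proof -
  obtain \<A> where A: "finite \<A>" "card \<A> = h" "\<And>A. A \<in> \<A> \<Longrightarrow> A \<subseteq> verts H \<and> A \<noteq> {} \<and> conn (adj H) A"
    "\<And>A B. A \<in> \<A> \<Longrightarrow> B \<in> \<A> \<Longrightarrow> A \<noteq> B \<Longrightarrow> A \<inter> B = {} \<and> (\<exists>a\<in>A. \<exists>b\<in>B. adj H a b)"
    using assms(2) unfolding clique_minor_def by metis
  let ?f = "\<lambda>A. \<Union>y\<in>A. \<phi> y"
  note mD = minor_modelD[OF m]
  have disj: "?f A \<inter> ?f B = {}" if "A \<in> \<A>" "B \<in> \<A>" "A \<noteq> B" for A B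
  proof -
    have "\<phi> a \<inter> \<phi> b = {}" if "a \<in> A" "b \<in> B" for a b
      using mD(4)[of a b] A(3,4) that \<open>A \<in> \<A>\<close> \<open>B \<in> \<A>\<close> \<open>A \<noteq> B\<close> by blast
    then show ?thesis by blast
  qed
  have props: "?f A \<subseteq> verts G \<and> ?f A \<noteq> {} \<and> conn (adj G) (?f A)" if "A \<in> \<A>" for A
  proof (intro conjI)
    have s: "A \<subseteq> verts H" "A \<noteq> {}" "conn (adj H) A" using A(3)[OF that] by auto
    show "?f A \<subseteq> verts G" using s mD(1) by blast
    show "?f A \<noteq> {}" using s mD(2) by blast
    show "conn (adj G) (?f A)"
    proof (rule conn_UN_blowup[OF s(3)])
      fix y z assume "y \<in> A" "z \<in> A" "adj H y z"
      then show "\<exists>u\<in>\<phi> y. \<exists>v\<in>\<phi> z. adj G u v" using s(1) mD(5) by blast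
    qed (use s mD(2,3) in blast)+
  qed
  have "inj_on ?f \<A>"
  proof (rule inj_onI, rule ccontr)
    fix A B assume "A \<in> \<A>" "B \<in> \<A>" "?f A = ?f B" "A \<noteq> B"
    then show False using disj[of A B] props[of B] by simp
  qed
  then have "card (?f ` \<A>) = h" using A(2) card_image by blast
  moreover have edge: "\<exists>a\<in>?f A. \<exists>b\<in>?f B. adj G a b" if AB: "A \<in> \<A>" "B \<in> \<A>" "A \<noteq> B" for A B
  proof -
    obtain a b where "a \<in> A" "b \<in> B" "adj H a b" using A(4)[OF AB] by blast
    then show ?thesis using mD(5)[of a b] A(3)[OF AB(1)] A(3)[OF AB(2)] by blast
  qed
  ultimately show ?thesis unfolding clique_minor_def
  proof (intro exI[of _ "?f ` \<A>"] conjI ballI impI)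
    fix X Y assume "X \<in> ?f ` \<A>" "Y \<in> ?f ` \<A>" "X \<noteq> Y"
    then obtain A B where "A \<in> \<A>" "B \<in> \<A>" "A \<noteq> B" "X = ?f A" "Y = ?f B" by blast
    then show "X \<inter> Y = {}" "\<exists>a\<in>X. \<exists>b\<in>Y. adj G a b" using disj edge by simp_all
  next
    fix X assume "X \<in> ?f ` \<A>"
    then obtain A where A': "A \<in> \<A>" "X = ?f A" by blast
    show "X \<subseteq> verts G" "X \<noteq> {}" "conn (adj G) X" unfolding A'(2) using props[OF A'(1)] by blast+
  qed (use A(1) in auto)
qed

text \<open>In a minimal dense minor every edge lies in 2^(h + 1) triangles. So the neighbourhood of
  any vertex v has that minimum degree, hence 2^h edges per vertex, and a clique minor of order h
  found inside it extends by v. The bound is exponential in h, but h is a constant of the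
  family.\<close>

lemma dense_imp_clique_minor:
  fixes G :: "'a sgraph"
  assumes "simple_graph G" "verts G \<noteq> {}" "2 ^ h * card (verts G) \<le> card (edges G)"
  shows "clique_minor (adj G) (verts G) h"
  using assms
proof (induction h arbitrary: G)
  case 0
  then show ?case unfolding clique_minor_def by (intro exI[of _ "{}"]) auto
next
  case (Suc h)
  let ?k = "2 ^ Suc h :: nat" and ?n = "card (verts G)"
  have n0: "?n > 0" using Suc.prems finite_simple_graph(1) by (simp add: card_gt_0_iff)
  have "2 * (?k * ?n) \<le> ?n * (?n - 1)"
    using Suc.prems(3) card_edges_le[OF Suc.prems(1)] by linarith
  then have "?n * (2 * ?k) \<le> ?n * (?n - 1)" by (simp add: mult_ac)
  then have "2 * ?k \<le> ?n - 1" using n0 by simp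
  then have kn: "?k \<le> ?n" by simp
  \<comment> \<open>The defect 1/2 turns the weak inequality into the strict one that
    \<open>dense_minimal_minor\<close> asks for.\<close>
  have d1: "real ?k * (real ?n - 1 / 2) < real (card (edges G))"
  proof -
    have "real ?k * real ?n \<le> real (card (edges G))" using Suc.prems(3) by (metis of_nat_le_iff of_nat_mult)
    moreover have "real ?k * (real ?n - 1 / 2) < real ?k * real ?n" by simp
    ultimately show ?thesis by linarith
  qed
  have d2: "2 * (1 / 2 :: real) \<le> real ?k" using one_le_power[of "2 :: real" "Suc h"] by simp
  obtain H :: "'a sgraph" and \<phi> where H: "simple_graph H" "minor_model G H \<phi>" "?k < card (verts H)"
      "\<And>v. v \<in> verts H \<Longrightarrow> ?k < card (nbrs H v)"
      "\<And>u v. adj H u v \<Longrightarrow> ?k \<le> card (nbrs H u \<inter> nbrs H v)"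
    using dense_minimal_minor[OF Suc.prems(1) kn d1 _ d2] by (metis half_gt_zero_iff zero_less_one)
  then obtain v where v: "v \<in> verts H" by fastforce
  let ?N = "nbrs H v" and ?K = "induced H (nbrs H v)"
  have N: "?N \<subseteq> verts H" "v \<notin> ?N" using nbrs_subset[OF H(1)] by blast+
  have vK: "verts ?K = ?N" using N by auto
  have "?k * card (verts ?K) \<le> 2 * card (edges ?K)"
  proof (rule min_degree_card_edges[OF simple_induced[OF H(1)]])
    fix u assume "u \<in> verts ?K"
    then have u: "u \<in> ?N" using vK by simp
    have "nbrs ?K u = nbrs H v \<inter> nbrs H u" using u unfolding nbrs_def by (auto simp: adj_induced nbrs_def)
    then show "?k \<le> card (nbrs ?K u)" using H(5)[of v u] u unfolding nbrs_def by simp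
  qed
  then have dK: "2 ^ h * card (verts ?K) \<le> card (edges ?K)" by simp
  have "verts ?K \<noteq> {}" using H(4)[OF v] vK by auto
  from Suc.IH[OF simple_induced[OF H(1)] this dK] have "clique_minor (adj ?K) (verts ?K) h" .
  then obtain \<A> where A: "finite \<A>" "card \<A> = h" "\<And>A. A \<in> \<A> \<Longrightarrow> A \<subseteq> ?N \<and> A \<noteq> {} \<and> conn (adj ?K) A"
    "\<And>A B. A \<in> \<A> \<Longrightarrow> B \<in> \<A> \<Longrightarrow> A \<noteq> B \<Longrightarrow> A \<inter> B = {} \<and> (\<exists>a\<in>A. \<exists>b\<in>B. adj ?K a b)"
    unfolding clique_minor_def vK by metis
  have "{v} \<notin> \<A>" using A(3) N(2) by blast
  then have c: "card (insert {v} \<A>) = Suc h" using A by simp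
  have con: "conn (adj H) A" if "A \<in> \<A>" for A
    by (rule conn_mono[of "adj ?K"]) (use A(3)[OF that] in \<open>auto simp: adj_induced\<close>)
  have toA: "\<exists>b\<in>A. adj H v b \<and> adj H b v" if "A \<in> \<A>" for A
  proof -
    from A(3)[OF that] obtain b where "b \<in> A" "b \<in> nbrs H v" by blast
    then show ?thesis using adj_sym[of H v b] unfolding nbrs_def by blast
  qed
  have vA: "v \<notin> A" "A \<subseteq> verts H" "A \<noteq> {}" if "A \<in> \<A>" for A using A(3)[OF that] N by blast+
  have AB: "\<exists>a\<in>A. \<exists>b\<in>B. adj H a b" if "A \<in> \<A>" "B \<in> \<A>" "A \<noteq> B" for A B
    using A(4)[OF that] by (auto simp: adj_induced)
  have "clique_minor (adj H) (verts H) (Suc h)"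
    unfolding clique_minor_def
  proof (intro exI[of _ "insert {v} \<A>"] conjI ballI impI)
    fix X Y assume XY: "X \<in> insert {v} \<A>" "Y \<in> insert {v} \<A>" "X \<noteq> Y"
    then show "X \<inter> Y = {}" using vA(1) A(4)[of X Y] by auto
    show "\<exists>a\<in>X. \<exists>b\<in>Y. adj H a b"
      using XY AB[of X Y] toA[of X] toA[of Y] by auto
  next
    fix X assume "X \<in> insert {v} \<A>"
    then show "X \<subseteq> verts H" "X \<noteq> {}" "conn (adj H) X" using v vA con by auto
  qed (use c A(1) in auto)
  then show ?case by (rule clique_minor_model[OF H(2)])
qed

section \<open>Dense, robustly connected minors\<close>

text \<open>About 2k vertices are what the embedding consumes. The upper bound 8k makes degrees
  linear in the order, so that diameters and almost dominating sets are bounded. The last clause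
  keeps the host connected while branch sets are being removed from it.\<close>

definition is_host :: "'a sgraph \<Rightarrow> nat \<Rightarrow> real \<Rightarrow> real \<Rightarrow> bool" where
  "is_host G k \<delta> \<gamma> \<longleftrightarrow> simple_graph G \<and>
     2 * (1 - \<delta>) * real k \<le> real (card (verts G)) \<and> card (verts G) \<le> 8 * k \<and>
     (\<forall>v\<in>verts G. (1 - \<delta>) * real k \<le> real (card (nbrs G v))) \<and>
     (\<forall>X\<subseteq>verts G. real (card X) \<le> \<gamma> * real k \<longrightarrow> conn (adj G) (verts G - X))"

definition robust :: "('a \<Rightarrow> 'a \<Rightarrow> bool) \<Rightarrow> 'a set \<Rightarrow> real \<Rightarrow> bool" where
  "robust E D q \<longleftrightarrow> (\<forall>X\<subseteq>D. real (card X) \<le> q \<longrightarrow> conn E (D - X))"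

lemma robustD:
  fixes q :: real
  assumes "robust E D q" "finite D" "card (D \<inter> X) \<le> q"
  shows "conn E (D - X)"
proof -
  have "conn E (D - (D \<inter> X))" using assms unfolding robust_def by blast
  then show ?thesis by (simp add: Diff_Int)
qed

text \<open>The smaller side of the cut left by X has at most half the vertices, and each of its
  vertices loses only neighbours in X.\<close>

lemma not_robust_split:
  fixes d q :: real
  assumes "finite W" "symp E" "\<not> robust E W q" and deg: "\<And>x. x \<in> W \<Longrightarrow> d \<le> card {y \<in> W. E x y}"
  shows "\<exists>Y\<subseteq>W. Y \<noteq> {} \<and> 2 * card Y \<le> card W \<and> (\<forall>x\<in>Y. d - q \<le> card {y \<in> Y. E x y})"
proof -
  obtain X where X: "X \<subseteq> W" "card X \<le> q" "\<not> conn E (W - X)" using assms(3) unfolding robust_def by blast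
  then obtain Y where Y: "Y \<subseteq> W - X" "Y \<noteq> {}" "Y \<noteq> W - X" "\<And>x y. x \<in> Y \<Longrightarrow> y \<in> W - X - Y \<Longrightarrow> \<not> E x y"
    unfolding conn_def by blast
  let ?Z = "W - X - Y"
  have fin: "finite X" "finite Y" "finite ?Z" using assms(1) X Y finite_subset[of _ W] by blast+
  have part: "\<forall>x\<in>P. d - q \<le> card {y \<in> P. E x y}"
    if P: "P \<subseteq> W" "finite P" "\<And>x y. x \<in> P \<Longrightarrow> y \<in> W - X - P \<Longrightarrow> \<not> E x y" for P
  proof
    fix x assume x: "x \<in> P"
    have "{y \<in> W. E x y} \<subseteq> {y \<in> P. E x y} \<union> X" using P(3)[OF x] by blast
    then have "card {y \<in> W. E x y} \<le> card ({y \<in> P. E x y} \<union> X)" using P fin by (intro card_mono) auto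
    also have "\<dots> \<le> card {y \<in> P. E x y} + card X" by (rule card_Un_le)
    finally have "real (card {y \<in> W. E x y}) \<le> card {y \<in> P. E x y} + card X" by linarith
    then show "d - q \<le> card {y \<in> P. E x y}" using deg[of x] x P X(2) by force
  qed
  have "card Y + card ?Z = card (Y \<union> ?Z)" using fin by (intro card_Un_disjoint[symmetric]) auto
  also have "\<dots> \<le> card W" using assms(1) Y by (intro card_mono) auto
  finally have sum: "card Y + card ?Z \<le> card W" .
  have Zne: "?Z \<noteq> {}" using Y by blast
  show ?thesis
  proof (cases "card Y \<le> card ?Z")
    case True
    have "\<forall>x\<in>Y. d - q \<le> card {y \<in> Y. E x y}" using part[of Y] Y fin by blast
    then show ?thesis using Y True sum by (intro exI[of _ Y]) auto
  next
    case False
    have "\<not> E x y" if "x \<in> ?Z" "y \<in> W - X - ?Z" for x y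
      using Y(4)[of y x] that sympD[OF assms(2), of x y] by blast
    then have "\<forall>x\<in>?Z. d - q \<le> card {y \<in> ?Z. E x y}" using part[of ?Z] fin by blast
    then show ?thesis using Zne False sum by (intro exI[of _ ?Z]) auto
  qed
qed

text \<open>Each failure of robustness halves the set and lowers the minimum degree by q. From 4k
  this leads to 2k and k; a third failure would leave at most k / 2 vertices with minimum degree k -
  3q, which exceeds k / 2. So two losses of q suffice.\<close>

lemma robust_piece:
  fixes k q :: real
  assumes W: "finite W" "W \<noteq> {}" "card W \<le> 4 * k" and E: "symp E" and q: "0 \<le> q" "6 * q < k"
    and deg: "\<And>x. x \<in> W \<Longrightarrow> k \<le> card {y \<in> W. E x y}"
  shows "\<exists>D\<subseteq>W. D \<noteq> {} \<and> robust E D q \<and> (\<forall>x\<in>D. k - 2 * q \<le> card {y \<in> D. E x y})"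
proof -
  have step: "\<exists>Y\<subseteq>W. Y \<noteq> {} \<and> card Y \<le> c / 2 \<and> (\<forall>x\<in>Y. d - q \<le> card {y \<in> Y. E x y})"
    if "A \<subseteq> W" "card A \<le> c" "\<forall>x\<in>A. d \<le> card {y \<in> A. E x y}" "\<not> robust E A q" for A and c d :: real
  proof -
    have fA: "finite A" using W(1) that(1) finite_subset by blast
    have dA: "d \<le> card {y \<in> A. E x y}" if "x \<in> A" for x using \<open>\<forall>x\<in>A. _\<close> that by blast
    obtain Y where
      "Y \<subseteq> A" "Y \<noteq> {}" "2 * card Y \<le> card A" "\<forall>x\<in>Y. d - q \<le> card {y \<in> Y. E x y}"
      using not_robust_split[OF fA E \<open>\<not> robust E A q\<close> dA] by metis
    moreover from this(3) have "2 * real (card Y) \<le> card A" by linarith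
    ultimately show ?thesis using that by (intro exI[of _ Y]) auto
  qed
  show ?thesis
  proof (cases "robust E W q")
    case True
    then show ?thesis using W deg q by (intro exI[of _ W]) force
  next
    case False
    then obtain A where A: "A \<subseteq> W" "A \<noteq> {}" "card A \<le> 4 * k / 2" "\<forall>x\<in>A. k - q \<le> card {y \<in> A. E x y}"
      using step[of W "4 * k" k] W(3) deg by blast
    show ?thesis
    proof (cases "robust E A q")
      case True
      then show ?thesis using A q by (intro exI[of _ A]) force
    next
      case False
      then obtain B where B: "B \<subseteq> W" "B \<noteq> {}" "card B \<le> 4 * k / 2 / 2" "\<forall>x\<in>B. k - q - q \<le> card {y \<in> B. E x y}"
        using step[OF A(1,3,4)] by blast
      have "robust E B q"
      proof (rule ccontr)
        assume "\<not> ?thesis"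
        then obtain C where C: "C \<subseteq> W" "C \<noteq> {}" "card C \<le> 4 * k / 2 / 2 / 2" "\<forall>x\<in>C. k - q - q - q \<le> card {y \<in> C. E x y}"
          using step[OF B(1,3,4)] by blast
        then obtain x where x: "x \<in> C" by blast
        have "card {y \<in> C. E x y} \<le> card C" using C(1) W(1) finite_subset by (intro card_mono) auto
        then have "k - q - q - q \<le> card C" using C(4) x by force
        then show False using C(3) q by linarith
      qed
      then show ?thesis using B by (intro exI[of _ B]) force
    qed
  qed
qed

lemma induced_host:
  fixes \<delta> \<gamma> :: real and k :: nat
  assumes "simple_graph H" "Z \<subseteq> verts H" "2 * (1 - \<delta>) * k \<le> card Z" "card Z \<le> 8 * k"
    "\<And>v. v \<in> Z \<Longrightarrow> (1 - \<delta>) * k \<le> card {y \<in> Z. adj H v y}" "robust (adj H) Z (\<gamma> * k)"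
  shows "is_host (induced H Z) k \<delta> \<gamma>"
proof -
  have v: "verts (induced H Z) = Z" using assms(2) by auto
  have n: "nbrs (induced H Z) x = {y \<in> Z. adj H x y}" if "x \<in> Z" for x
    using that unfolding nbrs_def by (auto simp: adj_induced)
  have c: "conn (adj (induced H Z)) (Z - X)" if "X \<subseteq> Z" "card X \<le> \<gamma> * k" for X
    by (rule conn_mono[of "adj H"]) (use that assms(6) in \<open>auto simp: adj_induced robust_def\<close>)
  show ?thesis unfolding is_host_def v using simple_induced[OF assms(1)] assms(3-5) n c by simp
qed

lemma card_min_degree:
  fixes d :: real
  assumes "finite D" "D \<noteq> {}" "\<forall>x\<in>D. d \<le> card {y \<in> D. E x y}"
  shows "d \<le> real (card D)"
proof -
  obtain x where "x \<in> D" using assms by blast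
  moreover have "card {y \<in> D. E x y} \<le> card D" using assms(1) by (intro card_mono) auto
  ultimately show ?thesis using assms(3) by force
qed

text \<open>Each linking walk is contracted onto its end in \<open>D\<^sub>2\<close>. This costs at
  most q vertices of \<open>D\<^sub>1\<close>, which hardly affects degrees and order. Since there
  are more than \<open>\<delta>\<close> k / 32 walks, deleting that many vertices leaves one link
  between the two robust pieces intact.\<close>

lemma linked_pieces_host:
  fixes H :: "'a sgraph" and k q :: nat and \<delta> :: real
  assumes H: "simple_graph H" and \<delta>: "0 < \<delta>" "\<delta> < 1 / 2"
    and D: "D\<^sub>1 \<subseteq> verts H" "D\<^sub>2 \<subseteq> verts H" "card D\<^sub>1 \<le> 4 * k" "card D\<^sub>2 \<le> 4 * k" "D\<^sub>1 \<noteq> {}" "D\<^sub>2 \<noteq> {}"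
    and deg: "\<forall>x\<in>D\<^sub>1. (1 - \<delta> / 4) * k \<le> card {y \<in> D\<^sub>1. adj H x y}"
       "\<forall>x\<in>D\<^sub>2. (1 - \<delta> / 4) * k \<le> card {y \<in> D\<^sub>2. adj H x y}"
    and rob: "robust (adj H) D\<^sub>1 (\<delta> / 8 * k)" "robust (adj H) D\<^sub>2 (\<delta> / 8 * k)"
    and inter: "card (D\<^sub>1 \<inter> D\<^sub>2) \<le> \<delta> / 2 * k"
    and q: "q \<le> \<delta> / 16 * k" "\<delta> / 32 * k < q"
    and Ps: "finite Ps" "card Ps = q" "disjoint_walks {(u, v). adj H u v} D\<^sub>1 D\<^sub>2 Ps" "\<forall>p\<in>Ps. trimmed D\<^sub>1 D\<^sub>2 p"
  shows "\<exists>(K :: 'a sgraph) \<psi>. minor_model H K \<psi> \<and> is_host K k \<delta> (\<delta> / 32)"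
proof -
  note fin = finite_simple_graph[OF H]
  have fD: "finite D\<^sub>1" "finite D\<^sub>2" using D fin finite_subset by blast+
  have k0: "real k > 0"
  proof (rule ccontr)
    assume "\<not> ?thesis"
    then show False using q by simp
  qed
  have P: "walk {(u, v). adj H u v} p" "p \<noteq> []" "hd p \<in> D\<^sub>1" "last p \<in> D\<^sub>2"
      "set (tl p) \<inter> D\<^sub>1 = {}" "set (butlast p) \<inter> D\<^sub>2 = {}" if "p \<in> Ps" for p
    using Ps(3,4) that unfolding disjoint_walks_def walk_between_def walk_def trimmed_def by auto
  have disj: "set p \<inter> set p' = {}" if "p \<in> Ps" "p' \<in> Ps" "p \<noteq> p'" for p p'
    using Ps(3) that unfolding disjoint_walks_def by blast
  have D1p: "z = hd p" if "p \<in> Ps" "z \<in> set p" "z \<in> D\<^sub>1" for p z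
    using P(2,5)[OF that(1)] that(2,3) by (cases p) auto
  have D2p: "z = last p" if "p \<in> Ps" "z \<in> set p" "z \<in> D\<^sub>2" for p z
    using P(2,6)[OF that(1)] that(2,3) by (cases p rule: rev_cases) auto
  have hdin: "hd p \<in> set p" and lastin: "last p \<in> set p" if "p \<in> Ps" for p using P(2)[OF that] by auto
  \<comment> \<open>The vertices of the first piece swallowed by a branch set. A walk with equal
    ends is a single common vertex of both pieces and swallows nothing.\<close>
  define S where "S = {hd p |p. p \<in> Ps \<and> hd p \<noteq> last p}"
  define \<psi> where "\<psi> = (\<lambda>x. if \<exists>p\<in>Ps. last p = x then set (SOME p. p \<in> Ps \<and> last p = x) else {x})"
  define V where "V = (D\<^sub>1 \<union> D\<^sub>2) - S"
  define K where "K = SGraph V {{x, y} | x y. x \<in> V \<and> y \<in> V \<and> x \<noteq> y \<and> (\<exists>u\<in>\<psi> x. \<exists>v\<in>\<psi> y. adj H u v)}"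
  have \<psi>last: "\<psi> (last p) = set p" if "p \<in> Ps" for p
  proof -
    have "(SOME p'. p' \<in> Ps \<and> last p' = last p) = p"
    proof (rule some_equality)
      fix p' assume "p' \<in> Ps \<and> last p' = last p"
      then show "p' = p" using disj[of p' p] that lastin[of p] lastin[of p'] by auto
    qed (use that in auto)
    then show ?thesis using that unfolding \<psi>_def by auto
  qed
  have \<psi>other: "\<psi> x = {x}" if "\<And>p. p \<in> Ps \<Longrightarrow> last p \<noteq> x" for x
    using that unfolding \<psi>_def by auto
  have \<psi>cases: "(\<exists>p\<in>Ps. x = last p \<and> \<psi> x = set p) \<or> ((\<forall>p\<in>Ps. last p \<noteq> x) \<and> \<psi> x = {x})" for x
    using \<psi>last \<psi>other by metis
  have self: "x \<in> \<psi> x" for x using \<psi>cases[of x] lastin by auto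
  have Sp: "x \<in> S" if "p \<in> Ps" "x \<in> set p" "x \<in> D\<^sub>1" "x \<noteq> last p" for p x
    using D1p[OF that(1-3)] that unfolding S_def by blast
  have SD2: "x \<notin> D\<^sub>2" if "x \<in> S" for x
    using that D2p hdin unfolding S_def by blast
  have SD1: "S \<subseteq> D\<^sub>1" using P(3) unfolding S_def by blast
  have D2V: "D\<^sub>2 \<subseteq> V" using SD2 unfolding V_def by blast
  have VH: "V \<subseteq> verts H" using D unfolding V_def by blast
  have fV: "finite V" using VH fin finite_subset by blast
  have "S \<subseteq> hd ` Ps" unfolding S_def by blast
  then have cS: "card S \<le> q" using Ps(1,2) surj_card_le by blast
  have fS: "finite S" using SD1 fD finite_subset by blast
  \<comment> \<open>A branch set contains no vertex of K besides its own name. The walks are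
    trimmed, so the only other vertex of the pieces on a walk is its start, which lies in S.\<close>
  have onlyV: "z = x" if xz: "x \<in> V" "z \<in> V" "z \<in> \<psi> x" for x z
  proof (rule ccontr)
    assume "z \<noteq> x"
    then obtain p where p: "p \<in> Ps" "x = last p" "z \<in> set p" using \<psi>cases[of x] xz by auto
    then have "z \<in> D\<^sub>1 \<or> z \<in> D\<^sub>2" using xz unfolding V_def by blast
    then show False using Sp[OF p(1,3)] D2p[OF p(1,3)] p \<open>z \<noteq> x\<close> xz unfolding V_def by blast
  qed
  have walk_adj: "conn (adj H) (set p)" if "p \<in> Ps" for p
    by (rule conn_set_walk[OF P(1)[OF that]]) auto
  have sK: "simple_graph K" unfolding simple_graph_def K_def using fV by auto
  have adjK: "adj K x y \<longleftrightarrow> x \<in> V \<and> y \<in> V \<and> x \<noteq> y \<and> (\<exists>u\<in>\<psi> x. \<exists>v\<in>\<psi> y. adj H u v)" for x y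
    unfolding K_def adj_def by (auto simp: doubleton_eq_iff insert_commute intro: adj_sym[unfolded adj_def])
  have vK: "verts K = V" unfolding K_def by simp
  have psub: "set p \<subseteq> verts H" if "p \<in> Ps" for p
  proof
    fix z assume "z \<in> set p"
    show "z \<in> verts H"
    proof (cases "tl p = []")
      case True
      then have "p = [hd p]" using P(2)[OF that] by (metis list.collapse)
      then have "z = hd p" using \<open>z \<in> set p\<close> by (metis empty_iff empty_set set_ConsD)
      then show ?thesis using P(3)[OF that] D by blast
    next
      case False
      then have "set p \<noteq> {z}" "z \<in> set p"
        using P(2,3,5)[OF that] \<open>z \<in> set p\<close> by (auto; metis disjoint_iff hd_Cons_tl hd_in_set list.set_intros(1) list.set_sel(2) singletonD)+
      then have "\<exists>x\<in>{z}. \<exists>y\<in>set p - {z}. adj H x y" by (intro connD[OF walk_adj[OF that]]) auto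
      then show ?thesis using adj_simple[OF H] by blast
    qed
  qed
  have model: "minor_model H K \<psi>"
  proof (rule minor_modelI)
    fix x assume x: "x \<in> verts K"
    show "\<psi> x \<subseteq> verts H" using \<psi>cases[of x] psub x VH unfolding vK by auto
    show "\<psi> x \<noteq> {}" using self by blast
    show "conn (adj H) (\<psi> x)" using \<psi>cases[of x] walk_adj by auto
  next
    fix x y assume xy: "x \<in> verts K" "y \<in> verts K" "x \<noteq> y"
    show "\<psi> x \<inter> \<psi> y = {}"
    proof (rule ccontr)
      assume "\<psi> x \<inter> \<psi> y \<noteq> {}"
      then obtain z where z: "z \<in> \<psi> x" "z \<in> \<psi> y" by blast
      have "x \<noteq> z" using z(2) onlyV[of y x] xy unfolding vK by blast
      moreover have "y \<noteq> z" using z(1) onlyV[of x y] xy unfolding vK by blast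
      ultimately show False
      proof -
        obtain p where p: "p \<in> Ps" "last p = x" using \<psi>cases[of x] z(1) \<open>x \<noteq> z\<close> by auto
        obtain p' where p': "p' \<in> Ps" "last p' = y" using \<psi>cases[of y] z(2) \<open>y \<noteq> z\<close> by auto
        have "p \<noteq> p'" using xy p p' by blast
        then show False using disj[of p p'] p p' z \<psi>last by blast
      qed
    qed
  next
    fix x y assume "x \<in> verts K" "y \<in> verts K" "adj K x y"
    then show "\<exists>u\<in>\<psi> x. \<exists>v\<in>\<psi> y. adj H u v" using adjK by blast
  qed
  have HK: "adj K x y" if "x \<in> V" "y \<in> V" "adj H x y" for x y
    using that self adjK adj_simple(3)[OF H that(3)] by blast
  have degK: "(1 - \<delta>) * k \<le> card (nbrs K x)" if x: "x \<in> V" for x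
  proof (cases "x \<in> D\<^sub>2")
    case True
    have "{y \<in> D\<^sub>2. adj H x y} \<subseteq> nbrs K x" using HK[OF x] D2V unfolding nbrs_def by blast
    then have "card {y \<in> D\<^sub>2. adj H x y} \<le> card (nbrs K x)" using finite_simple_graph(3)[OF sK] by (rule card_mono[rotated])
    moreover have "(1 - \<delta> / 4) * k \<le> card {y \<in> D\<^sub>2. adj H x y}" using deg True by blast
    moreover have "(1 - \<delta>) * k \<le> (1 - \<delta> / 4) * k" using \<delta> by (intro mult_right_mono) auto
    ultimately show ?thesis by linarith
  next
    case False
    then have x1: "x \<in> D\<^sub>1" using x unfolding V_def by blast
    have "{y \<in> D\<^sub>1. adj H x y} \<subseteq> nbrs K x \<union> S" using HK[OF x] unfolding nbrs_def V_def by blast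
    then have "card {y \<in> D\<^sub>1. adj H x y} \<le> card (nbrs K x \<union> S)"
      using finite_simple_graph(3)[OF sK] fS by (intro card_mono) auto
    also have "\<dots> \<le> card (nbrs K x) + q" using card_Un_le[of "nbrs K x" S] cS by linarith
    finally have "real (card {y \<in> D\<^sub>1. adj H x y}) \<le> card (nbrs K x) + q" by linarith
    moreover have "(1 - \<delta> / 4) * k \<le> card {y \<in> D\<^sub>1. adj H x y}" using deg x1 by blast
    moreover have "(1 - \<delta>) * k + \<delta> / 16 * k \<le> (1 - \<delta> / 4) * k" using \<delta> k0 by (simp add: algebra_simps)
    ultimately show ?thesis using q by linarith
  qed
  \<comment> \<open>Both pieces stay connected by robustness. It remains to join them through a walk
    whose end is not in X.\<close>
  have conK: "conn (adj K) (V - X)" if X: "X \<subseteq> V" "card X \<le> \<delta> / 32 * k" for X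
  proof -
    have fX: "finite X" using X fV finite_subset by blast
    have c2: "card (D\<^sub>2 \<inter> X) \<le> \<delta> / 8 * k"
    proof -
      have "card (D\<^sub>2 \<inter> X) \<le> card X" using fX by (intro card_mono) auto
      moreover have "\<delta> / 32 * k \<le> \<delta> / 8 * k" using \<delta> by (intro mult_right_mono) auto
      ultimately show ?thesis using X(2) by linarith
    qed
    have c1: "card (D\<^sub>1 \<inter> (S \<union> X)) \<le> \<delta> / 8 * k"
    proof -
      have "card (D\<^sub>1 \<inter> (S \<union> X)) \<le> card (S \<union> X)" using fX fS by (intro card_mono) auto
      also have "\<dots> \<le> q + card X" using card_Un_le[of S X] cS by linarith
      finally have "real (card (D\<^sub>1 \<inter> (S \<union> X))) \<le> q + card X" by linarith
      also have "\<dots> \<le> \<delta> / 16 * k + \<delta> / 32 * k" using q X(2) by linarith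
      also have "\<dots> \<le> \<delta> / 8 * k" using \<delta> k0 by (simp add: algebra_simps)
      finally show ?thesis .
    qed
    have con2: "conn (adj K) (D\<^sub>2 - X)"
      by (rule conn_mono[OF robustD[OF rob(2) fD(2) c2]]) (use D2V HK in blast)
    have con1: "conn (adj K) (D\<^sub>1 - (S \<union> X))"
      by (rule conn_mono[OF robustD[OF rob(1) fD(1) c1]]) (use HK in \<open>auto simp: V_def\<close>)
    have eq: "V - X = (D\<^sub>2 - X) \<union> (D\<^sub>1 - (S \<union> X))" using D2V unfolding V_def by blast
    have "\<exists>p\<in>Ps. last p \<notin> X"
    proof (rule ccontr)
      assume "\<not> ?thesis"
      then have "last ` Ps \<subseteq> X" by blast
      then have "card (last ` Ps) \<le> card X" using fX by (rule card_mono[rotated])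
      moreover have "inj_on last Ps"
      proof (rule inj_onI, rule ccontr)
        fix p p' assume "p \<in> Ps" "p' \<in> Ps" "last p = last p'" "p \<noteq> p'"
        then show False using disj[of p p'] lastin[of p] lastin[of p'] by auto
      qed
      ultimately have "q \<le> card X" using card_image Ps(2) by metis
      then show False using X(2) q by linarith
    qed
    then obtain p where p: "p \<in> Ps" "last p \<notin> X" by blast
    have l2: "last p \<in> D\<^sub>2 - X" using P(4)[OF p(1)] p(2) by blast
    show ?thesis
    proof (cases "hd p = last p")
      case True
      have "hd p \<notin> S"
      proof
        assume "hd p \<in> S"
        then show False using SD2[of "hd p"] l2 True by simp
      qed
      then have "last p \<in> D\<^sub>1 - (S \<union> X)" using True P(3)[OF p(1)] p(2) by auto
      then show ?thesis unfolding eq using l2 by (intro conn_Un[OF con2 con1]) blast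
    next
      case False
      \<comment> \<open>The start of the walk was contracted away, but it has more neighbours in
        \<open>D\<^sub>1\<close> than S and X can cover. Such a neighbour w is adjacent in K to the
        end of the walk.\<close>
      have h1: "hd p \<in> D\<^sub>1" using P(3)[OF p(1)] .
      have "\<not> {y \<in> D\<^sub>1. adj H (hd p) y} \<subseteq> D\<^sub>1 \<inter> (S \<union> X)"
      proof
        assume "{y \<in> D\<^sub>1. adj H (hd p) y} \<subseteq> D\<^sub>1 \<inter> (S \<union> X)"
        then have "card {y \<in> D\<^sub>1. adj H (hd p) y} \<le> card (D\<^sub>1 \<inter> (S \<union> X))" using fD by (intro card_mono) auto
        moreover have "(1 - \<delta> / 4) * k \<le> card {y \<in> D\<^sub>1. adj H (hd p) y}" using deg h1 by blast
        ultimately have "(1 - \<delta> / 4) * k \<le> \<delta> / 8 * k" using c1 by linarith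
        then have "1 - \<delta> / 4 \<le> \<delta> / 8" using k0 by simp
        then show False using \<delta> by linarith
      qed
      then obtain w where w: "w \<in> D\<^sub>1 - (S \<union> X)" "adj H (hd p) w" by blast
      have wl: "w \<noteq> last p"
      proof
        assume "w = last p"
        then have "w = hd p" using D1p[OF p(1) lastin[OF p(1)]] w by blast
        then show False using \<open>w = last p\<close> False by simp
      qed
      have "adj K (last p) w"
        using wl w l2 D2V self[of w] hdin[OF p(1)] \<psi>last[OF p(1)] unfolding adjK V_def by blast
      then show ?thesis unfolding eq
        by (intro conn_Un_edge[OF con2 con1 l2 w(1)]) (auto intro: adj_sym)
    qed
  qed
  have c1: "(1 - \<delta> / 4) * k \<le> card D\<^sub>1" "(1 - \<delta> / 4) * k \<le> card D\<^sub>2"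
    using card_min_degree[OF fD(1) D(5) deg(1)] card_min_degree[OF fD(2) D(6) deg(2)] by auto
  have "card (D\<^sub>1 \<union> D\<^sub>2) + card (D\<^sub>1 \<inter> D\<^sub>2) = card D\<^sub>1 + card D\<^sub>2" using card_Un_Int[OF fD] by simp
  then have un: "real (card (D\<^sub>1 \<union> D\<^sub>2)) + card (D\<^sub>1 \<inter> D\<^sub>2) = real (card D\<^sub>1) + card D\<^sub>2" by linarith
  have "card (D\<^sub>1 \<union> D\<^sub>2) \<le> card V + card S"
    using card_Un_le[of V S] card_mono[of "V \<union> S" "D\<^sub>1 \<union> D\<^sub>2"] fV fS unfolding V_def by (auto intro: le_trans)
  then have "real (card (D\<^sub>1 \<union> D\<^sub>2)) \<le> real (card V) + q" using cS by linarith
  then have "2 * ((1 - \<delta> / 4) * k) - \<delta> / 2 * k - \<delta> / 16 * k \<le> card V" using c1 un inter q by linarith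
  moreover have "2 * (1 - \<delta>) * k \<le> 2 * ((1 - \<delta> / 4) * k) - \<delta> / 2 * k - \<delta> / 16 * k" using \<delta> k0 by (simp add: algebra_simps)
  ultimately have low: "2 * (1 - \<delta>) * k \<le> card V" by linarith
  have "card V \<le> card (D\<^sub>1 \<union> D\<^sub>2)" using fD unfolding V_def by (intro card_mono) auto
  then have "card V \<le> 8 * k" using card_Un_le[of D\<^sub>1 D\<^sub>2] D(3,4) by linarith
  then have "is_host K k \<delta> (\<delta> / 32)" using sK low degK conK unfolding is_host_def vK by auto
  then show ?thesis using model by blast
qed

text \<open>A minimal dense minor H with at most 8k vertices is itself a host. A larger one has more
  than 4k vertices of degree at most 4k, each with a robust piece in its neighbourhood. Two nearly
  disjoint pieces are linked; if any two overlap substantially, unions of pieces are robust, and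
  only their size has to be adjusted.\<close>

theorem dense_imp_host:
  fixes G :: "'a sgraph" and k :: nat and \<delta> :: real
  assumes G: "simple_graph G" "verts G \<noteq> {}" "k * card (verts G) \<le> card (edges G)"
    and \<delta>: "0 < \<delta>" "\<delta> < 1 / 2" "32 < \<delta> * real k"
  shows "\<exists>(K :: 'a sgraph) \<phi>. minor_model G K \<phi> \<and> is_host K k \<delta> (\<delta> / 32)"
proof -
  define s where "s = \<delta> / 8 * real k"
  have k0: "real k > 0"
  proof (rule ccontr)
    assume "\<not> ?thesis"
    then show False using \<delta> by simp
  qed
  have s0: "0 < s" "2 * s \<le> real k" using \<delta> k0 unfolding s_def by (auto simp: field_simps)
  have nG: "card (verts G) > 0" using G finite_simple_graph(1) by (simp add: card_gt_0_iff)
  have "2 * (k * card (verts G)) \<le> card (verts G) * (card (verts G) - 1)"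
    using G(3) card_edges_le[OF G(1)] by linarith
  then have "card (verts G) * (2 * k) \<le> card (verts G) * (card (verts G) - 1)" by (simp add: mult_ac)
  then have "2 * k \<le> card (verts G) - 1" using nG by simp
  then have kG: "k \<le> card (verts G)" by simp
  have dG: "real k * (real (card (verts G)) - s) < real (card (edges G))"
  proof -
    have "real k * real (card (verts G)) \<le> real (card (edges G))" using G(3) by (metis of_nat_le_iff of_nat_mult)
    moreover have "real k * (real (card (verts G)) - s) < real k * real (card (verts G))"
      using k0 s0 by (intro mult_strict_left_mono) auto
    ultimately show ?thesis by linarith
  qed
  obtain H :: "'a sgraph" and \<phi> where H: "simple_graph H" "minor_model G H \<phi>" "k < card (verts H)"
      "real k * (real (card (verts H)) - s) < real (card (edges H))"
      "real (card (edges H)) \<le> real k * (real (card (verts H)) - s) + 1"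
      "\<And>v. v \<in> verts H \<Longrightarrow> k < card (nbrs H v)"
      "\<And>u v. adj H u v \<Longrightarrow> k \<le> card (nbrs H u \<inter> nbrs H v)"
      "\<And>X. X \<subseteq> verts H \<Longrightarrow> real (card X) \<le> s \<Longrightarrow> conn (adj H) (verts H - X)"
    by (rule dense_minimal_minor[OF G(1) kG dG s0]) blast
  note fin = finite_simple_graph[OF H(1)]
  let ?n = "card (verts H)"
  have mono: "(1 - \<delta>) * real k \<le> (1 - \<delta> / 4) * real k" "(1 - \<delta> / 4) * real k \<le> real k" "(1 - \<delta>) * real k \<le> real k"
    using \<delta> k0 by (auto simp: algebra_simps)
  have suff: ?thesis if "minor_model H K \<psi>" "is_host K k \<delta> (\<delta> / 32)" for K :: "'a sgraph" and \<psi>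
    using minor_model_trans[OF H(2) that(1)] that(2) by blast
  show ?thesis
  proof (cases "?n \<le> 8 * k")
    case True
    \<comment> \<open>With n < 2 (1 - \<open>\<delta>\<close>) k vertices there are at most n^2 / 2
      edges, which forces \<open>\<delta>\<close> n < s = \<open>\<delta>\<close> k / 8, although n
      exceeds k.\<close>
    have low: "2 * (1 - \<delta>) * real k \<le> real ?n"
    proof (rule ccontr)
      assume n: "\<not> ?thesis"
      have "2 * card (edges H) \<le> ?n * (?n - 1)" by (rule card_edges_le[OF H(1)])
      also have "\<dots> \<le> ?n * ?n" by simp
      finally have "2 * real (card (edges H)) \<le> real ?n * real ?n" by (metis of_nat_le_iff of_nat_mult of_nat_numeral)
      moreover have "real ?n * real ?n \<le> real ?n * (2 * (1 - \<delta>) * real k)"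
        using n by (intro mult_left_mono) auto
      ultimately have "real k * (real ?n - s) < real ?n * ((1 - \<delta>) * real k)" using H(4) by (simp add: algebra_simps)
      then have "real k * (real ?n - s) < real k * (real ?n * (1 - \<delta>))" by (simp add: algebra_simps)
      then have "\<delta> * real ?n < s" using k0 by (simp add: algebra_simps)
      moreover have "\<delta> * real k \<le> \<delta> * real ?n" using H(3) \<delta> by (intro mult_left_mono) auto
      ultimately show False using \<delta> k0 unfolding s_def by (simp add: algebra_simps)
    qed
    have "is_host H k \<delta> (\<delta> / 32)"
      unfolding is_host_def
    proof (intro conjI ballI allI impI)
      fix v assume "v \<in> verts H"
      then have "real k \<le> real (card (nbrs H v))" using H(6)[of v] by simp
      then show "(1 - \<delta>) * real k \<le> real (card (nbrs H v))" using mono by linarith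
    next
      fix X assume X: "X \<subseteq> verts H" "real (card X) \<le> \<delta> / 32 * real k"
      moreover have "\<delta> / 32 * real k \<le> s" using \<delta> k0 unfolding s_def by (intro mult_right_mono) auto
      ultimately show "conn (adj H) (verts H - X)" using H(8) by simp
    qed (use H(1) low True in auto)
    then show ?thesis using H(2) by blast
  next
    case False
    then have n8: "8 * k < ?n" by simp
    define L where "L = {v \<in> verts H. card (nbrs H v) \<le> 4 * k}"
    have LH: "L \<subseteq> verts H" and fL: "finite L" using fin unfolding L_def by auto
    \<comment> \<open>The degree sum is at most 2 k n, so at most n / 2 vertices have degree above
      4k, and n / 2 is more than 4k.\<close>
    have cL: "4 * k < card L"
    proof -
      let ?M = "verts H - L"
      have "real (card ?M) * (4 * real k) \<le> (\<Sum>v\<in>?M. real (card (nbrs H v)))"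
      proof -
        have "(\<Sum>v\<in>?M. 4 * real k) \<le> (\<Sum>v\<in>?M. real (card (nbrs H v)))"
          by (rule sum_mono) (auto simp: L_def)
        then show ?thesis by simp
      qed
      also have "\<dots> \<le> (\<Sum>v\<in>verts H. real (card (nbrs H v)))" using fin by (intro sum_mono2) auto
      also have "\<dots> = 2 * real (card (edges H))"
        using handshake[OF H(1)] by (metis of_nat_mult of_nat_numeral of_nat_sum)
      also have "\<dots> \<le> 2 * (real k * real ?n)"
      proof -
        have "1 \<le> real k * s"
        proof -
          have "1 \<le> s" using \<delta>(3) unfolding s_def by simp
          moreover have "1 \<le> real k" using k0 by simp
          ultimately show ?thesis using mult_mono[of 1 "real k" 1 s] by simp
        qed
        then show ?thesis using H(5) by (simp add: algebra_simps)
      qed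
      finally have "real k * (2 * real (card ?M)) \<le> real k * real ?n" by (simp add: algebra_simps)
      then have "2 * card ?M \<le> ?n" using k0 by simp
      moreover have "card ?M = ?n - card L" using fL LH by (simp add: card_Diff_subset)
      ultimately show ?thesis using n8 by linarith
    qed
    have piece: "\<exists>D\<subseteq>nbrs H v. D \<noteq> {} \<and> robust (adj H) D s \<and> (\<forall>x\<in>D. (1 - \<delta> / 4) * real k \<le> card {y \<in> D. adj H x y})"
      if v: "v \<in> L" for v
    proof -
      have "\<exists>D\<subseteq>nbrs H v. D \<noteq> {} \<and> robust (adj H) D s \<and> (\<forall>x\<in>D. real k - 2 * s \<le> card {y \<in> D. adj H x y})"
      proof (rule robust_piece)
        show "nbrs H v \<noteq> {}" using H(6)[of v] v LH by auto
        show "real (card (nbrs H v)) \<le> 4 * real k" using v unfolding L_def by simp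
        show "6 * s < real k" using \<delta> k0 unfolding s_def by (simp add: field_simps)
        fix x assume x: "x \<in> nbrs H v"
        have "nbrs H v \<inter> nbrs H x = {y \<in> nbrs H v. adj H x y}" unfolding nbrs_def by auto
        then show "real k \<le> card {y \<in> nbrs H v. adj H x y}" using H(7)[of v x] x unfolding nbrs_def by simp
      qed (use fin s0 in auto)
      moreover have "real k - 2 * s = (1 - \<delta> / 4) * real k" unfolding s_def by (simp add: algebra_simps)
      ultimately show ?thesis by simp
    qed
    have "\<forall>v\<in>L. \<exists>D. D \<subseteq> nbrs H v \<and> D \<noteq> {} \<and> robust (adj H) D s \<and> (\<forall>x\<in>D. (1 - \<delta> / 4) * real k \<le> card {y \<in> D. adj H x y})"
      using piece by blast
    from bchoice[OF this] obtain D where D: "\<forall>v\<in>L. D v \<subseteq> nbrs H v \<and> D v \<noteq> {} \<and> robust (adj H) (D v) s \<and>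
        (\<forall>x\<in>D v. (1 - \<delta> / 4) * real k \<le> card {y \<in> D v. adj H x y})" ..
    have Dn: "D v \<subseteq> nbrs H v" "D v \<noteq> {}" "robust (adj H) (D v) s"
        "\<forall>x\<in>D v. (1 - \<delta> / 4) * real k \<le> card {y \<in> D v. adj H x y}" if "v \<in> L" for v
      using D that by blast+
    have DH: "D v \<subseteq> verts H" if "v \<in> L" for v using Dn(1)[OF that] nbrs_subset[OF H(1)] by blast
    have fD: "finite (D v)" if "v \<in> L" for v using DH[OF that] fin finite_subset by blast
    have cD: "card (D v) \<le> 4 * k" if "v \<in> L" for v
      using card_mono[OF fin(3) Dn(1)[OF that]] that unfolding L_def by auto
    have cD2: "(1 - \<delta> / 4) * real k \<le> card (D v)" if "v \<in> L" for v
      using card_min_degree[OF fD[OF that] Dn(2)[OF that] Dn(4)[OF that]] .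
    show ?thesis
    proof (cases "\<exists>v\<in>L. \<exists>w\<in>L. real (card (D v \<inter> D w)) \<le> \<delta> / 2 * real k")
      case True
      then obtain v w where vw: "v \<in> L" "w \<in> L" "real (card (D v \<inter> D w)) \<le> \<delta> / 2 * real k" by blast
      \<comment> \<open>Since \<open>\<delta>\<close> k > 32, rounding down loses less than half, so
        q stays above \<open>\<delta>\<close> k / 32.\<close>
      define q where "q = nat \<lfloor>\<delta> / 16 * real k\<rfloor>"
      have q: "real q \<le> \<delta> / 16 * real k" "\<delta> / 32 * real k < real q"
      proof -
        have "0 \<le> \<delta> / 16 * real k" using \<delta> k0 by simp
        then have "real q = of_int \<lfloor>\<delta> / 16 * real k\<rfloor>" unfolding q_def by simp
        then show "real q \<le> \<delta> / 16 * real k" "\<delta> / 32 * real k < real q"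
          using \<delta>(3) floor_correct[of "\<delta> / 16 * real k"] by linarith+
      qed
      let ?E = "{(u, v). adj H u v}"
      have "\<exists>Ps. finite Ps \<and> card Ps = q \<and> disjoint_walks ?E (D v) (D w) Ps \<and> (\<forall>p\<in>Ps. trimmed (D v) (D w) p)"
      proof (rule menger)
        have "?E \<subseteq> verts H \<times> verts H" using adj_simple[OF H(1)] by auto
        then show "finite ?E" using fin finite_subset by blast
        show "finite (D v)" "finite (D w)" using fD vw by auto
        fix S assume S: "finite S" "separates ?E (D v) (D w) S"
        show "q \<le> card S"
        proof (rule ccontr)
          assume n: "\<not> ?thesis"
          have big: "\<not> D u \<subseteq> S" if "u \<in> L" for u
          proof
            assume "D u \<subseteq> S"
            then have "card (D u) \<le> card S" using S(1) by (rule card_mono[rotated])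
            then have "(1 - \<delta> / 4) * real k < real q" using cD2[OF that] n by linarith
            then have "(1 - \<delta> / 4) * real k < \<delta> / 16 * real k" using q by linarith
            then show False using k0 \<delta> by simp
          qed
          obtain a b where ab: "a \<in> D v - S" "b \<in> D w - S" using big[OF vw(1)] big[OF vw(2)] by blast
          have "card (verts H \<inter> S) \<le> card S" using S(1) by (intro card_mono) auto
          then have "real (card (verts H \<inter> S)) \<le> real q" using n by linarith
          also have "\<dots> \<le> s" using q(1) \<delta> k0 unfolding s_def by (simp add: algebra_simps)
          finally have "conn (adj H) (verts H - (verts H \<inter> S))" by (intro H(8)) auto
          moreover have "a \<in> verts H - (verts H \<inter> S)" "b \<in> verts H - (verts H \<inter> S)"
            using ab DH vw by blast+
          ultimately obtain p where p: "walk ?E p" "hd p = a" "last p = b" "set p \<subseteq> verts H - (verts H \<inter> S)"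
            using conn_imp_walk[of "adj H" _ a b ?E] by blast
          then have "walk_between ?E (D v) (D w) p" using ab unfolding walk_between_def by blast
          then show False using S(2) p(4) unfolding separates_def by blast
        qed
      qed
      then obtain Ps where Ps: "finite Ps" "card Ps = q" "disjoint_walks ?E (D v) (D w) Ps" "\<forall>p\<in>Ps. trimmed (D v) (D w) p"
        by blast
      have rob: "robust (adj H) (D v) (\<delta> / 8 * real k)" "robust (adj H) (D w) (\<delta> / 8 * real k)"
        using Dn(3) vw unfolding s_def by blast+
      obtain K :: "'a sgraph" and \<psi> where "minor_model H K \<psi>" "is_host K k \<delta> (\<delta> / 32)"
        using linked_pieces_host[OF H(1) \<delta>(1,2) DH[OF vw(1)] DH[OF vw(2)] cD[OF vw(1)] cD[OF vw(2)]
          Dn(2)[OF vw(1)] Dn(2)[OF vw(2)] Dn(4)[OF vw(1)] Dn(4)[OF vw(2)] rob vw(3) q Ps] by blast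
      then show ?thesis by (rule suff)
    next
      case False
      then have meet: "\<delta> / 2 * real k < real (card (D v \<inter> D w))" if "v \<in> L" "w \<in> L" for v w
        using that by force
      have unH: "(\<Union>v\<in>I. D v) \<subseteq> verts H" if "I \<subseteq> L" for I using DH that by blast
      have gs: "\<delta> / 32 * real k \<le> s" "\<delta> / 32 * real k < \<delta> / 2 * real k"
        using \<delta> k0 unfolding s_def by (auto simp: field_simps)
      \<comment> \<open>The deleted set X is smaller than any pairwise overlap, so what is left of
        each piece still meets what is left of a fixed one.\<close>
      have rob: "robust (adj H) (\<Union>v\<in>I. D v) (\<delta> / 32 * real k)" if I: "I \<subseteq> L" "I \<noteq> {}" for I
        unfolding robust_def
      proof (intro allI impI)
        fix X assume X: "X \<subseteq> (\<Union>v\<in>I. D v)" "real (card X) \<le> \<delta> / 32 * real k"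
        have fX: "finite X" using X(1) unH[OF I(1)] fin finite_subset by (metis subset_trans)
        obtain v0 where v0: "v0 \<in> I" using I by blast
        have con: "conn (adj H) (D v - X)" if "v \<in> I" for v
        proof (rule robustD[OF Dn(3) fD])
          have "card (D v \<inter> X) \<le> card X" using fX by (intro card_mono) auto
          then show "real (card (D v \<inter> X)) \<le> s" using X(2) gs by linarith
        qed (use that I in auto)
        have "conn (adj H) ((D v0 - X) \<union> (\<Union>v\<in>I. D v - X))"
        proof (rule conn_UN_core)
          fix v assume v: "v \<in> I"
          show "(D v - X) \<inter> (D v0 - X) \<noteq> {}"
          proof
            assume "(D v - X) \<inter> (D v0 - X) = {}"
            then have "D v \<inter> D v0 \<subseteq> X" by blast
            then have "card (D v \<inter> D v0) \<le> card X" using fX by (rule card_mono[rotated])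
            then show False using meet[of v v0] v v0 I X(2) gs by force
          qed
        qed (use con v0 in auto)
        moreover have "(D v0 - X) \<union> (\<Union>v\<in>I. D v - X) = (\<Union>v\<in>I. D v) - X" using v0 by blast
        ultimately show "conn (adj H) ((\<Union>v\<in>I. D v) - X)" by simp
      qed
      have deg: "(1 - \<delta>) * real k \<le> card {y \<in> Z. adj H x y}"
        if "v \<in> L" "x \<in> D v" "D v \<subseteq> Z" "finite Z" for x v Z
      proof -
        have "card {y \<in> D v. adj H x y} \<le> card {y \<in> Z. adj H x y}" using that by (intro card_mono) auto
        then show ?thesis using Dn(4)[OF that(1)] that(2) mono by force
      qed
      have Lne: "L \<noteq> {}" using cL by auto
      show ?thesis
      proof (cases "2 * k \<le> card (\<Union>v\<in>L. D v)")
        case True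
        \<comment> \<open>A smallest subfamily covering 2k vertices covers fewer than 2k after
          losing one member, hence at most 6k in all, within the limit 8k.\<close>
        let ?P = "\<lambda>I. I \<subseteq> L \<and> 2 * k \<le> card (\<Union>v\<in>I. D v)"
        obtain I where I: "?P I" and min: "\<And>J. ?P J \<Longrightarrow> card I \<le> card J"
          using ex_has_least_nat[of ?P L card] True by blast
        have fI: "finite I" using I fL finite_subset by blast
        have "I \<noteq> {}" using I k0 by auto
        then obtain v where v: "v \<in> I" by blast
        let ?Z = "\<Union>v\<in>I. D v"
        have fZ: "finite ?Z" using unH I fin finite_subset by metis
        have "card (I - {v}) < card I" using card_Diff1_less[OF fI v] .
        then have "\<not> ?P (I - {v})" using min[of "I - {v}"] by force
        then have lt: "card (\<Union>v\<in>I - {v}. D v) < 2 * k" using I by auto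
        have "?Z = D v \<union> (\<Union>v\<in>I - {v}. D v)" using v by blast
        then have "card ?Z \<le> card (D v) + card (\<Union>v\<in>I - {v}. D v)" by (metis card_Un_le)
        then have up: "card ?Z \<le> 8 * k" using lt cD[of v] v I by force
        have "is_host (induced H ?Z) k \<delta> (\<delta> / 32)"
        proof (rule induced_host[OF H(1)])
          show "2 * (1 - \<delta>) * real k \<le> real (card ?Z)"
          proof -
            have "2 * real k \<le> real (card ?Z)" using I by simp
            then show ?thesis using mono by linarith
          qed
          show "card ?Z \<le> 8 * k" using up .
          fix x assume "x \<in> ?Z"
          then obtain u where "u \<in> I" "x \<in> D u" by blast
          then show "(1 - \<delta>) * real k \<le> real (card {y \<in> ?Z. adj H x y})" using deg[of u x ?Z] I fZ by blast
        qed (use unH I rob \<open>I \<noteq> {}\<close> in auto)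
        then show ?thesis using suff minor_model_induced by blast
      next
        case False
        \<comment> \<open>The pieces together have fewer than 2k vertices, so L contains 2k vertices
          outside them. Each of these sees its own piece, about k vertices of the union, and can be
          attached without harming degrees or robustness.\<close>
        let ?Z = "\<Union>v\<in>L. D v"
        have fZ: "finite ?Z" using fL fD by blast
        have "card L \<le> card ((L - ?Z) \<union> ?Z)" using fL fZ by (intro card_mono) auto
        then have "card L \<le> card (L - ?Z) + card ?Z" using card_Un_le le_trans by blast
        then have "2 * k \<le> card (L - ?Z)" using False cL by linarith
        then obtain L' where L': "L' \<subseteq> L - ?Z" "card L' = 2 * k" "finite L'" by (meson obtain_subset_with_card_n)
        let ?Y = "?Z \<union> L'"
        have fY: "finite ?Y" using fZ L' by blast
        have cY: "card ?Y = card ?Z + 2 * k" using card_Un_disjoint[OF fZ L'(3)] L'(1,2) by auto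
        have finN: "finite {y \<in> ?Z. adj H x y}" for x by (rule finite_subset[OF _ fZ]) blast
        have attach: "(1 - \<delta> / 4) * real k \<le> card {y \<in> ?Z. adj H x y}" if "x \<in> L'" for x
        proof -
          have "x \<in> L" using that L' by blast
          then have "D x \<subseteq> {y \<in> ?Z. adj H x y}" using Dn(1)[of x] unfolding nbrs_def by blast
          then have "card (D x) \<le> card {y \<in> ?Z. adj H x y}" using finN by (rule card_mono[rotated])
          then show ?thesis using cD2[OF \<open>x \<in> L\<close>] by linarith
        qed
        have "is_host (induced H ?Y) k \<delta> (\<delta> / 32)"
        proof (rule induced_host[OF H(1)])
          show "?Y \<subseteq> verts H" using unH[of L] L'(1) LH by blast
          show "2 * (1 - \<delta>) * real k \<le> real (card ?Y)"
          proof -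
            have "2 * real k \<le> real (card ?Y)" using cY by simp
            then show ?thesis using mono by linarith
          qed
          show "card ?Y \<le> 8 * k" using cY False by simp
          show "robust (adj H) ?Y (\<delta> / 32 * real k)"
            unfolding robust_def
          proof (intro allI impI)
            fix X assume X: "X \<subseteq> ?Y" "real (card X) \<le> \<delta> / 32 * real k"
            have fX: "finite X" using X fY finite_subset by blast
            have "card (?Z \<inter> X) \<le> card X" using fX by (intro card_mono) auto
            then have "conn (adj H) (?Z - X)" using X(2) by (intro robustD[OF rob fZ]) (use Lne in auto)
            moreover have "\<exists>z\<in>?Z - X. adj H x z" if x: "x \<in> L' - X" for x
            proof (rule ccontr)
              assume "\<not> ?thesis"
              then have "{y \<in> ?Z. adj H x y} \<subseteq> X" by blast
              then have "card {y \<in> ?Z. adj H x y} \<le> card X" using fX by (rule card_mono[rotated])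
              then have "(1 - \<delta> / 4) * real k \<le> \<delta> / 32 * real k" using attach[of x] x X(2) by force
              then show False using k0 \<delta> by simp
            qed
            ultimately have "conn (adj H) ((?Z - X) \<union> (L' - X))" by (intro conn_add_vertices) auto
            moreover have "(?Z - X) \<union> (L' - X) = ?Y - X" by blast
            ultimately show "conn (adj H) (?Y - X)" by simp
          qed
          fix x assume "x \<in> ?Y"
          then show "(1 - \<delta>) * real k \<le> real (card {y \<in> ?Y. adj H x y})"
          proof
            assume "x \<in> ?Z"
            then obtain u where "u \<in> L" "x \<in> D u" by blast
            then show ?thesis using deg[of u x ?Y] fY by blast
          next
            assume x: "x \<in> L'"
            have "card {y \<in> ?Z. adj H x y} \<le> card {y \<in> ?Y. adj H x y}"
              by (rule card_mono[OF finite_subset[OF _ fY]]) auto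
            then show ?thesis using attach[OF x] mono by linarith
          qed
        qed
        then show ?thesis using suff minor_model_induced by blast
      qed
    qed
  qed
qed

section \<open>Tilings by balanced complete bipartite graphs\<close>

text \<open>Only the covered vertex set is recorded, which makes unions and refinements easy. Where
  individual tiles matter, \<open>tiling\<close> is extracted by \<open>tileable_imp_tiling\<close>.
  R is the size of one side of a tile.\<close>

inductive tileable :: "('a \<Rightarrow> 'a \<Rightarrow> bool) \<Rightarrow> nat \<Rightarrow> 'a set \<Rightarrow> bool" for E R where
  tileable_empty: "tileable E R {}"
| tileable_insert: "tileable E R X \<Longrightarrow> card P = R \<Longrightarrow> card Q = R \<Longrightarrow> P \<inter> Q = {} \<Longrightarrow> (P \<union> Q) \<inter> X = {} \<Longrightarrow>
    (\<And>x y. x \<in> P \<Longrightarrow> y \<in> Q \<Longrightarrow> E x y) \<Longrightarrow> tileable E R (P \<union> Q \<union> X)"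

definition tiling :: "('a \<Rightarrow> 'a \<Rightarrow> bool) \<Rightarrow> nat \<Rightarrow> ('a set \<times> 'a set) set \<Rightarrow> bool" where
  "tiling E R T \<longleftrightarrow> finite T \<and>
     (\<forall>t\<in>T. card (fst t) = R \<and> card (snd t) = R \<and> fst t \<inter> snd t = {} \<and> (\<forall>x\<in>fst t. \<forall>y\<in>snd t. E x y)) \<and>
     (\<forall>t\<in>T. \<forall>t'\<in>T. t \<noteq> t' \<longrightarrow> (fst t \<union> snd t) \<inter> (fst t' \<union> snd t') = {})"

abbreviation area :: "'a set \<times> 'a set \<Rightarrow> 'a set" where
  "area t \<equiv> fst t \<union> snd t"

lemma tilingD:
  assumes "tiling E R T"
  shows "finite T" "\<And>t. t \<in> T \<Longrightarrow> card (fst t) = R" "\<And>t. t \<in> T \<Longrightarrow> card (snd t) = R"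
    "\<And>t. t \<in> T \<Longrightarrow> fst t \<inter> snd t = {}" "\<And>t x y. t \<in> T \<Longrightarrow> x \<in> fst t \<Longrightarrow> y \<in> snd t \<Longrightarrow> E x y"
    "\<And>t t'. t \<in> T \<Longrightarrow> t' \<in> T \<Longrightarrow> t \<noteq> t' \<Longrightarrow> area t \<inter> area t' = {}"
proof -
  show "finite T" using assms by (simp add: tiling_def)
  show "card (fst t) = R" "card (snd t) = R" "fst t \<inter> snd t = {}" if "t \<in> T" for t
    using assms that by (simp_all add: tiling_def)
  show "E x y" if "t \<in> T" "x \<in> fst t" "y \<in> snd t" for t x y
    using assms that by (simp add: tiling_def)
  show "area t \<inter> area t' = {}" if "t \<in> T" "t' \<in> T" "t \<noteq> t'" for t t'
    using assms that unfolding tiling_def by meson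
qed

lemma tileable_imp_tiling:
  assumes "tileable E R X" "R > 0"
  shows "\<exists>T. tiling E R T \<and> (\<Union>t\<in>T. area t) = X"
  using assms
proof (induction rule: tileable.induct)
  case tileable_empty
  then show ?case by (intro exI[of _ "{}"]) (auto simp: tiling_def)
next
  case (tileable_insert X P Q)
  then obtain T where T: "tiling E R T" "(\<Union>t\<in>T. area t) = X" by blast
  have "tiling E R (insert (P, Q) T)"
    unfolding tiling_def
  proof (intro conjI ballI impI)
    fix t t' assume t: "t \<in> insert (P, Q) T" "t' \<in> insert (P, Q) T" "t \<noteq> t'"
    have "area u \<inter> (P \<union> Q) = {}" if "u \<in> T" for u using T(2) that tileable_insert by blast
    then have "area u \<inter> area (P, Q) = {}" "area (P, Q) \<inter> area u = {}" if "u \<in> T" for u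
      using that by (simp_all add: Int_commute)
    then show "area t \<inter> area t' = {}"
      using t tilingD(6)[OF T(1), of t t'] by (elim insertE) (simp_all only: simp_thms)
  next
    fix t assume t: "t \<in> insert (P, Q) T"
    then show "card (fst t) = R" "card (snd t) = R" "fst t \<inter> snd t = {}"
      using tilingD(2-4)[OF T(1), of t] tileable_insert by auto
    fix x y assume "x \<in> fst t" "y \<in> snd t"
    then show "E x y" using t tilingD(5)[OF T(1), of t x y] tileable_insert by auto
  qed (use tilingD(1)[OF T(1)] in auto)
  then show ?case using T(2) by (intro exI[of _ "insert (P, Q) T"]) auto
qed

lemma tiling_finite_area:
  assumes "tiling E R T" "R > 0" "t \<in> T"
  shows "finite (fst t)" "finite (snd t)" "finite (area t)" "card (area t) = 2 * R"
proof -
  show f: "finite (fst t)" "finite (snd t)"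
    using tilingD(2,3)[OF assms(1,3)] assms(2) by (metis card_gt_0_iff)+
  then show "finite (area t)" by simp
  show "card (area t) = 2 * R"
    using card_Un_disjoint[OF f tilingD(4)[OF assms(1,3)]] tilingD(2,3)[OF assms(1,3)] by simp
qed

lemma card_tiling:
  assumes "tiling E R T" "R > 0"
  shows "card (\<Union>t\<in>T. area t) = 2 * R * card T"
proof -
  have "card (\<Union>t\<in>T. area t) = (\<Sum>t\<in>T. card (area t))"
    using tilingD[OF assms(1)] tiling_finite_area[OF assms] by (intro card_UN_disjoint) auto
  then show ?thesis using tiling_finite_area(4)[OF assms] by simp
qed

lemma tileable_Un:
  assumes "tileable E R X" "tileable E R Y" "X \<inter> Y = {}"
  shows "tileable E R (X \<union> Y)"
  using assms(1,3)
proof (induction rule: tileable.induct)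
  case tileable_empty
  then show ?case using assms(2) by simp
next
  case (tileable_insert X P Q)
  have "tileable E R (P \<union> Q \<union> (X \<union> Y))"
  proof (rule tileable.tileable_insert)
    show "tileable E R (X \<union> Y)" using tileable_insert by blast
  qed (use tileable_insert in auto)
  then show ?case by (simp add: Un_assoc)
qed

lemma tileable_UN:
  assumes "finite I" "\<And>i. i \<in> I \<Longrightarrow> tileable E R (D i)" "\<And>i j. i \<in> I \<Longrightarrow> j \<in> I \<Longrightarrow> i \<noteq> j \<Longrightarrow> D i \<inter> D j = {}"
  shows "tileable E R (\<Union>i\<in>I. D i)"
  using assms
proof (induction rule: finite_induct)
  case empty
  then show ?case by (simp add: tileable.tileable_empty)
next
  case (insert i I)
  have "tileable E R (D i \<union> (\<Union>i\<in>I. D i))"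
    by (rule tileable_Un) (use insert in auto)
  then show ?case by simp
qed

lemma tileable_biclique:
  assumes "card P = L * R" "card Q = L * R" "finite P" "finite Q" "P \<inter> Q = {}"
    "\<And>x y. x \<in> P \<Longrightarrow> y \<in> Q \<Longrightarrow> E x y"
  shows "tileable E R (P \<union> Q)"
  using assms
proof (induction L arbitrary: P Q)
  case 0
  then show ?case by (simp add: tileable.tileable_empty)
next
  case (Suc L)
  obtain P1 where P1: "P1 \<subseteq> P" "card P1 = R" using obtain_subset_with_card_n[of R P] Suc.prems by auto
  obtain Q1 where Q1: "Q1 \<subseteq> Q" "card Q1 = R" using obtain_subset_with_card_n[of R Q] Suc.prems by auto
  have f: "finite P1" "finite Q1" using P1 Q1 Suc.prems finite_subset by blast+
  have "tileable E R ((P - P1) \<union> (Q - Q1))"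
    by (rule Suc.IH) (use P1 Q1 f Suc.prems in \<open>auto simp: card_Diff_subset\<close>)
  then have "tileable E R (P1 \<union> Q1 \<union> ((P - P1) \<union> (Q - Q1)))"
  proof (rule tileable.tileable_insert)
    show "E x y" if "x \<in> P1" "y \<in> Q1" for x y using that P1(1) Q1(1) Suc.prems(6) by blast
  qed (use P1 Q1 Suc.prems in auto)
  moreover have "P1 \<union> Q1 \<union> ((P - P1) \<union> (Q - Q1)) = P \<union> Q" using P1 Q1 by blast
  ultimately show ?case by simp
qed

lemma tiling_tileable_mult:
  assumes "tiling E (L * R) T" "L * R > 0" "t \<in> T"
  shows "tileable E R (area t)"
  using tiling_finite_area[OF assms] tilingD(2-5)[OF assms(1,3)]
  by (intro tileable_biclique[where L = L]) auto

section \<open>Pigeonhole, double counting and bicliques\<close>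

lemma ex_large_fibre:
  assumes "finite A" "finite B" "B \<noteq> {}" "f ` A \<subseteq> B" "card B * m \<le> card A"
  shows "\<exists>b\<in>B. m \<le> card {a \<in> A. f a = b}"
proof (rule ccontr)
  assume "\<not> ?thesis"
  then have lt: "\<And>b. b \<in> B \<Longrightarrow> card {a \<in> A. f a = b} < m" by force
  have "A = (\<Union>b\<in>B. {a \<in> A. f a = b})" using assms(4) by blast
  then have "card A = card (\<Union>b\<in>B. {a \<in> A. f a = b})" by simp
  also have "\<dots> \<le> (\<Sum>b\<in>B. card {a \<in> A. f a = b})" by (rule card_UN_le[OF assms(2)])
  also have "\<dots> < (\<Sum>b\<in>B. m)" by (rule sum_strict_mono) (use assms lt in auto)
  finally show False using assms(5) by simp
qed

lemma card_filter_swap: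
  assumes "finite A" "finite B"
  shows "(\<Sum>a\<in>A. card {b \<in> B. R a b}) = (\<Sum>b\<in>B. card {a \<in> A. R a b})"
proof -
  have "(\<Sum>a\<in>A. card {b \<in> B. R a b}) = (\<Sum>a\<in>A. \<Sum>b\<in>B. if R a b then 1 else 0)"
    using assms by (intro sum.cong refl) (simp add: sum.If_cases Int_def)
  also have "\<dots> = (\<Sum>b\<in>B. \<Sum>a\<in>A. if R a b then 1 else 0)" by (rule sum.swap)
  also have "\<dots> = (\<Sum>b\<in>B. card {a \<in> A. R a b})"
    using assms by (intro sum.cong refl) (simp add: sum.If_cases Int_def)
  finally show ?thesis .
qed

text \<open>A weak form of the Kovari--Sos--Turan theorem: a constant number of vertices of linear
  degree already forces a biclique, because the other vertices see only boundedly many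
  different subsets of them.\<close>

lemma high_degree_biclique:
  fixes \<theta> :: real and R :: nat
  assumes "finite U" "Y \<subseteq> U" "symp E" and \<theta>: "\<theta> > 0" "2 * real R \<le> \<theta> * card Y"
    and deg: "\<And>y. y \<in> Y \<Longrightarrow> \<theta> * card U \<le> card {u \<in> U. E y u}"
    and big: "2 ^ card Y * real R + card Y \<le> \<theta> * card U / 2" and R: "R > 0"
  shows "\<exists>P Q. P \<subseteq> U \<and> Q \<subseteq> U \<and> P \<inter> Q = {} \<and> card P = R \<and> card Q = R \<and> (\<forall>x\<in>P. \<forall>y\<in>Q. E x y)"
proof -
  have fY: "finite Y" using assms(1,2) finite_subset by blast
  have Y0: "0 < card Y"
  proof (rule ccontr)
    assume "\<not> ?thesis"
    then show False using \<theta> R by simp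
  qed
  \<comment> \<open>Double counting of the pairs between Y and U: the average over U of the degree
    into Y is at least \<open>\<theta>\<close> card Y, twice the threshold R up to rounding-free
    bounds, so B contains at least \<open>\<theta>\<close> card U / 2 vertices.\<close>
  define B where "B = {u \<in> U. R \<le> card {y \<in> Y. E y u}}"
  have fB: "finite B" "B \<subseteq> U" using assms(1) unfolding B_def by auto
  have "real (card Y) * (\<theta> * card U) \<le> (\<Sum>y\<in>Y. real (card {u \<in> U. E y u}))"
    using sum_mono[of Y "\<lambda>_. \<theta> * card U" "\<lambda>y. real (card {u \<in> U. E y u})"] deg by simp
  also have "\<dots> = (\<Sum>u\<in>U. real (card {y \<in> Y. E y u}))"
    using card_filter_swap[OF fY assms(1), of E] by (simp only: of_nat_sum[symmetric])
  also have "\<dots> \<le> (\<Sum>u\<in>U. (if u \<in> B then real (card Y) else 0) + real R)"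
  proof (rule sum_mono)
    fix u assume u: "u \<in> U"
    have "card {y \<in> Y. E y u} \<le> card Y" using fY by (intro card_mono) auto
    then show "real (card {y \<in> Y. E y u}) \<le> (if u \<in> B then real (card Y) else 0) + real R"
      using u unfolding B_def by auto
  qed
  also have "\<dots> = real (card B) * card Y + card U * real R"
    using assms(1) fB by (simp add: sum.distrib sum.If_cases Int_absorb1)
  finally have 1: "real (card Y) * (\<theta> * card U) \<le> real (card B) * card Y + card U * real R" .
  have "2 * (card U * real R) \<le> card U * (\<theta> * card Y)"
    using \<theta>(2) mult_left_mono[of "2 * real R" "\<theta> * card Y" "real (card U)"] by simp
  then have "real (card Y) * (\<theta> * card U / 2) \<le> real (card Y) * card B"
    using 1 by (simp add: algebra_simps)
  then have cB: "\<theta> * card U / 2 \<le> card B" using Y0 by simp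
  have "card B \<le> card (B - Y) + card Y" using card_mono[of "(B - Y) \<union> Y" B] card_Un_le[of "B - Y" Y] fB fY
    by (auto intro: le_trans)
  then have "2 ^ card Y * real R \<le> card (B - Y)" using cB big by linarith
  then have cBY: "2 ^ card Y * R \<le> card (B - Y)"
    by (metis (mono_tags, lifting) of_nat_le_iff of_nat_mult of_nat_numeral of_nat_power)
  have "\<exists>S\<subseteq>{y \<in> Y. E y u}. card S = R" if "u \<in> B" for u
    using that obtain_subset_with_card_n[of R "{y \<in> Y. E y u}"] unfolding B_def by auto
  then have "\<forall>u\<in>B. \<exists>S. S \<subseteq> {y \<in> Y. E y u} \<and> card S = R" by blast
  from bchoice[OF this] obtain g where g: "\<forall>u\<in>B. g u \<subseteq> {y \<in> Y. E y u} \<and> card (g u) = R" ..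
  \<comment> \<open>Y has at most 2^(card Y) subsets, and more than R times as many vertices are
    available; so R of them share the same R neighbours in Y.\<close>
  have "\<exists>P\<in>Pow Y. R \<le> card {u \<in> B - Y. g u = P}"
    by (rule ex_large_fibre) (use fB fY g cBY in \<open>auto simp: card_Pow\<close>)
  then obtain P where P: "P \<subseteq> Y" "R \<le> card {u \<in> B - Y. g u = P}" by blast
  then obtain Q where Q: "Q \<subseteq> {u \<in> B - Y. g u = P}" "card Q = R" by (meson obtain_subset_with_card_n)
  obtain u where "u \<in> Q" using Q R by fastforce
  then have "card P = R" using Q(1) g by blast
  moreover have "E x y" if "x \<in> P" "y \<in> Q" for x y using that Q(1) g by blast
  ultimately show ?thesis using P(1) Q assms(2) fB(2) by (intro exI[of _ P] exI[of _ Q]) blast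
qed

text \<open>One half of W is paired with P and the other half with Q. Taking R vertices from either
  side of the tile leaves a balanced biclique with sides (L - 1) R, which again splits into tiles of
  side R.\<close>

lemma augment_tile:
  assumes "tiling E (L * R) T" "L > 0" "R > 0" "t \<in> T" "symp E"
    and W: "finite W" "card W = 2 * R" "W \<inter> area t = {}"
    and P: "P \<subseteq> fst t" "card P = R" "Q \<subseteq> snd t" "card Q = R"
    and E: "\<And>u x. u \<in> W \<Longrightarrow> x \<in> P \<union> Q \<Longrightarrow> E u x"
  shows "tileable E R (area t \<union> W)"
proof -
  have R': "L * R > 0" using assms by simp
  note fin = tiling_finite_area[OF assms(1) R' assms(4)]
  note D = tilingD(2-5)[OF assms(1,4)]
  obtain U where U: "U \<subseteq> W" "card U = R" using obtain_subset_with_card_n[of R W] W by auto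
  have fU: "finite U" using U W finite_subset by blast
  have cW: "card (W - U) = R" using U W fU by (simp add: card_Diff_subset)
  have fPQ: "finite P" "finite Q" using P fin finite_subset by blast+
  have rest: "tileable E R ((fst t - P) \<union> (snd t - Q))"
  proof (rule tileable_biclique[where L = "L - 1"])
    show "card (fst t - P) = (L - 1) * R" "card (snd t - Q) = (L - 1) * R"
      using P D fPQ by (simp_all add: card_Diff_subset algebra_simps)
  qed (use D fin in auto)
  have single: "tileable E R (A \<union> B)"
    if "card A = R" "card B = R" "A \<inter> B = {}" "\<And>x y. x \<in> A \<Longrightarrow> y \<in> B \<Longrightarrow> E x y" for A B
    using tileable.tileable_insert[OF tileable.tileable_empty that(1,2,3) _ that(4)] by simp
  have 1: "tileable E R (U \<union> P)" by (rule single) (use U P W E in auto)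
  have 2: "tileable E R ((W - U) \<union> Q)" by (rule single) (use cW P W E in auto)
  have "tileable E R ((U \<union> P) \<union> ((W - U) \<union> Q))"
    by (rule tileable_Un[OF 1 2]) (use U P W D(3) in auto)
  then have "tileable E R (((U \<union> P) \<union> ((W - U) \<union> Q)) \<union> ((fst t - P) \<union> (snd t - Q)))"
    by (rule tileable_Un[OF _ rest]) (use U P W D(3) in auto)
  moreover have "((U \<union> P) \<union> ((W - U) \<union> Q)) \<union> ((fst t - P) \<union> (snd t - Q)) = area t \<union> W"
    using U P by blast
  ultimately show ?thesis by simp
qed

text \<open>If a maximum packing of large bicliques leaves a linear number of vertices uncovered, these
  are sparse among themselves, so on average they see more than half of each biclique. Many bicliques
  are then seen on both sides by vertices with identical neighbourhoods, and splitting such a biclique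
  into smaller ones absorbs them.\<close>

lemma tile_improve:
  fixes \<beta> a :: real and L R :: nat and V :: "'a set"
  assumes \<beta>: "0 < \<beta>" "\<beta> \<le> 1" and L: "16 \<le> \<beta> * real L" and R: "R > 0"
    and V: "finite V" "symp E" "2 * a \<le> real (card V)" "real (card V) \<le> 10 * a"
    and deg: "\<And>x. x \<in> V \<Longrightarrow> a \<le> real (card {y \<in> V. E x y})"
    and X: "X \<subseteq> V" "tileable E (L * R) X" "real (card X) \<le> (2 - \<beta>) * a"
    and max: "\<And>X'. X' \<subseteq> V \<Longrightarrow> tileable E (L * R) X' \<Longrightarrow> card X' \<le> card X"
    and y: "2 * real (L * R) \<le> \<beta> / 80 * real y"
    and a1: "2 ^ y * real (L * R) + real y \<le> \<beta> / 80 * (\<beta> * a) / 2"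
    and a2: "4 ^ (L * R) * (2 * real R) \<le> \<beta> * a / 4 * (\<beta> / 16)"
    and a3: "32 * real L * real R \<le> \<beta> * a"
  shows "\<exists>X'\<subseteq>V. tileable E R X' \<and> real (card X) + \<beta> / (16 * real L) * a \<le> real (card X')"
proof -
  let ?R = "L * R"
  have L0: "L > 0"
  proof (rule ccontr)
    assume "\<not> ?thesis"
    then show False using L by simp
  qed
  then have R0: "?R > 0" and R0': "real ?R > 0" using R by auto
  have a0: "a > 0"
  proof -
    have "0 < \<beta> * a" using a3 L0 R by (smt (verit) mult_pos_pos of_nat_0_less_iff)
    then show ?thesis using \<beta> by (simp add: zero_less_mult_iff)
  qed
  obtain T where T: "tiling E ?R T" "(\<Union>t\<in>T. area t) = X" using tileable_imp_tiling[OF X(2) R0] by blast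
  note TD = tilingD[OF T(1)] and Tf = tiling_finite_area[OF T(1) R0]
  have fX: "finite X" using X V finite_subset by blast
  have cX: "real (card X) = 2 * real ?R * real (card T)" using card_tiling[OF T(1) R0] T(2) by simp
  have pR: "real ?R * real (card T) \<le> (1 - \<beta> / 2) * a" using X(3) cX by (simp add: algebra_simps)
  define U where "U = V - X"
  have fU: "finite U" using V unfolding U_def by simp
  have "card U = card V - card X" using X fX unfolding U_def by (simp add: card_Diff_subset)
  moreover have "card X \<le> card V" using X V by (simp add: card_mono)
  ultimately have cU: "real (card U) = real (card V) - real (card X)" by (simp add: of_nat_diff)
  have U1: "\<beta> * a \<le> real (card U)" using cU V(3) X(3) by (simp add: algebra_simps)
  have U2: "real (card U) \<le> 10 * a" using cU V(4) by simp
  let ?\<theta> = "\<beta> / 80"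
  \<comment> \<open>Vertices of the uncovered set with linear degree inside it. With y of them there
    would be a further biclique of side L R, contradicting the maximality of X.\<close>
  define Hi where "Hi = {u \<in> U. ?\<theta> * real (card U) \<le> real (card {x \<in> U. E u x})}"
  have cHi: "card Hi < y"
  proof (rule ccontr)
    assume "\<not> ?thesis"
    then obtain Y where Y: "Y \<subseteq> Hi" "card Y = y" by (meson obtain_subset_with_card_n not_less)
    have "\<exists>P Q. P \<subseteq> U \<and> Q \<subseteq> U \<and> P \<inter> Q = {} \<and> card P = ?R \<and> card Q = ?R \<and> (\<forall>x\<in>P. \<forall>y\<in>Q. E x y)"
    proof (rule high_degree_biclique[OF fU _ V(2), of Y ?\<theta>])
      show "Y \<subseteq> U" using Y unfolding Hi_def by blast
      show "2 * real ?R \<le> ?\<theta> * real (card Y)" using y Y by simp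
      have "?\<theta> * (\<beta> * a) / 2 \<le> ?\<theta> * real (card U) / 2" using U1 \<beta> by (intro divide_right_mono mult_left_mono) auto
      then show "2 ^ card Y * real ?R + real (card Y) \<le> ?\<theta> * real (card U) / 2" using a1 unfolding Y(2) by linarith
    qed (use \<beta> Y R0 in \<open>auto simp: Hi_def\<close>)
    then obtain P Q where "P \<subseteq> U \<and> Q \<subseteq> U \<and> P \<inter> Q = {} \<and> card P = ?R \<and> card Q = ?R \<and> (\<forall>x\<in>P. \<forall>y\<in>Q. E x y)"
      by (elim exE)
    then have PQ: "P \<subseteq> U" "Q \<subseteq> U" "P \<inter> Q = {}" "card P = ?R" "card Q = ?R" "\<And>x y. x \<in> P \<Longrightarrow> y \<in> Q \<Longrightarrow> E x y"
      by simp_all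
    have "tileable E ?R (P \<union> Q \<union> X)"
      by (rule tileable.tileable_insert[OF X(2) PQ(4,5,3)]) (use PQ in \<open>auto simp: U_def\<close>)
    moreover have "P \<union> Q \<union> X \<subseteq> V" using PQ X unfolding U_def by blast
    ultimately have "card (P \<union> Q \<union> X) \<le> card X" by (intro max)
    moreover have "card (P \<union> X) \<le> card (P \<union> Q \<union> X)" using fU fX PQ finite_subset[of _ U] by (intro card_mono) auto
    moreover have "card (P \<union> X) = card P + card X"
      using fU fX PQ finite_subset[of _ U] by (intro card_Un_disjoint) (auto simp: U_def)
    ultimately show False using PQ(4) R0 by linarith
  qed
  define U0 where "U0 = U - Hi"
  have fU0: "finite U0" using fU unfolding U0_def by simp
  have cU0: "\<beta> * a / 2 \<le> real (card U0)"
  proof -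
    have "card U0 = card U - card Hi" using fU unfolding U0_def by (intro card_Diff_subset) (auto simp: Hi_def)
    then have "real (card U) - real y \<le> real (card U0)" using cHi by linarith
    moreover have "real y \<le> \<beta> * a / 2"
    proof -
      have "0 \<le> 2 ^ y * real ?R" by simp
      then have "real y \<le> \<beta> / 80 * (\<beta> * a) / 2" using a1 by linarith
      also have "\<dots> \<le> 1 * (\<beta> * a) / 2" using \<beta> a0 by (intro divide_right_mono mult_right_mono) auto
      finally show ?thesis by simp
    qed
    ultimately show ?thesis using U1 by linarith
  qed
  have U0X: "U0 \<inter> X = {}" "U0 \<subseteq> V" unfolding U0_def U_def by auto
  define N where "N = (\<lambda>u t. card {x \<in> area t. E u x})"
  define good where "good = (\<lambda>u t. real ?R * (1 + \<beta> / 16) \<le> real (N u t))"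
  have Nle: "N u t \<le> 2 * ?R" if "t \<in> T" for u t
    using card_mono[OF Tf(3)[OF that], of "{x \<in> area t. E u x}"] Tf(4)[OF that] unfolding N_def by auto
  \<comment> \<open>All but \<open>\<beta>\<close> a / 8 of the degree of u goes into tiles. If it
    were spread with at most L R (1 + \<open>\<beta>\<close> / 16) per tile, it would amount to at
    most (1 - \<open>\<beta>\<close> / 2 + \<open>\<beta>\<close> / 16) a, since L R card T is at
    most (1 - \<open>\<beta>\<close> / 2) a. The deficit has to come from good tiles, each of which
    contributes at most L R beyond that.\<close>
  have many: "\<beta> * a / 8 \<le> real ?R * real (card {t \<in> T. good u t})" if u: "u \<in> U0" for u
  proof -
    have uV: "u \<in> V" "u \<in> U" "u \<notin> Hi" using u unfolding U0_def U_def by auto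
    have "{x \<in> V. E u x} = {x \<in> U. E u x} \<union> (\<Union>t\<in>T. {x \<in> area t. E u x})" using T(2) X(1) unfolding U_def by blast
    then have "card {x \<in> V. E u x} \<le> card {x \<in> U. E u x} + card (\<Union>t\<in>T. {x \<in> area t. E u x})"
      using card_Un_le[of "{x \<in> U. E u x}" "\<Union>t\<in>T. {x \<in> area t. E u x}"] by (simp only:)
    also have "\<dots> \<le> card {x \<in> U. E u x} + (\<Sum>t\<in>T. N u t)" unfolding N_def using card_UN_le[OF TD(1)] by simp
    finally have "real (card {x \<in> V. E u x}) \<le> real (card {x \<in> U. E u x}) + (\<Sum>t\<in>T. real (N u t))"
      by (metis (mono_tags) of_nat_add of_nat_le_iff of_nat_sum)
    moreover have "real (card {x \<in> U. E u x}) < ?\<theta> * real (card U)" using uV unfolding Hi_def by auto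
    moreover have "?\<theta> * real (card U) \<le> ?\<theta> * (10 * a)" using U2 \<beta> by (intro mult_left_mono) auto
    ultimately have "a - \<beta> * a / 8 \<le> (\<Sum>t\<in>T. real (N u t))" using deg[OF uV(1)] by simp
    also have "\<dots> \<le> (\<Sum>t\<in>T. real ?R * (1 + \<beta> / 16) + (if good u t then real ?R else 0))"
    proof (rule sum_mono)
      fix t assume t: "t \<in> T"
      show "real (N u t) \<le> real ?R * (1 + \<beta> / 16) + (if good u t then real ?R else 0)"
      proof (cases "good u t")
        case True
        have "real (N u t) \<le> 2 * real ?R" using Nle[OF t, of u] by (metis of_nat_le_iff of_nat_mult of_nat_numeral)
        moreover have "real ?R \<le> real ?R * (1 + \<beta> / 16)" using \<beta> R0' by (simp add: algebra_simps)
        ultimately show ?thesis using True by simp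
      qed (auto simp: good_def)
    qed
    also have "\<dots> = (real ?R * real (card T)) * (1 + \<beta> / 16) + real ?R * real (card {t \<in> T. good u t})"
      using TD(1) by (simp add: sum.distrib sum.If_cases Int_def algebra_simps)
    also have "\<dots> \<le> ((1 - \<beta> / 2) * a) * (1 + \<beta> / 16) + real ?R * real (card {t \<in> T. good u t})"
      using pR \<beta> by (intro add_right_mono mult_right_mono) auto
    also have "((1 - \<beta> / 2) * a) * (1 + \<beta> / 16) \<le> (1 - \<beta> / 2 + \<beta> / 16) * a"
    proof -
      have "(1 - \<beta> / 2) * (1 + \<beta> / 16) \<le> 1 - \<beta> / 2 + \<beta> / 16" using \<beta> by (simp add: algebra_simps)
      then show ?thesis using mult_right_mono[of "(1 - \<beta> / 2) * (1 + \<beta> / 16)" _ a] a0 by (simp add: mult_ac)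
    qed
    finally have "a - \<beta> * a / 8 \<le> (1 - \<beta> / 2 + \<beta> / 16) * a + real ?R * real (card {t \<in> T. good u t})" by simp
    moreover have "a - \<beta> * a / 8 - (1 - \<beta> / 2 + \<beta> / 16) * a = 5 / 16 * (\<beta> * a)" by (simp add: algebra_simps)
    moreover have "\<beta> * a > 0" using \<beta> a0 by simp
    ultimately show ?thesis by linarith
  qed
  \<comment> \<open>The number of tiles to be augmented. While g L R is at most
    \<open>\<beta>\<close> a / 16, the tiles already used account for at most half of the good tiles
    of any vertex, and \<open>\<beta>\<close> a / 4 low-degree vertices stay uncovered.\<close>
  define g where "g = nat \<lfloor>\<beta> * a / (16 * real ?R)\<rfloor>"
  have g: "real g \<le> \<beta> * a / (16 * real ?R)" "\<beta> * a / (16 * real ?R) - 1 < real g"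
  proof -
    have "0 \<le> \<beta> * a / (16 * real ?R)" using \<beta> a0 by simp
    then have "real g = of_int \<lfloor>\<beta> * a / (16 * real ?R)\<rfloor>" unfolding g_def by simp
    then show "real g \<le> \<beta> * a / (16 * real ?R)" "\<beta> * a / (16 * real ?R) - 1 < real g"
      using floor_correct[of "\<beta> * a / (16 * real ?R)"] by linarith+
  qed
  have "\<exists>J W. J \<subseteq> T \<and> W \<subseteq> U0 \<and> card J = j \<and> card W = 2 * R * j \<and> tileable E R (W \<union> (\<Union>t\<in>J. area t))"
    if "j \<le> g" for j
    using that
  proof (induction j)
    case 0
    then show ?case by (intro exI[of _ "{}"]) (auto simp: tileable.tileable_empty)
  next
    case (Suc j)
    then obtain J W where J: "J \<subseteq> T" "W \<subseteq> U0" "card J = j" "card W = 2 * R * j" "tileable E R (W \<union> (\<Union>t\<in>J. area t))"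
      by auto
    have fJ: "finite J" "finite W" using J TD(1) fU0 finite_subset by blast+
    have jR: "real ?R * real j \<le> \<beta> * a / 16"
    proof -
      have "real j \<le> \<beta> * a / (16 * real ?R)" using g Suc.prems by linarith
      then show ?thesis using R0' by (simp add: field_simps)
    qed
    define U' where "U' = U0 - W"
    have fU': "finite U'" using fU0 unfolding U'_def by simp
    have cU': "\<beta> * a / 4 \<le> real (card U')"
    proof -
      have "card U' = card U0 - card W" using fJ J unfolding U'_def by (intro card_Diff_subset) auto
      then have "real (card U0) - real (card W) \<le> real (card U')" by linarith
      moreover have "real (card W) = 2 * (real R * real j)" using J(4) by simp
      moreover have "real R * real j \<le> real ?R * real j" 
      proof (rule mult_right_mono)
        have "R \<le> L * R" using L0 by simp
        then show "real R \<le> real ?R" by (simp only: of_nat_le_iff)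
      qed simp
      ultimately have "real (card U0) - 2 * (\<beta> * a / 16) \<le> real (card U')" using jR by linarith
      then show ?thesis using cU0 by linarith
    qed
    have U'0: "0 < real (card U')"
    proof -
      have "0 < \<beta> * a / 4" using \<beta> a0 by simp
      then show ?thesis using cU' by linarith
    qed
    have "\<exists>t\<in>T - J. real (card U') * (\<beta> / 16) \<le> real (card {u \<in> U'. good u t})"
    proof (rule ccontr)
      assume n: "\<not> ?thesis"
      have "real (card U') * (\<beta> * a / 16) \<le> (\<Sum>u\<in>U'. real ?R * real (card {t \<in> T - J. good u t}))"
      proof -
        have "\<beta> * a / 16 \<le> real ?R * real (card {t \<in> T - J. good u t})" if "u \<in> U'" for u
        proof -
          have "{t \<in> T. good u t} \<subseteq> {t \<in> T - J. good u t} \<union> J" by blast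
          then have "card {t \<in> T. good u t} \<le> card ({t \<in> T - J. good u t} \<union> J)" using TD(1) fJ by (intro card_mono) auto
          also have "\<dots> \<le> card {t \<in> T - J. good u t} + j" using card_Un_le[of "{t \<in> T - J. good u t}" J] unfolding J(3) .
          finally have "real ?R * real (card {t \<in> T. good u t}) \<le> real ?R * (real (card {t \<in> T - J. good u t}) + real j)"
            using R0' by (intro mult_left_mono) auto
          then show ?thesis using many[of u] that jR unfolding U'_def by (simp add: algebra_simps)
        qed
        then show ?thesis using sum_mono[of U' "\<lambda>_. \<beta> * a / 16"] by simp
      qed
      also have "\<dots> = real ?R * (\<Sum>t\<in>T - J. real (card {u \<in> U'. good u t}))"
        using card_filter_swap[OF fU', of "T - J" good] TD(1) by (simp only: sum_distrib_left[symmetric] of_nat_sum[symmetric] finite_Diff)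
      also have "\<dots> \<le> real ?R * (\<Sum>t\<in>T - J. real (card U') * (\<beta> / 16))"
        using n R0' by (intro mult_left_mono sum_mono) force+
      also have "\<dots> = real ?R * real (card (T - J)) * (real (card U') * (\<beta> / 16))" by simp
      also have "\<dots> \<le> real ?R * real (card T) * (real (card U') * (\<beta> / 16))"
        using TD(1) \<beta> by (intro mult_right_mono mult_left_mono) (auto intro: card_mono)
      also have "\<dots> \<le> (1 - \<beta> / 2) * a * (real (card U') * (\<beta> / 16))" using pR \<beta> by (intro mult_right_mono) auto
      also have "\<dots> < 1 * a * (real (card U') * (\<beta> / 16))"
        using \<beta> a0 U'0 by (intro mult_strict_right_mono mult_pos_pos) auto
      finally show False by (simp add: algebra_simps)
    qed
    then obtain t where t: "t \<in> T - J" "real (card U') * (\<beta> / 16) \<le> real (card {u \<in> U'. good u t})" by blast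
    define B where "B = {u \<in> U'. good u t}"
    have fB: "finite B" using fU' unfolding B_def by simp
    have tT: "t \<in> T" using t by blast
    \<comment> \<open>A good vertex sees at least L R (1 + \<open>\<beta>\<close> / 16) vertices of
      the tile and at most L R on one side, hence at least L R \<open>\<beta>\<close> / 16 on the
      other; this is at least R because \<open>\<beta>\<close> L is at least 16.\<close>
    have half: "R \<le> card {x \<in> fst t. E u x} \<and> R \<le> card {x \<in> snd t. E u x}" if "u \<in> B" for u
    proof -
      have "{x \<in> area t. E u x} = {x \<in> fst t. E u x} \<union> {x \<in> snd t. E u x}" by blast
      then have Nu: "N u t \<le> card {x \<in> fst t. E u x} + card {x \<in> snd t. E u x}"
        using card_Un_le[of "{x \<in> fst t. E u x}" "{x \<in> snd t. E u x}"] unfolding N_def by (simp only:)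
      have "real (N u t) \<le> real (card {x \<in> fst t. E u x}) + real (card {x \<in> snd t. E u x})"
        using of_nat_mono[OF Nu, where ?'a = real] by simp
      moreover have "real ?R * (1 + \<beta> / 16) \<le> real (N u t)" using that unfolding B_def good_def by simp
      moreover have "real (card {x \<in> fst t. E u x}) \<le> real ?R" "real (card {x \<in> snd t. E u x}) \<le> real ?R"
        unfolding of_nat_le_iff using card_mono[OF Tf(1)[OF tT], of "{x \<in> fst t. E u x}"] card_mono[OF Tf(2)[OF tT], of "{x \<in> snd t. E u x}"]
          TD(2,3)[OF tT] by auto
      ultimately have "real ?R * (\<beta> / 16) \<le> real (card {x \<in> fst t. E u x})" "real ?R * (\<beta> / 16) \<le> real (card {x \<in> snd t. E u x})"
        unfolding distrib_left by linarith+
      moreover have "real R \<le> real ?R * (\<beta> / 16)"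
        using mult_right_mono[OF L, of "real R"] by (simp add: algebra_simps)
      ultimately have "real R \<le> real (card {x \<in> fst t. E u x})" "real R \<le> real (card {x \<in> snd t. E u x})" by linarith+
      then show ?thesis by simp
    qed
    have "\<forall>u\<in>B. \<exists>S. fst S \<subseteq> {x \<in> fst t. E u x} \<and> card (fst S) = R \<and> snd S \<subseteq> {x \<in> snd t. E u x} \<and> card (snd S) = R"
    proof
      fix u assume "u \<in> B"
      then have h: "R \<le> card {x \<in> fst t. E u x}" "R \<le> card {x \<in> snd t. E u x}" using half by auto
      obtain S1 where "S1 \<subseteq> {x \<in> fst t. E u x}" "card S1 = R" by (rule obtain_subset_with_card_n[OF h(1)])
      moreover obtain S2 where "S2 \<subseteq> {x \<in> snd t. E u x}" "card S2 = R" by (rule obtain_subset_with_card_n[OF h(2)])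
      ultimately show "\<exists>S. fst S \<subseteq> {x \<in> fst t. E u x} \<and> card (fst S) = R \<and> snd S \<subseteq> {x \<in> snd t. E u x} \<and> card (snd S) = R"
        by (intro exI[of _ "(S1, S2)"]) simp
    qed
    from bchoice[OF this] obtain f where
      f: "\<forall>u\<in>B. fst (f u) \<subseteq> {x \<in> fst t. E u x} \<and> card (fst (f u)) = R \<and> snd (f u) \<subseteq> {x \<in> snd t. E u x} \<and> card (snd (f u)) = R" ..
    \<comment> \<open>There are 4^(L R) pairs of subsets of the two sides, so 2 R vertices agree on
      their chosen neighbours. They form the set to be absorbed.\<close>
    have "\<exists>S\<in>Pow (fst t) \<times> Pow (snd t). 2 * R \<le> card {u \<in> B. f u = S}"
    proof (rule ex_large_fibre[OF fB])
      show "f ` B \<subseteq> Pow (fst t) \<times> Pow (snd t)"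
      proof
        fix S assume "S \<in> f ` B"
        then obtain u where "u \<in> B" "S = f u" by blast
        then show "S \<in> Pow (fst t) \<times> Pow (snd t)" using bspec[OF f, of u] unfolding mem_Times_iff by blast
      qed
      have "card (Pow (fst t) \<times> Pow (snd t)) = 2 ^ ?R * 2 ^ ?R"
        using Tf(1,2)[OF tT] TD(2,3)[OF tT] by (simp add: card_cartesian_product card_Pow)
      then have c: "card (Pow (fst t) \<times> Pow (snd t)) = 4 ^ ?R" by (simp add: power_mult_distrib[symmetric])
      have "4 ^ ?R * (2 * real R) \<le> real (card U') * (\<beta> / 16)"
        using a2 mult_right_mono[OF cU', of "\<beta> / 16"] \<beta> by linarith
      then have "real (4 ^ ?R * (2 * R)) \<le> real (card B)" using t(2) unfolding B_def by simp
      then show "card (Pow (fst t) \<times> Pow (snd t)) * (2 * R) \<le> card B" unfolding c by (simp only: of_nat_le_iff)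
    qed (use Tf[OF tT] in auto)
    then obtain P Q where PQ: "2 * R \<le> card {u \<in> B. f u = (P, Q)}" by auto
    then obtain W' where W': "W' \<subseteq> {u \<in> B. f u = (P, Q)}" "card W' = 2 * R" "finite W'"
      using obtain_subset_with_card_n[OF PQ] by blast
    obtain u0 where "u0 \<in> W'" using W' R by fastforce
    then have PQ2: "P \<subseteq> fst t" "card P = R" "Q \<subseteq> snd t" "card Q = R" using f W'(1) by fastforce+
    have W'U: "W' \<subseteq> U0" "W' \<inter> W = {}" using W'(1) unfolding B_def U'_def by auto
    have areaX: "area u \<subseteq> X" if "u \<in> T" for u using T(2) that by blast
    have "tileable E R (area t \<union> W')"
    proof (rule augment_tile[OF T(1) L0 R tT V(2) W'(3,2) _ PQ2])
      show "W' \<inter> area t = {}" using W'U U0X(1) areaX[OF tT] by blast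
      fix u x assume "u \<in> W'" "x \<in> P \<union> Q"
      then show "E u x" using f W'(1) by fastforce
    qed
    moreover have "(area t \<union> W') \<inter> (W \<union> (\<Union>t\<in>J. area t)) = {}"
    proof -
      have "area t \<inter> area t' = {}" if "t' \<in> J" for t' using TD(6)[of t t'] that t J(1) by blast
      moreover have "area t \<inter> W = {}" using areaX[OF tT] J(2) U0X(1) by blast
      moreover have "W' \<inter> area t' = {}" if "t' \<in> J" for t' using areaX[of t'] J(1) that W'U U0X(1) by blast
      ultimately show ?thesis using W'U by blast
    qed
    ultimately have "tileable E R ((area t \<union> W') \<union> (W \<union> (\<Union>t\<in>J. area t)))"
      by (intro tileable_Un[OF _ J(5)])
    moreover have "(area t \<union> W') \<union> (W \<union> (\<Union>t\<in>J. area t)) = (W \<union> W') \<union> (\<Union>t\<in>insert t J. area t)" by blast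
    moreover have "card (W \<union> W') = 2 * R * Suc j"
      using card_Un_disjoint[OF fJ(2) W'(3)] W'U W'(2) J(4) by (simp add: Int_commute)
    moreover have "card (insert t J) = Suc j" using t fJ J(3) by simp
    ultimately show ?case using J W'U tT by (intro exI[of _ "insert t J"] exI[of _ "W \<union> W'"]) auto
  qed
  from this[of g] obtain J W where J: "J \<subseteq> T" "W \<subseteq> U0" "card J = g" "card W = 2 * R * g" "tileable E R (W \<union> (\<Union>t\<in>J. area t))"
    by auto
  have "tileable E R (\<Union>t\<in>T - J. area t)"
    by (rule tileable_UN) (use TD tiling_tileable_mult[OF T(1) R0] in auto)
  moreover have "(W \<union> (\<Union>t\<in>J. area t)) \<inter> (\<Union>t\<in>T - J. area t) = {}"
  proof -
    have "area t \<inter> area t' = {}" if "t \<in> J" "t' \<in> T - J" for t t' using TD(6)[of t t'] that J(1) by blast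
    moreover have "W \<inter> area t = {}" if "t \<in> T" for t using that T(2) J(2) U0X(1) by blast
    ultimately show ?thesis by blast
  qed
  ultimately have "tileable E R ((W \<union> (\<Union>t\<in>J. area t)) \<union> (\<Union>t\<in>T - J. area t))"
    by (intro tileable_Un[OF J(5)])
  moreover have "(W \<union> (\<Union>t\<in>J. area t)) \<union> (\<Union>t\<in>T - J. area t) = W \<union> X" using T(2) J(1) by blast
  ultimately have tile: "tileable E R (W \<union> X)" by simp
  have "finite W" using J(2) fU0 finite_subset by blast
  then have "card (W \<union> X) = 2 * R * g + card X" using fX J(2,4) U0X(1) by (subst card_Un_disjoint) auto
  then have "real (card (W \<union> X)) = 2 * real R * real g + real (card X)" by simp
  moreover have "\<beta> / (16 * real L) * a \<le> 2 * real R * real g"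
  proof -
    have "2 * real R * (\<beta> * a / (16 * real ?R) - 1) \<le> 2 * real R * real g" using g by (intro mult_left_mono) auto
    moreover have "2 * real R * (\<beta> * a / (16 * real ?R) - 1) = 2 * (\<beta> / (16 * real L) * a) - 2 * real R"
      using R L0 by (simp add: field_simps)
    moreover have "2 * real R \<le> \<beta> / (16 * real L) * a" using a3 L0 by (simp add: field_simps)
    ultimately show ?thesis by linarith
  qed
  ultimately show ?thesis using tile J(2) U0X(2) X(1) by (intro exI[of _ "W \<union> X"]) auto
qed

text \<open>\<open>tile_improve\<close> gains a fixed amount \<open>\<kappa>\<close> a at the price
  of dividing the tile side by L. So coverage by i + 1 gains at side R follows from coverage by i
  gains at side L R, which explains the induction on i with R arbitrary. A bounded number of rounds
  reaches 2 - \<open>\<beta>\<close>.\<close>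

theorem tile_cover:
  fixes \<beta> :: real and R :: nat
  assumes "0 < \<beta>" "\<beta> \<le> 1" "R > 0"
  shows "\<exists>a0. \<forall>a\<ge>a0. \<forall>(V :: 'a set) E. finite V \<longrightarrow> symp E \<longrightarrow> 2 * a \<le> real (card V) \<longrightarrow>
    real (card V) \<le> 10 * a \<longrightarrow> (\<forall>x\<in>V. a \<le> real (card {y \<in> V. E x y})) \<longrightarrow>
    (\<exists>X\<subseteq>V. tileable E R X \<and> (2 - \<beta>) * a \<le> real (card X))"
proof -
  define L where "L = nat \<lceil>16 / \<beta>\<rceil>"
  have "16 / \<beta> \<le> real L" unfolding L_def by linarith
  then have L: "16 \<le> \<beta> * real L" using assms by (simp add: field_simps)
  then have L0: "L > 0" by (cases L) auto
  define \<kappa> where "\<kappa> = \<beta> / (16 * real L)"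
  have \<kappa>0: "\<kappa> > 0" using assms L0 unfolding \<kappa>_def by simp
  define cover where "cover = (\<lambda>(R :: nat) (c :: real) (a :: real). \<forall>(V :: 'a set) E. finite V \<longrightarrow> symp E \<longrightarrow>
    2 * a \<le> real (card V) \<longrightarrow> real (card V) \<le> 10 * a \<longrightarrow> (\<forall>x\<in>V. a \<le> real (card {y \<in> V. E x y})) \<longrightarrow>
    (\<exists>X\<subseteq>V. tileable E R X \<and> c * a \<le> real (card X)))"
  have "\<exists>a0. \<forall>a\<ge>a0. cover R (min (2 - \<beta>) (real i * \<kappa>)) a" if "R > 0" for i R
    using that
  proof (induction i arbitrary: R)
    case 0
    have "cover R 0 a" for a unfolding cover_def using tileable.tileable_empty by fastforce
    then show ?case using assms by simp
  next
    case (Suc i)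
    have LR: "L * R > 0" using L0 Suc.prems by simp
    from Suc.IH[OF LR] obtain a0 where a0: "\<And>a. a0 \<le> a \<Longrightarrow> cover (L * R) (min (2 - \<beta>) (real i * \<kappa>)) a" by blast
    define y where "y = nat \<lceil>160 * real (L * R) / \<beta>\<rceil>"
    have "160 * real (L * R) / \<beta> \<le> real y" unfolding y_def by linarith
    then have y: "2 * real (L * R) \<le> \<beta> / 80 * real y" using assms by (simp add: field_simps)
    define a1 where "a1 = (2 ^ y * real (L * R) + real y) * 160 / \<beta>\<^sup>2"
    define a2 where "a2 = 4 ^ (L * R) * (2 * real R) * 64 / \<beta>\<^sup>2"
    define a3 where "a3 = 32 * real L * real R / \<beta>"
    show ?case
    proof (intro exI[of _ "max (max a0 1) (max a1 (max a2 a3))"] allI impI)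
      fix a assume "max (max a0 1) (max a1 (max a2 a3)) \<le> a"
      then have a: "a0 \<le> a" "a1 \<le> a" "a2 \<le> a" "a3 \<le> a" "0 < a" by auto
      have b1: "2 ^ y * real (L * R) + real y \<le> \<beta> / 80 * (\<beta> * a) / 2"
        using a(2) assms unfolding a1_def by (simp add: field_simps power2_eq_square)
      have b2: "4 ^ (L * R) * (2 * real R) \<le> \<beta> * a / 4 * (\<beta> / 16)"
        using a(3) assms unfolding a2_def by (simp add: field_simps power2_eq_square)
      have b3: "32 * real L * real R \<le> \<beta> * a"
        using a(4) assms unfolding a3_def by (simp add: field_simps)
      show "cover R (min (2 - \<beta>) (real (Suc i) * \<kappa>)) a"
        unfolding cover_def
      proof (intro allI impI)
        fix V :: "'a set" and E
        assume V: "finite V" "symp E" "2 * a \<le> real (card V)" "real (card V) \<le> 10 * a"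
          and deg: "\<forall>x\<in>V. a \<le> real (card {y \<in> V. E x y})"
        let ?P = "\<lambda>X. X \<subseteq> V \<and> tileable E (L * R) X"
        have "\<exists>X\<subseteq>V. tileable E (L * R) X \<and> min (2 - \<beta>) (real i * \<kappa>) * a \<le> real (card X)"
          using a0[OF a(1), unfolded cover_def, THEN spec, THEN spec, THEN mp, OF V(1), THEN mp, OF V(2),
            THEN mp, OF V(3), THEN mp, OF V(4), THEN mp, OF deg] .
        then obtain X0 where X0: "?P X0" "min (2 - \<beta>) (real i * \<kappa>) * a \<le> real (card X0)" by blast
        have "\<forall>X. ?P X \<longrightarrow> card X < Suc (card V)" using card_mono[OF V(1)] by (auto simp: less_Suc_eq_le)
        from ex_has_greatest_nat[of ?P, OF X0(1) this]
        obtain X where X: "?P X" and max: "\<And>X'. ?P X' \<Longrightarrow> card X' \<le> card X" by blast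
        have cX: "min (2 - \<beta>) (real i * \<kappa>) * a \<le> real (card X)" using X0 max[of X0] by linarith
        show "\<exists>X\<subseteq>V. tileable E R X \<and> min (2 - \<beta>) (real (Suc i) * \<kappa>) * a \<le> real (card X)"
        proof (cases "real (card X) \<le> (2 - \<beta>) * a")
          case True
          have dV: "\<And>x. x \<in> V \<Longrightarrow> a \<le> real (card {y \<in> V. E x y})" using deg by blast
          have "\<exists>X'\<subseteq>V. tileable E R X' \<and> real (card X) + \<beta> / (16 * real L) * a \<le> real (card X')"
            using tile_improve[OF assms(1,2) L Suc.prems V dV _ _ True _ y b1 b2 b3] X max by blast
          then obtain X' where X': "X' \<subseteq> V" "tileable E R X'" "real (card X) + \<kappa> * a \<le> real (card X')"
            unfolding \<kappa>_def by blast
          have "min (2 - \<beta>) (real (Suc i) * \<kappa>) * a \<le> (min (2 - \<beta>) (real i * \<kappa>) + \<kappa>) * a"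
            using a(5) \<kappa>0 by (intro mult_right_mono) (auto simp: algebra_simps)
          then have "min (2 - \<beta>) (real (Suc i) * \<kappa>) * a \<le> real (card X')" using cX X'(3) by (simp add: algebra_simps)
          then show ?thesis using X' by blast
        next
          case False
          \<comment> \<open>The maximum packing with large tiles already covers enough; its tiles
            are cut into tiles of side R.\<close>
          obtain T where T: "tiling E (L * R) T" "(\<Union>t\<in>T. area t) = X" using tileable_imp_tiling[OF _ LR] X by blast
          have "tileable E R (\<Union>t\<in>T. area t)"
            by (rule tileable_UN) (use tilingD[OF T(1)] tiling_tileable_mult[OF T(1) LR] in auto)
          moreover have "min (2 - \<beta>) (real (Suc i) * \<kappa>) * a \<le> (2 - \<beta>) * a" using a(5) by (intro mult_right_mono) auto
          ultimately show ?thesis using X False T(2) by (intro exI[of _ X]) auto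
        qed
      qed
    qed
  qed
  moreover have "\<exists>i. min (2 - \<beta>) (real i * \<kappa>) = 2 - \<beta>"
  proof -
    obtain i :: nat where "2 / \<kappa> \<le> real i" using real_arch_simple by blast
    then have "2 \<le> real i * \<kappa>" using \<kappa>0 by (simp add: field_simps)
    then have "min (2 - \<beta>) (real i * \<kappa>) = 2 - \<beta>" using assms by linarith
    then show ?thesis by blast
  qed
  ultimately have "\<exists>a0. \<forall>a\<ge>a0. cover R (2 - \<beta>) a" using assms(3) by metis
  then show ?thesis unfolding cover_def .
qed

section \<open>Separators in graphs without a clique minor\<close>

lemma clique_minor_mono:
  assumes "clique_minor E V h" "V \<subseteq> W"
  shows "clique_minor E W h"
proof -
  let ?Q = "\<lambda>\<A>. \<forall>A\<in>\<A>. \<forall>B\<in>\<A>. A \<noteq> B \<longrightarrow> A \<inter> B = {} \<and> (\<exists>a\<in>A. \<exists>b\<in>B. E a b)"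
  obtain \<A> where A: "finite \<A>" "card \<A> = h" "\<forall>A\<in>\<A>. A \<subseteq> V \<and> A \<noteq> {} \<and> conn E A" "?Q \<A>"
    using assms(1) unfolding clique_minor_def by (elim exE conjE)
  have "\<forall>A\<in>\<A>. A \<subseteq> W \<and> A \<noteq> {} \<and> conn E A" using A(3) assms(2) by (simp add: subset_trans[OF _ assms(2)])
  then show ?thesis unfolding clique_minor_def using A(1,2,4) by (intro exI[of _ \<A>] conjI)
qed

text \<open>Until it fills half of V, a ball grows by the factor 1 + 1 / l in each step. By
  Bernoulli's inequality l steps double it, so l j steps would give 2^j > card V vertices. Two balls
  larger than half intersect, and two connecting sets of at most l j + 1 vertices are
  united.\<close>

lemma expanding_diam_le:
  fixes l j :: nat
  assumes V: "finite V" "symp E" and l: "l > 0" and j: "card V < 2 ^ j"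
    and exp: "\<And>S. S \<subseteq> V \<Longrightarrow> S \<noteq> {} \<Longrightarrow> 2 * card S \<le> card V \<Longrightarrow> card S < l * card {z \<in> V - S. \<exists>y\<in>S. E y z}"
  shows "diam_le E V (2 * (l * j) + 2)"
proof -
  have half: "card V < 2 * card (nball E V x (l * j))" if x: "x \<in> V" for x
  proof -
    let ?B = "nball E V x" and ?q = "1 + 1 / real l"
    have sub: "?B i \<subseteq> V" for i using nball_subset[OF x] .
    have fB: "finite (?B i)" for i using sub V(1) finite_subset by blast
    have "card V < 2 * card (?B i) \<or> ?q ^ i \<le> real (card (?B i))" for i
    proof (induction i)
      case (Suc i)
      have up: "card (?B i) \<le> card (?B (Suc i))" by (rule card_mono[OF fB]) auto
      show ?case
      proof (cases "card V < 2 * card (?B i)")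
        case True
        then show ?thesis using up by linarith
      next
        case False
        let ?N = "{z \<in> V - ?B i. \<exists>y\<in>?B i. E y z}"
        have "card (?B i) < l * card ?N" using exp[OF sub] nball_centre[of x E V i] False by fastforce
        then have "real (card (?B i)) < real (l * card ?N)" by (simp only: of_nat_less_iff)
        then have "real (card (?B i)) / real l \<le> real (card ?N)" using l by (simp add: pos_divide_le_eq mult.commute)
        moreover have "card (?B i \<union> ?N) = card (?B i) + card ?N" using fB V(1) by (intro card_Un_disjoint) auto
        moreover have "?B (Suc i) = ?B i \<union> ?N" by auto
        ultimately have "?q * real (card (?B i)) \<le> real (card (?B (Suc i)))" by (simp add: algebra_simps)
        moreover have "?q * ?q ^ i \<le> ?q * real (card (?B i))" using Suc False by (intro mult_left_mono) auto
        ultimately show ?thesis by simp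
      qed
    qed simp
    then have "card V < 2 * card (?B (l * j)) \<or> ?q ^ (l * j) \<le> real (card (?B (l * j)))" .
    moreover have "\<not> ?q ^ (l * j) \<le> real (card (?B (l * j)))"
    proof
      assume a: "?q ^ (l * j) \<le> real (card (?B (l * j)))"
      have "-1 \<le> 1 / real l" by (rule order_trans[of _ 0]) simp_all
      then have "2 \<le> ?q ^ l" using Bernoulli_inequality[of "1 / real l" l] l by simp
      then have "2 ^ j \<le> ?q ^ (l * j)" unfolding power_mult by (rule power_mono) simp
      moreover have "card (?B (l * j)) \<le> card V" using card_mono[OF V(1) sub] .
      ultimately have "2 ^ j \<le> real (card V)" using a by linarith
      then show False using j by (metis not_less of_nat_le_iff of_nat_numeral of_nat_power)
    qed
    ultimately show ?thesis by blast
  qed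
  show ?thesis
    unfolding diam_le_def
  proof (intro ballI)
    fix x y assume xy: "x \<in> V" "y \<in> V"
    let ?A = "nball E V x (l * j)" and ?B = "nball E V y (l * j)"
    have sub: "?A \<subseteq> V" "?B \<subseteq> V" using nball_subset xy by metis+
    have "?A \<inter> ?B \<noteq> {}"
    proof
      assume "?A \<inter> ?B = {}"
      then have "card (?A \<union> ?B) = card ?A + card ?B" using sub V(1) finite_subset by (intro card_Un_disjoint) auto
      moreover have "card (?A \<union> ?B) \<le> card V" using sub V(1) by (intro card_mono) auto
      ultimately show False using half[OF xy(1)] half[OF xy(2)] by linarith
    qed
    then obtain z where z: "z \<in> ?A" "z \<in> ?B" by blast
    obtain P where P: "P \<subseteq> V" "finite P" "conn E P" "x \<in> P" "z \<in> P" "card P \<le> Suc (l * j)"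
      using nball_conn[OF V(2) xy(1) z(1)] by blast
    obtain Q where Q: "Q \<subseteq> V" "finite Q" "conn E Q" "y \<in> Q" "z \<in> Q" "card Q \<le> Suc (l * j)"
      using nball_conn[OF V(2) xy(2) z(2)] by blast
    have "conn E (P \<union> Q)" using P Q by (intro conn_Un) auto
    moreover have "card (P \<union> Q) \<le> 2 * (l * j) + 2" using card_Un_le[of P Q] P(6) Q(6) by linarith
    ultimately show "\<exists>P\<subseteq>V. finite P \<and> conn E P \<and> x \<in> P \<and> y \<in> P \<and> card P \<le> 2 * (l * j) + 2"
      using P Q by (intro exI[of _ "P \<union> Q"]) auto
  qed
qed

text \<open>The argument of Plotkin, Rao and Smith. In a minimal state, \<open>\<A>\<close> is a clique minor with small
  branch sets and \<open>W\<close> the part not yet processed. A branch set without neighbours in \<open>W\<close> can be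
  discarded. Otherwise either \<open>W\<close> has a sparse cut, or it has small diameter and then
  contains a further small branch set.\<close>

lemma clique_minor_free_separator_param:
  fixes l j h :: nat
  assumes V: "finite V" "symp E" and h: "\<not> clique_minor E V h" and l: "l > 0" and j: "card V < 2 ^ j"
  shows "\<exists>X A B. X \<union> A \<union> B = V \<and> X \<inter> A = {} \<and> X \<inter> B = {} \<and> A \<inter> B = {} \<and> (\<forall>a\<in>A. \<forall>b\<in>B. \<not> E a b) \<and>
    3 * card A \<le> 2 * card V \<and> 3 * card B \<le> 2 * card V \<and>
    l * card X \<le> card V + l * (h * (h * (2 * (l * j) + 2)))"
proof -
  \<comment> \<open>A new branch set joins at most h points, each at the cost of one connecting set
    as in \<open>expanding_diam_le\<close>.\<close>
  define b where "b = h * (2 * (l * j) + 2)"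
  define state where "state = (\<lambda>(\<A>, R, D, W).
    finite \<A> \<and> (\<forall>A\<in>\<A>. A \<subseteq> V \<and> A \<noteq> {} \<and> conn E A \<and> card A \<le> b) \<and>
    (\<forall>A\<in>\<A>. \<forall>B\<in>\<A>. A \<noteq> B \<longrightarrow> A \<inter> B = {} \<and> (\<exists>a\<in>A. \<exists>b\<in>B. E a b)) \<and>
    \<Union>\<A> \<union> R \<union> D \<union> W = V \<and> \<Union>\<A> \<inter> R = {} \<and> \<Union>\<A> \<inter> D = {} \<and> \<Union>\<A> \<inter> W = {} \<and> R \<inter> D = {} \<and> R \<inter> W = {} \<and> D \<inter> W = {} \<and>
    (\<forall>d\<in>D. \<forall>w\<in>W. \<not> E d w) \<and> l * card R \<le> card D \<and> 3 * card D \<le> 2 * card V)"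
  \<comment> \<open>The factor h + 1 makes a loss of one vertex of W outweigh the gain of one branch
    set, while discarding a branch set with W unchanged also decreases the measure.\<close>
  define ms where "ms = (\<lambda>(\<A> :: 'a set set, R :: 'a set, D :: 'a set, W :: 'a set). card W * (h + 1) + card \<A>)"
  have "state ({}, {}, {}, V)" unfolding state_def by auto
  from ex_has_least_nat[of state, OF this, of ms]
  obtain S where S: "state S" "\<And>S'. state S' \<Longrightarrow> ms S \<le> ms S'" by blast
  obtain \<A> R D W where Seq: "S = (\<A>, R, D, W)" by (cases S) auto
  have min: "card W * (h + 1) + card \<A> \<le> card W' * (h + 1) + card \<A>'" if "state (\<A>', R', D', W')" for \<A>' R' D' W'
    using S(2)[OF that] unfolding Seq ms_def by simp
  have st: "finite \<A>" "\<And>A. A \<in> \<A> \<Longrightarrow> A \<subseteq> V \<and> A \<noteq> {} \<and> conn E A \<and> card A \<le> b"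
      "\<And>A B. A \<in> \<A> \<Longrightarrow> B \<in> \<A> \<Longrightarrow> A \<noteq> B \<Longrightarrow> A \<inter> B = {} \<and> (\<exists>a\<in>A. \<exists>b\<in>B. E a b)"
      "\<Union>\<A> \<union> R \<union> D \<union> W = V" "\<Union>\<A> \<inter> R = {}" "\<Union>\<A> \<inter> D = {}" "\<Union>\<A> \<inter> W = {}" "R \<inter> D = {}" "R \<inter> W = {}" "D \<inter> W = {}"
      "\<And>d w. d \<in> D \<Longrightarrow> w \<in> W \<Longrightarrow> \<not> E d w" "l * card R \<le> card D" "3 * card D \<le> 2 * card V"
    using S(1) unfolding Seq state_def by auto
  have few: "card \<A>' < h" if "finite \<A>'" "\<forall>A\<in>\<A>'. A \<subseteq> V \<and> A \<noteq> {} \<and> conn E A"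
      "\<forall>A\<in>\<A>'. \<forall>B\<in>\<A>'. A \<noteq> B \<longrightarrow> A \<inter> B = {} \<and> (\<exists>a\<in>A. \<exists>b\<in>B. E a b)" for \<A>'
  proof (rule ccontr)
    assume "\<not> ?thesis"
    then have "h \<le> card \<A>'" by simp
    then obtain \<B> where B: "\<B> \<subseteq> \<A>'" "card \<B> = h" "finite \<B>" by (rule obtain_subset_with_card_n)
    have "clique_minor E V h"
      unfolding clique_minor_def
    proof (intro exI[of _ \<B>] conjI)
      show "\<forall>A\<in>\<B>. A \<subseteq> V \<and> A \<noteq> {} \<and> conn E A" using that(2) B(1) by (meson subsetD)
      show "\<forall>A\<in>\<B>. \<forall>B\<in>\<B>. A \<noteq> B \<longrightarrow> A \<inter> B = {} \<and> (\<exists>a\<in>A. \<exists>b\<in>B. E a b)"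
        using that(3) B(1) by (meson subsetD)
    qed (use B in auto)
    then show False using h by blast
  qed
  have cA: "card \<A> < h" using few[of \<A>] st(1-3) by blast
  have fins: "finite R" "finite D" "finite W" "finite (\<Union>\<A>)" using st(4) V(1) by (metis finite_Un)+
  show ?thesis
  proof (cases "3 * card W \<le> 2 * card V")
    case True
    \<comment> \<open>The branch sets together with R separate D from W. Fewer than h branch sets of
      size at most b give the second term of the bound; the first is \<open>l * card R\<close>,
      which is at most \<open>card D\<close>.\<close>
    have "card (\<Union>\<A>) \<le> (\<Sum>A\<in>\<A>. card A)" by (rule card_Union_le_sum_card)
    also have "\<dots> \<le> (\<Sum>A\<in>\<A>. b)" using st(2) by (intro sum_mono) blast
    also have "\<dots> \<le> h * b" using cA by simp
    finally have "card (\<Union>\<A> \<union> R) \<le> h * b + card R" using card_Un_le[of "\<Union>\<A>" R] by linarith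
    then have "l * card (\<Union>\<A> \<union> R) \<le> l * (h * b) + l * card R"
      unfolding distrib_left[symmetric] by (rule mult_le_mono2)
    moreover have "card D \<le> card V" using st(4) V(1) by (intro card_mono) auto
    ultimately have "l * card (\<Union>\<A> \<union> R) \<le> card V + l * (h * b)" using st(12) by linarith
    note bound = this
    show ?thesis unfolding b_def[symmetric]
    proof (rule exI[of _ "\<Union>\<A> \<union> R"], rule exI[of _ D], rule exI[of _ W], intro conjI)
      show "(\<Union>\<A> \<union> R) \<inter> D = {}" using st(6,8) by blast
      show "(\<Union>\<A> \<union> R) \<inter> W = {}" using st(7,9) by blast
      show "\<forall>a\<in>D. \<forall>b\<in>W. \<not> E a b" using st(11) by blast
    qed (use st(4,10,13) True bound in simp_all)
  next
    case False
    then have big: "2 * card V < 3 * card W" by simp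
    have DW: "card D + card W \<le> card V"
    proof -
      have "card (D \<union> W) = card D + card W" using fins st(10) by (intro card_Un_disjoint)
      moreover have "card (D \<union> W) \<le> card V" using st(4) V(1) by (intro card_mono) auto
      ultimately show ?thesis by simp
    qed
    have WV: "W \<subseteq> V" using st(4) by blast
    have Wne: "W \<noteq> {}" using big by auto
    have False
    proof (cases "\<exists>A\<in>\<A>. \<forall>a\<in>A. \<forall>w\<in>W. \<not> E a w")
      case True
      then obtain A where A: "A \<in> \<A>" "\<And>a w. a \<in> A \<Longrightarrow> w \<in> W \<Longrightarrow> \<not> E a w" by blast
      have U: "\<Union>(\<A> - {A}) = \<Union>\<A> - A" using st(3)[OF A(1)] A(1) by blast
      have AU: "A \<subseteq> \<Union>\<A>" using A(1) by blast
      have fA: "finite A" using AU fins finite_subset by blast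
      have cDA: "card (D \<union> A) + card W \<le> card V"
      proof -
        have "card ((D \<union> A) \<union> W) = card (D \<union> A) + card W" using fins fA st(7,10) AU by (intro card_Un_disjoint) auto
        moreover have "card ((D \<union> A) \<union> W) \<le> card V" using st(4) V(1) AU by (intro card_mono) auto
        ultimately show ?thesis by simp
      qed
      have "card D \<le> card (D \<union> A)" using fins fA by (intro card_mono) auto
      then have cR: "l * card R \<le> card (D \<union> A)" using st(12) by linarith
      \<comment> \<open>A branch set without neighbours in W joins the processed side. The balance
        condition survives because W still has more than two thirds of V.\<close>
      have "state (\<A> - {A}, R, D \<union> A, W)"
        unfolding state_def prod.case U
      proof (intro conjI)
        show "\<forall>d\<in>D \<union> A. \<forall>w\<in>W. \<not> E d w" using st(11) A(2) by blast
        show "3 * card (D \<union> A) \<le> 2 * card V" using cDA big by linarith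
      qed (use st AU cR in auto)
      from min[OF this] show False using card_Diff1_less[OF st(1) A(1)] by linarith
    next
      case False
      show False
      proof (cases "\<exists>S\<subseteq>W. S \<noteq> {} \<and> 2 * card S \<le> card W \<and> l * card {z \<in> W - S. \<exists>y\<in>S. E y z} \<le> card S")
        case True
        then obtain S where S: "S \<subseteq> W" "S \<noteq> {}" "2 * card S \<le> card W" "l * card {z \<in> W - S. \<exists>y\<in>S. E y z} \<le> card S" by blast
        let ?N = "{z \<in> W - S. \<exists>y\<in>S. E y z}"
        have fS: "finite S" "finite ?N" using S fins finite_subset by auto
        have NW: "?N \<subseteq> W" "?N \<inter> S = {}" by auto
        have "card (R \<union> ?N) = card R + card ?N" using fins fS st(9) by (intro card_Un_disjoint) auto
        moreover have cDS: "card (D \<union> S) = card D + card S" using fins fS S st(10) by (intro card_Un_disjoint) auto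
        ultimately have cR: "l * card (R \<union> ?N) \<le> card (D \<union> S)" using st(12) S(4) by (simp add: distrib_left)
        \<comment> \<open>S is processed and its boundary in W goes to the separator; the cut is
          sparse, so the processed vertices pay for the boundary at the rate l.\<close>
        have "state (\<A>, R \<union> ?N, D \<union> S, W - S - ?N)"
          unfolding state_def prod.case
        proof (intro conjI)
          show "\<Union>\<A> \<union> (R \<union> ?N) \<union> (D \<union> S) \<union> (W - S - ?N) = V" using st(4) S(1) NW by blast
          show "\<forall>d\<in>D \<union> S. \<forall>w\<in>W - S - ?N. \<not> E d w" using st(11) by blast
          show "3 * card (D \<union> S) \<le> 2 * card V" using cDS S(3) DW big by linarith
          show "\<Union>\<A> \<inter> (R \<union> ?N) = {}" using st(5,7) NW by blast
          show "\<Union>\<A> \<inter> (D \<union> S) = {}" using st(6,7) S(1) by blast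
          show "\<Union>\<A> \<inter> (W - S - ?N) = {}" using st(7) by blast
          show "(R \<union> ?N) \<inter> (D \<union> S) = {}" using st(8,9,10) S(1) NW by blast
          show "(R \<union> ?N) \<inter> (W - S - ?N) = {}" using st(9) by blast
          show "(D \<union> S) \<inter> (W - S - ?N) = {}" using st(10) by blast
          show "\<forall>A\<in>\<A>. A \<subseteq> V \<and> A \<noteq> {} \<and> conn E A \<and> card A \<le> b" using st(2) by blast
          show "\<forall>A\<in>\<A>. \<forall>B\<in>\<A>. A \<noteq> B \<longrightarrow> A \<inter> B = {} \<and> (\<exists>a\<in>A. \<exists>b\<in>B. E a b)" using st(3) by blast
        qed (use st(1) cR in auto)
        from min[OF this] have "card W * (h + 1) \<le> card (W - S - ?N) * (h + 1)" by simp
        then have "card W \<le> card (W - S - ?N)" unfolding mult_le_cancel2 by simp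
        moreover have "card (W - S - ?N) < card W" using S fins by (intro psubset_card_mono) auto
        ultimately show False by simp
      next
        case nocut: False
        \<comment> \<open>Without a sparse cut W expands, so it has small diameter.\<close>
        have exp: "card S < l * card {z \<in> W - S. \<exists>y\<in>S. E y z}" if "S \<subseteq> W" "S \<noteq> {}" "2 * card S \<le> card W" for S
        proof (rule ccontr)
          assume "\<not> ?thesis"
          then have "l * card {z \<in> W - S. \<exists>y\<in>S. E y z} \<le> card S" by (rule leI)
          with that have "S \<subseteq> W \<and> S \<noteq> {} \<and> 2 * card S \<le> card W \<and> l * card {z \<in> W - S. \<exists>y\<in>S. E y z} \<le> card S" by simp
          then have "\<exists>S\<subseteq>W. S \<noteq> {} \<and> 2 * card S \<le> card W \<and> l * card {z \<in> W - S. \<exists>y\<in>S. E y z} \<le> card S"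
            by (rule exI)
          with nocut show False by (rule notE)
        qed
        have "card W < 2 ^ j" using j card_mono[OF V(1) WV] by linarith
        from expanding_diam_le[OF fins(3) V(2) l this exp] have diam: "diam_le E W (2 * (l * j) + 2)" .
        have "\<forall>A\<in>\<A>. \<exists>w. w \<in> W \<and> (\<exists>a\<in>A. E a w)" using False by blast
        from bchoice[OF this] obtain f where f: "\<forall>A\<in>\<A>. f A \<in> W \<and> (\<exists>a\<in>A. E a (f A))" ..
        obtain w0 where w0: "w0 \<in> W" using Wne by blast
        \<comment> \<open>One neighbour of every branch set, plus \<open>w0\<close> so that the new
          branch set is nonempty even if there are no others. There are fewer than h branch sets, so
          at most h points have to be joined.\<close>
        let ?Y = "insert w0 (f ` \<A>)"
        have "card ?Y \<le> Suc (card (f ` \<A>))" using st(1) by (simp add: card_insert_if)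
        then have cY: "card ?Y \<le> h" using card_image_le[OF st(1), of f] cA by linarith
        obtain C where C: "C \<subseteq> W" "?Y \<subseteq> C" "finite C" "conn E C" "card C \<le> (2 * (l * j) + 2) * card ?Y"
        proof -
          have "finite ?Y" "?Y \<noteq> {}" "?Y \<subseteq> W" using st(1) f w0 by auto
          from diam_le_join[OF diam this] show ?thesis using that by blast
        qed
        have "(2 * (l * j) + 2) * card ?Y \<le> (2 * (l * j) + 2) * h" using cY by (rule mult_le_mono2)
        then have cC: "card C \<le> b" using C(5) unfolding b_def mult.commute[of h] by linarith
        have CA: "C \<inter> A = {}" "\<exists>a\<in>A. \<exists>c\<in>C. E a c \<and> E c a" if "A \<in> \<A>" for A
        proof -
          show "C \<inter> A = {}" using C(1) st(7) that by blast
          have "\<exists>a\<in>A. E a (f A)" using f that by blast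
          then obtain a where "a \<in> A" "E a (f A)" by blast
          moreover have "f A \<in> C" using C(2) that by blast
          ultimately show "\<exists>a\<in>A. \<exists>c\<in>C. E a c \<and> E c a" using V(2) by (meson sympD)
        qed
        have props: "\<forall>A\<in>insert C \<A>. A \<subseteq> V \<and> A \<noteq> {} \<and> conn E A \<and> card A \<le> b"
          using st(2) C(1,2,4) cC WV by blast
        have pairs: "\<forall>A\<in>insert C \<A>. \<forall>B\<in>insert C \<A>. A \<noteq> B \<longrightarrow> A \<inter> B = {} \<and> (\<exists>a\<in>A. \<exists>b\<in>B. E a b)"
        proof (intro ballI impI)
          fix A B assume AB: "A \<in> insert C \<A>" "B \<in> insert C \<A>" "A \<noteq> B"
          then consider "A = C" "B \<in> \<A>" | "B = C" "A \<in> \<A>" | "A \<in> \<A>" "B \<in> \<A>" by blast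
          then show "A \<inter> B = {} \<and> (\<exists>a\<in>A. \<exists>b\<in>B. E a b)"
          proof cases
            case 1
            then show ?thesis using CA[of B] by blast
          next
            case 2
            then show ?thesis using CA[of A] by blast
          next
            case 3
            then show ?thesis using st(3) AB(3) by blast
          qed
        qed
        have "state (insert C \<A>, R, D, W - C)"
          unfolding state_def prod.case
        proof (intro conjI)
          show "\<Union>(insert C \<A>) \<union> R \<union> D \<union> (W - C) = V" using st(4) C(1) by blast
          show "\<Union>(insert C \<A>) \<inter> R = {}" "\<Union>(insert C \<A>) \<inter> D = {}" "\<Union>(insert C \<A>) \<inter> (W - C) = {}"
            using st(5-7,9,10) C(1) by blast+
        qed (use st props pairs in auto)
        from min[OF this] have m: "card W * (h + 1) + card \<A> \<le> card (W - C) * (h + 1) + card (insert C \<A>)" .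
        have "card (insert C \<A>) \<le> Suc (card \<A>)" using st(1) by (simp add: card_insert_if)
        moreover have "card (W - C) < card W" using C(1,2) fins by (intro psubset_card_mono) auto
        then have "Suc (card (W - C)) * (h + 1) \<le> card W * (h + 1)" by (intro mult_le_mono1) simp
        then have "card (W - C) * (h + 1) + (h + 1) \<le> card W * (h + 1)" by simp
        ultimately have "h + 1 \<le> 1" using m by linarith
        then show False using cA by simp
      qed
    qed
    then show ?thesis by blast
  qed
qed

text \<open>The parameters are l = q, about n^(1/4), and j = 2 q^2, so that n is at most q^4 < 2^j.
  Then n / l and l j are both of order q^3, which gives the exponent 3/4. Replacing log n by a power
  is wasteful, but every exponent below 1 serves the purpose.\<close>

lemma clique_minor_free_separator:
  fixes h :: nat
  assumes V: "finite V" "symp E" and h: "\<not> clique_minor E V h"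
  shows "\<exists>X A B. X \<union> A \<union> B = V \<and> X \<inter> A = {} \<and> X \<inter> B = {} \<and> A \<inter> B = {} \<and> (\<forall>a\<in>A. \<forall>b\<in>B. \<not> E a b) \<and>
    3 * card A \<le> 2 * card V \<and> 3 * card B \<le> 2 * card V \<and>
    real (card X) \<le> 8 * (1 + 6 * (real h)\<^sup>2) * real (card V) powr (3 / 4)"
proof (cases "V = {}")
  case True
  then show ?thesis by (intro exI[of _ "{}"]) auto
next
  case False
  let ?n = "card V"
  have n1: "real ?n \<ge> 1" using False V(1) by (simp add: Suc_le_eq card_gt_0_iff)
  define q where "q = nat \<lceil>real ?n powr (1 / 4)\<rceil>"
  have p1: "1 \<le> real ?n powr (1 / 4)" using n1 by (simp add: ge_one_powr_ge_zero)
  have q: "real ?n powr (1 / 4) \<le> real q" "real q \<le> 2 * real ?n powr (1 / 4)"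
    using p1 unfolding q_def by linarith+
  have q0: "q > 0" using q p1 by (cases q) auto
  have "real ?n = (real ?n powr (1 / 4)) ^ 4" using n1 by (simp add: powr_power)
  also have "\<dots> \<le> real q ^ 4" using q by (intro power_mono) auto
  finally have "real ?n \<le> real (q ^ 4)" by simp
  then have nq': "?n \<le> q ^ 4" by (simp only: of_nat_le_iff)
  have "q\<^sup>2 < 2 ^ q\<^sup>2" by (rule less_exp)
  then have "(q\<^sup>2)\<^sup>2 < (2 ^ q\<^sup>2)\<^sup>2" by (intro power_strict_mono) auto
  then have j: "?n < 2 ^ (2 * q\<^sup>2)" using nq' by (simp add: power_mult[symmetric] mult.commute)
  obtain X A B where XAB: "X \<union> A \<union> B = V" "X \<inter> A = {}" "X \<inter> B = {}" "A \<inter> B = {}" "\<forall>a\<in>A. \<forall>b\<in>B. \<not> E a b"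
      "3 * card A \<le> 2 * ?n" "3 * card B \<le> 2 * ?n"
      "q * card X \<le> ?n + q * (h * (h * (2 * (q * (2 * q\<^sup>2)) + 2)))"
    using clique_minor_free_separator_param[OF V h q0 j] by (elim exE conjE)
  have "q * card X \<le> q * q ^ 3 + q * (h * (h * (6 * q ^ 3)))"
  proof -
    have "1 \<le> q ^ 3" using q0 by simp
    then have "2 * (q * (2 * q\<^sup>2)) + 2 \<le> 6 * q ^ 3" by (simp add: power2_eq_square power3_eq_cube)
    then have "q * (h * (h * (2 * (q * (2 * q\<^sup>2)) + 2))) \<le> q * (h * (h * (6 * q ^ 3)))" by (intro mult_le_mono2)
    moreover have "?n \<le> q * q ^ 3" using nq' by (simp add: power_Suc[symmetric] del: power_Suc)
    ultimately show ?thesis using XAB(8) by linarith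
  qed
  then have "q * card X \<le> q * (q ^ 3 + h * (h * (6 * q ^ 3)))" by (simp add: distrib_left)
  then have "card X \<le> q ^ 3 + h * (h * (6 * q ^ 3))" using q0 by simp
  then have "real (card X) \<le> real (q ^ 3 + h * (h * (6 * q ^ 3)))" by (simp only: of_nat_le_iff)
  also have "\<dots> = (1 + 6 * (real h)\<^sup>2) * real q ^ 3" by (simp add: algebra_simps power2_eq_square)
  also have "\<dots> \<le> (1 + 6 * (real h)\<^sup>2) * (2 * real ?n powr (1 / 4)) ^ 3"
    using q by (intro mult_left_mono power_mono) auto
  also have "(2 * real ?n powr (1 / 4)) ^ 3 = 8 * real ?n powr (3 / 4)"
    using n1 by (simp add: power_mult_distrib powr_power)
  finally have "real (card X) \<le> 8 * (1 + 6 * (real h)\<^sup>2) * real ?n powr (3 / 4)" by (simp add: algebra_simps)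
  then show ?thesis using XAB(1-7)
    by (rule_tac exI[of _ X], rule_tac exI[of _ A], rule_tac exI[of _ B]) (intro conjI)
qed

section \<open>Iterated separation into parts of bounded size\<close>

definition parts_of :: "('a \<Rightarrow> 'a \<Rightarrow> bool) \<Rightarrow> 'a set \<Rightarrow> nat \<Rightarrow> 'a set set \<Rightarrow> bool" where
  "parts_of E W r \<Q> \<longleftrightarrow> \<Union>\<Q> = W \<and> (\<forall>Q\<in>\<Q>. card Q \<le> r) \<and>
     (\<forall>P\<in>\<Q>. \<forall>Q\<in>\<Q>. P \<noteq> Q \<longrightarrow> P \<inter> Q = {} \<and> (\<forall>x\<in>P. \<forall>y\<in>Q. \<not> E x y))"

lemma parts_of_Un:
  assumes "parts_of E A r P" "parts_of E B r Q" "A \<inter> B = {}" "\<forall>a\<in>A. \<forall>b\<in>B. \<not> E a b" "symp E"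
  shows "parts_of E (A \<union> B) r (P \<union> Q)"
proof -
  have cross: "\<not> E b a" if "a \<in> A" "b \<in> B" for a b using assms(4,5) that by (meson sympD)
  have PA: "X \<subseteq> A" if "X \<in> P" for X using assms(1) that unfolding parts_of_def by blast
  have QB: "X \<subseteq> B" if "X \<in> Q" for X using assms(2) that unfolding parts_of_def by blast
  show ?thesis
    unfolding parts_of_def
  proof (intro conjI ballI impI)
    show "\<Union>(P \<union> Q) = A \<union> B" using assms(1,2) unfolding parts_of_def by auto
    show "card X \<le> r" if "X \<in> P \<union> Q" for X using assms(1,2) that unfolding parts_of_def by blast
    fix X Y assume XY: "X \<in> P \<union> Q" "Y \<in> P \<union> Q" "X \<noteq> Y"
    then consider "X \<in> P" "Y \<in> P" | "X \<in> Q" "Y \<in> Q" | "X \<in> P" "Y \<in> Q" | "X \<in> Q" "Y \<in> P" by blast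
    then have "X \<inter> Y = {} \<and> (\<forall>x\<in>X. \<forall>y\<in>Y. \<not> E x y)"
    proof cases
      case 1
      then show ?thesis using assms(1) XY(3) unfolding parts_of_def by simp
    next
      case 2
      then show ?thesis using assms(2) XY(3) unfolding parts_of_def by simp
    next
      case 3
      then show ?thesis using PA[of X] QB[of Y] assms(3,4) by blast
    next
      case 4
      then show ?thesis using PA[of Y] QB[of X] assms(3) cross by blast
    qed
    then show "X \<inter> Y = {}" "\<And>x y. x \<in> X \<Longrightarrow> y \<in> Y \<Longrightarrow> \<not> E x y" by blast+
  qed
qed

lemma powr_two_thirds_gt_one: "(1 :: real) < (2 / 3) powr (- 1 / 4)"
proof -
  have "(1 :: real) < (3 / 2) powr (1 / 4)" by (rule gr_one_powr) auto
  also have "(3 / 2 :: real) powr (1 / 4) = (2 / 3) powr (- 1 / 4)"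
    using powr_minus[of "2 / 3 :: real" "1 / 4"] by (simp add: powr_divide)
  finally show ?thesis .
qed

text \<open>Sets larger than r are separated recursively. The cost of a set of n vertices is bounded
  by n g(n) for a potential g that absorbs one separator of size k n^(3/4) when passing to sets of
  size at most 2 n / 3.\<close>

lemma clique_minor_free_parts:
  fixes h r :: nat
  assumes r: "r > 0"
  defines "c \<equiv> 8 * (1 + 6 * (real h)\<^sup>2) / ((2 / 3) powr (- 1 / 4) - 1)"
  assumes V: "finite V" "symp E" "\<not> clique_minor E V h"
  shows "\<exists>S \<Q>. S \<subseteq> V \<and> parts_of E (V - S) r \<Q> \<and>
    real (card S) \<le> c * (2 * real r / 3) powr (- 1 / 4) * real (card V)"
proof -
  let ?k = "8 * (1 + 6 * (real h)\<^sup>2)" and ?d = "(2 / 3 :: real) powr (- 1 / 4) - 1"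
  have d0: "?d > 0" using powr_two_thirds_gt_one by simp
  have c0: "c > 0" using d0 unfolding c_def by (intro divide_pos_pos) (auto intro: add_pos_nonneg)
  have cd: "c * ?d = ?k" using d0 unfolding c_def by simp
  \<comment> \<open>Away from the truncation at 0, g satisfies k x^(-1/4) + g(2 x / 3) = g(x), by
    the choice of c. Only sets with more than r vertices are split, so the argument 2 n / 3 stays
    above 2 r / 3, the point where g vanishes.\<close>
  define g where "g = (\<lambda>x :: real. max 0 (c * ((2 * real r / 3) powr (- 1 / 4) - x powr (- 1 / 4))))"
  have gmono: "g x \<le> g y" if "0 < x" "x \<le> y" for x y
  proof -
    have "y powr (- 1 / 4) \<le> x powr (- 1 / 4)" using that by (intro powr_mono2') auto
    then have "c * ((2 * real r / 3) powr (- 1 / 4) - x powr (- 1 / 4)) \<le> c * ((2 * real r / 3) powr (- 1 / 4) - y powr (- 1 / 4))"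
      using c0 by (intro mult_left_mono) auto
    then show ?thesis unfolding g_def by linarith
  qed
  have "\<exists>S \<Q>. S \<subseteq> W \<and> parts_of E (W - S) r \<Q> \<and> real (card S) \<le> real (card W) * g (real (card W))"
    if "W \<subseteq> V" for W
    using that
  proof (induction "card W" arbitrary: W rule: less_induct)
    case less
    let ?n = "real (card W)"
    have fW: "finite W" using less.prems V(1) finite_subset by blast
    have noW: "\<not> clique_minor E W h" using V(3) clique_minor_mono less.prems by blast
    show ?case
    proof (cases "card W \<le> r")
      case True
      then have "parts_of E (W - {}) r {W}" unfolding parts_of_def by simp
      moreover have "0 \<le> ?n * g ?n" unfolding g_def by simp
      ultimately show ?thesis by (intro exI[of _ "{}"] exI[of _ "{W}"]) simp
    next
      case False
      then have nr: "real r < ?n" by simp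
      then have n0: "0 < ?n" by linarith
      obtain X A B where XAB: "X \<union> A \<union> B = W" "X \<inter> A = {}" "X \<inter> B = {}" "A \<inter> B = {}" "\<forall>a\<in>A. \<forall>b\<in>B. \<not> E a b"
          "3 * card A \<le> 2 * card W" "3 * card B \<le> 2 * card W" "real (card X) \<le> ?k * ?n powr (3 / 4)"
        using clique_minor_free_separator[OF fW V(2) noW] by (elim exE conjE)
      have lt: "card A < card W" "card B < card W" using XAB(6,7) n0 by linarith+
      have AV: "A \<subseteq> V" "B \<subseteq> V" using XAB(1) less.prems by blast+
      obtain S1 Q1 where 1: "S1 \<subseteq> A" "parts_of E (A - S1) r Q1" "real (card S1) \<le> real (card A) * g (real (card A))"
        using less.hyps[OF lt(1) AV(1)] by blast
      obtain S2 Q2 where 2: "S2 \<subseteq> B" "parts_of E (B - S2) r Q2" "real (card S2) \<le> real (card B) * g (real (card B))"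
        using less.hyps[OF lt(2) AV(2)] by blast
      have fin: "finite X" "finite A" "finite B" using XAB(1) fW by (metis finite_Un)+
      have step: "real (card C) * g (real (card C)) \<le> real (card C) * g (2 * ?n / 3)" if "3 * card C \<le> 2 * card W" for C :: "'a set"
      proof (cases "card C = 0")
        case False
        have "g (real (card C)) \<le> g (2 * ?n / 3)" using that False by (intro gmono) auto
        then show ?thesis by (intro mult_left_mono) auto
      qed simp
      have "card A + card B \<le> card W"
      proof -
        have "card (A \<union> B) = card A + card B" using fin XAB(4) by (intro card_Un_disjoint)
        moreover have "card (A \<union> B) \<le> card W" using XAB(1) fW by (intro card_mono) auto
        ultimately show ?thesis by simp
      qed
      then have "(real (card A) + real (card B)) * g (2 * ?n / 3) \<le> ?n * g (2 * ?n / 3)"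
        by (intro mult_right_mono) (auto simp: g_def)
      then have s12: "real (card S1) + real (card S2) \<le> ?n * g (2 * ?n / 3)"
        using 1(3) 2(3) step[OF XAB(6)] step[OF XAB(7)] by (simp add: distrib_right)
      let ?S = "X \<union> S1 \<union> S2"
      have "card ?S \<le> card X + card S1 + card S2" using card_Un_le[of "X \<union> S1" S2] card_Un_le[of X S1] by linarith
      then have "real (card ?S) \<le> ?k * ?n powr (3 / 4) + ?n * g (2 * ?n / 3)" using s12 XAB(8) by linarith
      also have "\<dots> \<le> ?n * g ?n"
      proof -
        let ?a = "(2 * real r / 3) powr (- 1 / 4)" and ?b = "?n powr (- 1 / 4)"
        have e1: "?n powr (3 / 4) = ?n * ?b" using n0 powr_mult_base[of ?n "- 1 / 4"] by simp
        have e2: "(2 * ?n / 3) powr (- 1 / 4) = (2 / 3) powr (- 1 / 4) * ?b"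
          using n0 powr_mult[of "2 / 3" ?n "- 1 / 4"] by simp
        have "(2 * ?n / 3) powr (- 1 / 4) \<le> ?a" using nr r by (intro powr_mono2') auto
        then have g1: "g (2 * ?n / 3) = c * (?a - (2 / 3) powr (- 1 / 4) * ?b)" using c0 unfolding g_def e2 by simp
        have g2: "c * (?a - ?b) \<le> g ?n" unfolding g_def by simp
        have "?k * ?b + g (2 * ?n / 3) = c * (?a - ?b)" unfolding g1 cd[symmetric] by (simp add: algebra_simps)
        then have "?n * (?k * ?b + g (2 * ?n / 3)) \<le> ?n * g ?n" using g2 n0 by (intro mult_left_mono) auto
        then show ?thesis unfolding e1 by (simp add: algebra_simps)
      qed
      finally have "real (card ?S) \<le> ?n * g ?n" .
      moreover have "parts_of E ((A - S1) \<union> (B - S2)) r (Q1 \<union> Q2)"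
        by (rule parts_of_Un[OF 1(2) 2(2) _ _ V(2)]) (use XAB(4,5) in auto)
      moreover have "(A - S1) \<union> (B - S2) = W - ?S" using XAB(1-4) 1(1) 2(1) by blast
      moreover have "?S \<subseteq> W" using XAB(1) 1(1) 2(1) by blast
      ultimately show ?thesis by (intro exI[of _ ?S] exI[of _ "Q1 \<union> Q2"]) simp
    qed
  qed
  from this[of V] obtain S \<Q> where S: "S \<subseteq> V" "parts_of E (V - S) r \<Q>" "real (card S) \<le> real (card V) * g (real (card V))"
    by blast
  have "g (real (card V)) \<le> c * (2 * real r / 3) powr (- 1 / 4)"
    unfolding g_def using c0 by (auto simp: algebra_simps)
  then have "real (card V) * g (real (card V)) \<le> real (card V) * (c * (2 * real r / 3) powr (- 1 / 4))"
    by (intro mult_left_mono) auto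
  then have "real (card S) \<le> c * (2 * real r / 3) powr (- 1 / 4) * real (card V)" using S(3) by (simp add: mult_ac)
  then show ?thesis using S by blast
qed

section \<open>Embedding into a dense, robustly connected graph\<close>

definition undominated :: "('a \<Rightarrow> 'a \<Rightarrow> bool) \<Rightarrow> 'a set \<Rightarrow> 'a set \<Rightarrow> 'a set" where
  "undominated E V T = {v \<in> V. \<forall>y\<in>T. \<not> E v y}"

text \<open>Greedy choice: on average a vertex of U is adjacent to a fraction 1 / q of the vertices
  not yet dominated, because these have d neighbours in U and U has at most q d vertices.\<close>

lemma almost_dominating_set:
  fixes d q :: real
  assumes V: "finite V" "U \<subseteq> V" "real (card V) \<le> q * d" "d > 0" "q \<ge> 1"
    and deg: "\<And>v. v \<in> V \<Longrightarrow> d \<le> real (card {y \<in> U. E v y})"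
  shows "\<exists>Y\<subseteq>U. card Y \<le> M \<and> real (card (undominated E V Y)) \<le> (1 - 1 / q) ^ M * real (card V)"
proof (induction M)
  case 0
  show ?case by (intro exI[of _ "{}"]) (auto simp: undominated_def)
next
  case (Suc M)
  then obtain Y where Y: "Y \<subseteq> U" "card Y \<le> M" "real (card (undominated E V Y)) \<le> (1 - 1 / q) ^ M * real (card V)" by blast
  let ?Z = "undominated E V Y"
  have fU: "finite U" using V finite_subset by blast
  have fZ: "finite ?Z" "?Z \<subseteq> V" using V(1) unfolding undominated_def by auto
  have q0: "0 \<le> 1 - 1 / q" using V(5) by simp
  show ?case
  proof (cases "?Z = {}")
    case True
    have "0 \<le> (1 - 1 / q) ^ Suc M * real (card V)" using q0 by (intro mult_nonneg_nonneg zero_le_power) auto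
    then show ?thesis using Y True by (intro exI[of _ Y]) auto
  next
    case False
    have "\<exists>y\<in>U. real (card ?Z) / q \<le> real (card {v \<in> ?Z. E v y})"
    proof (rule ccontr)
      assume n: "\<not> ?thesis"
      have "U \<noteq> {}"
      proof
        assume "U = {}"
        then show False using False fZ(2) deg V(4) by fastforce
      qed
      have "real (card ?Z) * d \<le> (\<Sum>v\<in>?Z. real (card {y \<in> U. E v y}))"
        using sum_mono[of ?Z "\<lambda>_. d" "\<lambda>v. real (card {y \<in> U. E v y})"] deg fZ(2) by auto
      also have "\<dots> = (\<Sum>y\<in>U. real (card {v \<in> ?Z. E v y}))"
        using card_filter_swap[OF fZ(1) fU, of E] by (simp only: of_nat_sum[symmetric])
      also have "\<dots> < (\<Sum>y\<in>U. real (card ?Z) / q)"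
        using n fU \<open>U \<noteq> {}\<close> by (intro sum_strict_mono) auto
      also have "\<dots> = real (card U) * (real (card ?Z) / q)" by simp
      also have "\<dots> \<le> (q * d) * (real (card ?Z) / q)"
      proof (rule mult_right_mono)
        have "card U \<le> card V" using V by (intro card_mono) auto
        then show "real (card U) \<le> q * d" using V(3) by linarith
      qed (use V in auto)
      also have "\<dots> = real (card ?Z) * d" using V(5) by simp
      finally show False by simp
    qed
    then obtain y where y: "y \<in> U" "real (card ?Z) / q \<le> real (card {v \<in> ?Z. E v y})" by blast
    have "undominated E V (insert y Y) = ?Z - {v \<in> ?Z. E v y}" unfolding undominated_def by auto
    then have "card (undominated E V (insert y Y)) = card ?Z - card {v \<in> ?Z. E v y}"
      using fZ by (simp add: card_Diff_subset)
    moreover have "card {v \<in> ?Z. E v y} \<le> card ?Z" using fZ by (intro card_mono) auto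
    ultimately have "real (card (undominated E V (insert y Y))) = real (card ?Z) - real (card {v \<in> ?Z. E v y})"
      by (simp add: of_nat_diff)
    also have "\<dots> \<le> (1 - 1 / q) * real (card ?Z)" using y(2) by (simp add: algebra_simps)
    also have "\<dots> \<le> (1 - 1 / q) * ((1 - 1 / q) ^ M * real (card V))" using Y(3) q0 by (rule mult_left_mono)
    finally have "real (card (undominated E V (insert y Y))) \<le> (1 - 1 / q) ^ Suc M * real (card V)" by simp
    moreover have "card (insert y Y) \<le> Suc M" using Y(1,2) fU finite_subset[of Y U] by (simp add: card_insert_if)
    ultimately show ?thesis using Y(1) y(1) by (intro exI[of _ "insert y Y"]) auto
  qed
qed

text \<open>The branch sets are built one after another in what is left of V, which remains
  connected with minimum degree d and hence has bounded diameter. A new branch set joins an almost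
  dominating set and one contact point for each earlier neighbour. Summed over S, the contact points
  number at most the edges inside S.\<close>

lemma dominating_branch_sets:
  fixes F :: "'b sgraph" and V :: "'a set" and d w \<zeta> :: real and q M :: nat
  assumes F: "simple_graph F" "finite S"
    and V: "finite V" "symp E" "real (card V) \<le> real q * d" "d > 0" "q \<ge> 1"
    and rob: "\<And>X. X \<subseteq> V \<Longrightarrow> real (card X) \<le> w \<Longrightarrow> conn E (V - X)"
    and deg: "\<And>v. v \<in> V \<Longrightarrow> d + w \<le> real (card {y \<in> V. E v y})"
    and Vne: "V \<noteq> {}"
    and M: "(1 - 1 / real q) ^ M \<le> \<zeta>" and \<zeta>: "\<zeta> * real q < 1"
    and w: "real ((3 * q + 4) * ((M + 1) * card S + card {e \<in> edges F. e \<subseteq> S})) \<le> w"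
  shows "\<exists>T. (\<forall>s\<in>S. T s \<subseteq> V \<and> T s \<noteq> {} \<and> conn E (T s) \<and> real (card (undominated E V (T s))) \<le> \<zeta> * real (card V)) \<and>
     (\<forall>s\<in>S. \<forall>s'\<in>S. s \<noteq> s' \<longrightarrow> T s \<inter> T s' = {}) \<and>
     (\<forall>s\<in>S. \<forall>s'\<in>S. adj F s s' \<longrightarrow> (\<exists>u\<in>T s. \<exists>v\<in>T s'. E u v)) \<and>
     card (\<Union>s\<in>S. T s) \<le> (3 * q + 4) * ((M + 1) * card S + card {e \<in> edges F. e \<subseteq> S})"
  using F(2) w
proof (induction S rule: finite_induct)
  case empty
  show ?case by auto
next
  case (insert s S)
  let ?b = "3 * q + 4" and ?e = "\<lambda>S. card {e \<in> edges F. e \<subseteq> S}"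
  let ?N = "{x \<in> S. adj F s x}"
  have fE: "finite (edges F)" using finite_simple_graph[OF F(1)] by blast
  have eN: "?e S + card ?N \<le> ?e (insert s S)"
  proof -
    have "card ((\<lambda>x. {s, x}) ` ?N) = card ?N" by (rule card_image) (auto simp: inj_on_def doubleton_eq_iff)
    moreover have "card ({e \<in> edges F. e \<subseteq> S} \<union> (\<lambda>x. {s, x}) ` ?N) = ?e S + card ((\<lambda>x. {s, x}) ` ?N)"
      using fE insert.hyps by (intro card_Un_disjoint) auto
    moreover have "card ({e \<in> edges F. e \<subseteq> S} \<union> (\<lambda>x. {s, x}) ` ?N) \<le> ?e (insert s S)"
      using fE by (intro card_mono) (auto simp: adj_def)
    ultimately show ?thesis by simp
  qed
  have budget: "?b * ((M + 1) * card S + ?e S) + ?b * (M + 1 + card ?N) \<le> ?b * ((M + 1) * card (insert s S) + ?e (insert s S))"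
  proof -
    have "((M + 1) * card S + ?e S) + (M + 1 + card ?N) \<le> (M + 1) * card (insert s S) + ?e (insert s S)"
      using eN insert.hyps by simp
    then show ?thesis unfolding distrib_left[symmetric] by (rule mult_le_mono2)
  qed
  have "real (?b * ((M + 1) * card S + ?e S)) \<le> w"
  proof -
    have "?b * ((M + 1) * card S + ?e S) \<le> ?b * ((M + 1) * card (insert s S) + ?e (insert s S))" using budget by linarith
    then have "real (?b * ((M + 1) * card S + ?e S)) \<le> real (?b * ((M + 1) * card (insert s S) + ?e (insert s S)))"
      by (simp only: of_nat_le_iff)
    then show ?thesis using insert.prems by linarith
  qed
  from insert.IH[OF this] obtain T where T0:
      "\<forall>s\<in>S. T s \<subseteq> V \<and> T s \<noteq> {} \<and> conn E (T s) \<and> real (card (undominated E V (T s))) \<le> \<zeta> * real (card V)"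
      "\<forall>s\<in>S. \<forall>s'\<in>S. s \<noteq> s' \<longrightarrow> T s \<inter> T s' = {}"
      "\<forall>s\<in>S. \<forall>s'\<in>S. adj F s s' \<longrightarrow> (\<exists>u\<in>T s. \<exists>v\<in>T s'. E u v)"
      "card (\<Union>s\<in>S. T s) \<le> ?b * ((M + 1) * card S + ?e S)"
    by (elim exE conjE)
  then have T:
      "\<And>s. s \<in> S \<Longrightarrow> T s \<subseteq> V \<and> T s \<noteq> {} \<and> conn E (T s) \<and> real (card (undominated E V (T s))) \<le> \<zeta> * real (card V)"
      "\<And>s s'. s \<in> S \<Longrightarrow> s' \<in> S \<Longrightarrow> s \<noteq> s' \<Longrightarrow> T s \<inter> T s' = {}"
      "\<And>s s'. s \<in> S \<Longrightarrow> s' \<in> S \<Longrightarrow> adj F s s' \<Longrightarrow> \<exists>u\<in>T s. \<exists>v\<in>T s'. E u v"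
      "card (\<Union>s\<in>S. T s) \<le> ?b * ((M + 1) * card S + ?e S)"
    by simp_all
  have cused: "real (card (\<Union>s\<in>S. T s)) \<le> w"
  proof -
    have "real (card (\<Union>s\<in>S. T s)) \<le> real (?b * ((M + 1) * card S + ?e S))" using T(4) by (simp only: of_nat_le_iff)
    then show ?thesis using \<open>real (?b * ((M + 1) * card S + ?e S)) \<le> w\<close> by linarith
  qed
  define U where "U = V - (\<Union>s\<in>S. T s)"
  have usedV: "(\<Union>s\<in>S. T s) \<subseteq> V" using T(1) by blast
  have fU: "finite U" "U \<subseteq> V" using V(1) unfolding U_def by auto
  have cU: "conn E U" unfolding U_def by (rule rob[OF usedV cused])
  have fused: "finite (\<Union>s\<in>S. T s)" using usedV V(1) finite_subset by blast
  have degU: "d \<le> real (card {y \<in> U. E v y})" if "v \<in> V" for v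
  proof -
    have "card {y \<in> V. E v y} \<le> card ({y \<in> U. E v y} \<union> (\<Union>s\<in>S. T s))"
      using fU fused by (intro card_mono) (auto simp: U_def)
    also have "\<dots> \<le> card {y \<in> U. E v y} + card (\<Union>s\<in>S. T s)" by (rule card_Un_le)
    finally have "real (card {y \<in> V. E v y}) \<le> real (card {y \<in> U. E v y}) + real (card (\<Union>s\<in>S. T s))" by linarith
    then show ?thesis using deg[OF that] cused by linarith
  qed
  have cUV: "card U \<le> card V" using card_mono[OF V(1) fU(2)] .
  have diam: "diam_le E U ?b"
    by (rule diam_le_min_degree[OF fU(1) V(2) cU V(4)]) (use cUV V(3) degU fU(2) in force)+
  obtain Y where Y: "Y \<subseteq> U" "card Y \<le> M" "real (card (undominated E V Y)) \<le> (1 - 1 / real q) ^ M * real (card V)"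
  proof -
    have "\<exists>Y\<subseteq>U. card Y \<le> M \<and> real (card (undominated E V Y)) \<le> (1 - 1 / real q) ^ M * real (card V)"
      by (rule almost_dominating_set[where E = E, OF V(1) fU(2) V(3,4) _ degU]) (use V(5) in auto)
    then show ?thesis using that by blast
  qed
  have dU: "d \<le> real (card U)"
  proof -
    obtain v where "v \<in> V" using Vne by blast
    moreover have "card {y \<in> U. E v y} \<le> card U" using fU by (intro card_mono) auto
    ultimately show ?thesis using degU[of v] by linarith
  qed
  have "\<exists>z. z \<in> U \<and> (\<exists>y\<in>T x. E z y)" if x: "x \<in> ?N" for x
  proof (rule ccontr)
    assume "\<not> ?thesis"
    then have "U \<subseteq> undominated E V (T x)" using fU(2) unfolding undominated_def by blast
    then have "card U \<le> card (undominated E V (T x))" using V(1) by (intro card_mono) (auto simp: undominated_def)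
    then have "d \<le> \<zeta> * real (card V)" using dU T(1)[of x] x by force
    also have "\<dots> \<le> \<zeta> * (real q * d)"
    proof (rule mult_left_mono[OF V(3)])
      have "0 \<le> (1 - 1 / real q) ^ M" using V(5) by (intro zero_le_power) simp
      then show "0 \<le> \<zeta>" using M by linarith
    qed
    also have "\<dots> = (\<zeta> * real q) * d" by simp
    also have "\<dots> < 1 * d" using \<zeta> V(4) by (intro mult_strict_right_mono)
    finally show False by simp
  qed
  then have "\<forall>x\<in>?N. \<exists>z. z \<in> U \<and> (\<exists>y\<in>T x. E z y)" by blast
  from bchoice[OF this] obtain f where f: "\<forall>x\<in>?N. f x \<in> U \<and> (\<exists>y\<in>T x. E (f x) y)" ..
  have "U \<noteq> {}" using dU V(4) by auto
  then obtain u0 where u0: "u0 \<in> U" by blast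
  \<comment> \<open>At most M dominating vertices, one vertex guaranteeing nonemptiness, and one
    contact point per earlier neighbour: this is the increment in the budget.\<close>
  let ?P = "insert u0 (Y \<union> f ` ?N)"
  have fin: "finite Y" "finite ?N" using Y(1) fU insert.hyps finite_subset by auto
  have P: "finite ?P" "?P \<noteq> {}" "?P \<subseteq> U" using fin Y(1) f u0 by auto
  have cP: "card ?P \<le> M + 1 + card ?N"
  proof -
    have "card ?P \<le> Suc (card (Y \<union> f ` ?N))" using fin by (simp add: card_insert_if)
    also have "card (Y \<union> f ` ?N) \<le> card Y + card (f ` ?N)" by (rule card_Un_le)
    also have "card (f ` ?N) \<le> card ?N" by (rule card_image_le[OF fin(2)])
    finally show ?thesis using Y(2) by simp
  qed
  obtain C where C: "C \<subseteq> U" "?P \<subseteq> C" "finite C" "conn E C" "card C \<le> ?b * card ?P"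
    using diam_le_join[OF diam P] by blast
  have cC: "card C \<le> ?b * (M + 1 + card ?N)" using C(5) mult_le_mono2[OF cP, of ?b] by linarith
  define T' where "T' = T(s := C)"
  have T'S: "T' x = T x" if "x \<in> S" for x using that insert.hyps unfolding T'_def by auto
  have T's: "T' s = C" unfolding T'_def by simp
  have CT: "C \<inter> T x = {}" if "x \<in> S" for x using C(1) that unfolding U_def by blast
  have un: "(\<Union>x\<in>insert s S. T' x) = C \<union> (\<Union>x\<in>S. T x)" using T'S T's by auto
  have edgeC: "\<exists>u\<in>C. \<exists>v\<in>T x. E u v \<and> E v u" if "x \<in> S" "adj F s x" for x
  proof -
    have x: "x \<in> ?N" using that by simp
    then obtain y where "y \<in> T x" "E (f x) y" using f by blast
    moreover have "f x \<in> C" using C(2) x by blast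
    ultimately show ?thesis using V(2) by (meson sympD)
  qed
  have "\<forall>x\<in>insert s S. T' x \<subseteq> V \<and> T' x \<noteq> {} \<and> conn E (T' x) \<and> real (card (undominated E V (T' x))) \<le> \<zeta> * real (card V)"
  proof
    fix x assume "x \<in> insert s S"
    then consider "x = s" | "x \<in> S" by blast
    then show "T' x \<subseteq> V \<and> T' x \<noteq> {} \<and> conn E (T' x) \<and> real (card (undominated E V (T' x))) \<le> \<zeta> * real (card V)"
    proof cases
      case 1
      have "undominated E V C \<subseteq> undominated E V Y" using C(2) unfolding undominated_def by blast
      then have "card (undominated E V C) \<le> card (undominated E V Y)"
        using V(1) by (intro card_mono) (auto simp: undominated_def)
      moreover have "(1 - 1 / real q) ^ M * real (card V) \<le> \<zeta> * real (card V)" using M by (intro mult_right_mono) auto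
      ultimately have "real (card (undominated E V C)) \<le> \<zeta> * real (card V)" using Y(3) by linarith
      then show ?thesis unfolding 1 T's using C fU(2) by blast
    next
      case 2
      then show ?thesis using T(1) T'S by simp
    qed
  qed
  moreover have "\<forall>x\<in>insert s S. \<forall>x'\<in>insert s S. x \<noteq> x' \<longrightarrow> T' x \<inter> T' x' = {}"
  proof (intro ballI impI)
    fix x x' assume "x \<in> insert s S" "x' \<in> insert s S" "x \<noteq> x'"
    then consider "x = s" "x' \<in> S" | "x' = s" "x \<in> S" | "x \<in> S" "x' \<in> S" by blast
    then show "T' x \<inter> T' x' = {}"
    proof cases
      case 1
      then show ?thesis using CT[of x'] T'S T's by simp
    next
      case 2
      then show ?thesis using CT[of x] T'S T's by (simp add: Int_commute)
    next
      case 3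
      then show ?thesis using T(2)[of x x'] T'S \<open>x \<noteq> x'\<close> by simp
    qed
  qed
  moreover have "\<forall>x\<in>insert s S. \<forall>x'\<in>insert s S. adj F x x' \<longrightarrow> (\<exists>u\<in>T' x. \<exists>v\<in>T' x'. E u v)"
  proof (intro ballI impI)
    fix x x' assume a: "x \<in> insert s S" "x' \<in> insert s S" "adj F x x'"
    then have "x \<noteq> x'" using adj_simple[OF F(1)] by blast
    then consider "x = s" "x' \<in> S" | "x' = s" "x \<in> S" | "x \<in> S" "x' \<in> S" using a by blast
    then show "\<exists>u\<in>T' x. \<exists>v\<in>T' x'. E u v"
    proof cases
      case 1
      then show ?thesis using edgeC[of x'] a(3) T'S T's by auto
    next
      case 2
      then show ?thesis using edgeC[of x] adj_sym[OF a(3)] T'S T's by auto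
    next
      case 3
      then show ?thesis using T(3)[of x x'] T'S a(3) by simp
    qed
  qed
  moreover have "card (\<Union>x\<in>insert s S. T' x) \<le> ?b * ((M + 1) * card (insert s S) + ?e (insert s S))"
    unfolding un using card_Un_le[of C "\<Union>x\<in>S. T x"] cC T(4) budget by linarith
  ultimately show ?case by (intro exI[of _ T'] conjI)
qed

text \<open>Greedy placement that keeps the two sides of every tile equally filled up to r. If no
  admissible tile has room for another item, one side has more than R - r used vertices and the
  other more than R - 2r. So every admissible tile contains at least 2R - 3r used vertices, more
  than all items together.\<close>

lemma place_in_tiles:
  fixes a b :: "'i \<Rightarrow> nat" and z :: real
  assumes T: "tiling E R T" "R > 0" and I: "finite I" and ab: "\<And>i. i \<in> I \<Longrightarrow> a i \<le> r \<and> b i \<le> r"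
    and bad: "\<And>i. i \<in> I \<Longrightarrow> Bad i \<subseteq> T \<and> real (card (Bad i)) \<le> z" and r: "3 * r \<le> 2 * R"
    and room: "real (\<Sum>i\<in>I. a i + b i) < (real (card T) - z) * (2 * real R - 3 * real r)"
  shows "\<exists>X Y. (\<forall>i\<in>I. card (X i) = a i \<and> card (Y i) = b i \<and>
        (\<exists>t\<in>T - Bad i. X i \<subseteq> fst t \<and> Y i \<subseteq> snd t \<or> X i \<subseteq> snd t \<and> Y i \<subseteq> fst t)) \<and>
      (\<forall>i\<in>I. \<forall>j\<in>I. i \<noteq> j \<longrightarrow> (X i \<union> Y i) \<inter> (X j \<union> Y j) = {})"
proof -
  note TD = tilingD[OF T(1)] and Tf = tiling_finite_area[OF T]
  let ?ok = "\<lambda>X Y i. card (X i) = a i \<and> card (Y i) = b i \<and>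
        (\<exists>t\<in>T - Bad i. X i \<subseteq> fst t \<and> Y i \<subseteq> snd t \<or> X i \<subseteq> snd t \<and> Y i \<subseteq> fst t)"
  let ?used = "\<lambda>X Y J. \<Union>i\<in>J. X i \<union> Y i"
  let ?bal = "\<lambda>W t. card (W \<inter> fst t) \<le> card (W \<inter> snd t) + r \<and> card (W \<inter> snd t) \<le> card (W \<inter> fst t) + r"
  have "\<exists>X Y. (\<forall>i\<in>J. ?ok X Y i) \<and> (\<forall>i\<in>J. \<forall>j\<in>J. i \<noteq> j \<longrightarrow> (X i \<union> Y i) \<inter> (X j \<union> Y j) = {}) \<and>
      finite (?used X Y J) \<and> card (?used X Y J) \<le> (\<Sum>i\<in>J. a i + b i) \<and> (\<forall>t\<in>T. ?bal (?used X Y J) t)"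
    if "J \<subseteq> I" for J
  proof -
    have "finite J" using that I finite_subset by blast
    then show ?thesis using that
    proof (induction J rule: finite_induct)
      case empty
      then show ?case by auto
    next
      case (insert i J)
      then obtain X Y where XY0: "\<forall>i\<in>J. ?ok X Y i" "\<forall>i\<in>J. \<forall>j\<in>J. i \<noteq> j \<longrightarrow> (X i \<union> Y i) \<inter> (X j \<union> Y j) = {}"
          "finite (?used X Y J)" "card (?used X Y J) \<le> (\<Sum>i\<in>J. a i + b i)" "\<forall>t\<in>T. ?bal (?used X Y J) t"
        by auto
      define W where "W = ?used X Y J"
      note XY = XY0[folded W_def]
      have iI: "i \<in> I" using insert.prems by blast
      have "\<exists>t\<in>T - Bad i. card (W \<inter> fst t) + r \<le> R \<and> card (W \<inter> snd t) + r \<le> R"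
      proof (rule ccontr)
        assume n: "\<not> ?thesis"
        have full: "2 * R - 3 * r \<le> card (W \<inter> area t)" if t: "t \<in> T - Bad i" for t
        proof -
          have "card (W \<inter> area t) = card ((W \<inter> fst t) \<union> (W \<inter> snd t))" by (simp add: Int_Un_distrib)
          also have "\<dots> = card (W \<inter> fst t) + card (W \<inter> snd t)"
            using Tf(1,2)[of t] TD(4)[of t] t by (intro card_Un_disjoint) auto
          finally have "card (W \<inter> area t) = card (W \<inter> fst t) + card (W \<inter> snd t)" .
          moreover have "R < card (W \<inter> fst t) + r \<or> R < card (W \<inter> snd t) + r" using n t by force
          moreover have "?bal W t" using XY(5) t by simp
          ultimately show ?thesis by linarith
        qed
        have "card (T - Bad i) * (2 * R - 3 * r) = (\<Sum>t\<in>T - Bad i. 2 * R - 3 * r)" by simp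
        also have "\<dots> \<le> (\<Sum>t\<in>T - Bad i. card (W \<inter> area t))" using full by (rule sum_mono)
        also have "\<dots> = card (\<Union>t\<in>T - Bad i. W \<inter> area t)"
        proof (rule card_UN_disjoint[symmetric])
          show "\<forall>t\<in>T - Bad i. \<forall>t'\<in>T - Bad i. t \<noteq> t' \<longrightarrow> (W \<inter> area t) \<inter> (W \<inter> area t') = {}"
          proof (intro ballI impI)
            fix t t' assume "t \<in> T - Bad i" "t' \<in> T - Bad i" "t \<noteq> t'"
            then have "area t \<inter> area t' = {}" using TD(6)[of t t'] by simp
            then show "(W \<inter> area t) \<inter> (W \<inter> area t') = {}" by blast
          qed
        qed (use TD(1) XY(3) in auto)
        also have "\<dots> \<le> card W" using XY(3) by (intro card_mono) auto
        also have "\<dots> \<le> (\<Sum>i\<in>J. a i + b i)" by (rule XY(4))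
        also have "\<dots> \<le> (\<Sum>i\<in>I. a i + b i)" using insert.prems I by (intro sum_mono2) auto
        finally have "real (card (T - Bad i) * (2 * R - 3 * r)) \<le> real (\<Sum>i\<in>I. a i + b i)" by (simp only: of_nat_le_iff)
        moreover have "real (2 * R - 3 * r) = 2 * real R - 3 * real r" using r by (simp add: of_nat_diff)
        moreover have "real (card T) - z \<le> real (card (T - Bad i))"
        proof -
          have "card (T - Bad i) = card T - card (Bad i)" using bad[OF iI] TD(1) finite_subset by (metis card_Diff_subset)
          then have "real (card T) - real (card (Bad i)) \<le> real (card (T - Bad i))" by linarith
          then show ?thesis using bad[OF iI] by linarith
        qed
        moreover have "0 \<le> 2 * real R - 3 * real r" using r by linarith
        ultimately have "(real (card T) - z) * (2 * real R - 3 * real r) \<le> real (\<Sum>i\<in>I. a i + b i)"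
          using mult_right_mono[of "real (card T) - z" "real (card (T - Bad i))" "2 * real R - 3 * real r"] by simp
        then show False using room by linarith
      qed
      then obtain t where t: "t \<in> T - Bad i" "card (W \<inter> fst t) + r \<le> R" "card (W \<inter> snd t) + r \<le> R" by blast
      have tT: "t \<in> T" using t by blast
      have side: "\<exists>Z. Z \<subseteq> P - W \<and> card Z = n \<and> finite Z" if "finite P" "card P = R" "card (W \<inter> P) + r \<le> R" "n \<le> r" for P n
      proof -
        have "P - W = P - (W \<inter> P)" by blast
        then have "card (P - W) = card P - card (W \<inter> P)" using that(1) by (simp add: card_Diff_subset)
        then have "n \<le> card (P - W)" using that by linarith
        then show ?thesis by (meson obtain_subset_with_card_n)
      qed
      obtain Z1 Z2 where Z: "Z1 \<subseteq> area t - W" "Z2 \<subseteq> area t - W" "card Z1 = a i" "card Z2 = b i"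
          "finite Z1" "finite Z2" "Z1 \<subseteq> fst t \<and> Z2 \<subseteq> snd t \<or> Z1 \<subseteq> snd t \<and> Z2 \<subseteq> fst t" "?bal (W \<union> Z1 \<union> Z2) t"
      proof -
        have swap: "\<exists>Z1 Z2. Z1 \<subseteq> P - W \<and> Z2 \<subseteq> Q - W \<and> card Z1 = a i \<and> card Z2 = b i \<and> finite Z1 \<and> finite Z2 \<and>
              card ((W \<union> Z1 \<union> Z2) \<inter> P) = card (W \<inter> P) + a i \<and> card ((W \<union> Z1 \<union> Z2) \<inter> Q) = card (W \<inter> Q) + b i"
          if PQ: "finite P" "finite Q" "card P = R" "card Q = R" "P \<inter> Q = {}"
            "card (W \<inter> P) + r \<le> R" "card (W \<inter> Q) + r \<le> R" for P Q
        proof -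
          obtain Z1 where Z1: "Z1 \<subseteq> P - W" "card Z1 = a i" "finite Z1"
            using side[OF PQ(1,3,6), of "a i"] ab[OF iI] by blast
          obtain Z2 where Z2: "Z2 \<subseteq> Q - W" "card Z2 = b i" "finite Z2"
            using side[OF PQ(2,4,7), of "b i"] ab[OF iI] by blast
          have "(W \<union> Z1 \<union> Z2) \<inter> P = (W \<inter> P) \<union> Z1" using Z1 Z2 PQ(5) by blast
          moreover have "card ((W \<inter> P) \<union> Z1) = card (W \<inter> P) + card Z1" using Z1 PQ(1) by (intro card_Un_disjoint) auto
          moreover have "(W \<union> Z1 \<union> Z2) \<inter> Q = (W \<inter> Q) \<union> Z2" using Z1 Z2 PQ(5) by blast
          moreover have "card ((W \<inter> Q) \<union> Z2) = card (W \<inter> Q) + card Z2" using Z2 PQ(2) by (intro card_Un_disjoint) auto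
          ultimately show ?thesis using Z1 Z2 by (intro exI[of _ Z1] exI[of _ Z2]) simp
        qed
        \<comment> \<open>The larger of the two portions goes to the emptier side, which keeps the
          imbalance at most r. The two cases say which orientation that is.\<close>
        have bal: "?bal W t" using XY(5) tT by simp
        have sw: "snd t \<inter> fst t = {}" using TD(4)[OF tT] by blast
        show ?thesis
        proof (cases "(card (W \<inter> fst t) \<le> card (W \<inter> snd t)) = (b i \<le> a i)")
          case True
          obtain Z1 Z2 where Z: "Z1 \<subseteq> fst t - W" "Z2 \<subseteq> snd t - W" "card Z1 = a i" "card Z2 = b i" "finite Z1" "finite Z2"
              "card ((W \<union> Z1 \<union> Z2) \<inter> fst t) = card (W \<inter> fst t) + a i" "card ((W \<union> Z1 \<union> Z2) \<inter> snd t) = card (W \<inter> snd t) + b i"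
            using swap[OF Tf(1,2)[OF tT] TD(2,3,4)[OF tT] t(2,3)] by (elim exE conjE)
          have "?bal (W \<union> Z1 \<union> Z2) t" unfolding Z(7,8) using True bal ab[OF iI] by linarith
          then show ?thesis using Z(1-6) by (intro that[of Z1 Z2]) auto
        next
          case False
          obtain Z1 Z2 where Z: "Z1 \<subseteq> snd t - W" "Z2 \<subseteq> fst t - W" "card Z1 = a i" "card Z2 = b i" "finite Z1" "finite Z2"
              "card ((W \<union> Z1 \<union> Z2) \<inter> snd t) = card (W \<inter> snd t) + a i" "card ((W \<union> Z1 \<union> Z2) \<inter> fst t) = card (W \<inter> fst t) + b i"
            using swap[OF Tf(2,1)[OF tT] TD(3,2)[OF tT] sw t(3,2)] by (elim exE conjE)
          have "?bal (W \<union> Z1 \<union> Z2) t" unfolding Z(7,8) using False bal ab[OF iI] by linarith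
          then show ?thesis using Z(1-6) by (intro that[of Z1 Z2]) auto
        qed
      qed
      define X' where "X' = X(i := Z1)"
      define Y' where "Y' = Y(i := Z2)"
      have old: "X' x = X x" "Y' x = Y x" if "x \<in> J" for x using that insert.hyps unfolding X'_def Y'_def by auto
      have new: "X' i = Z1" "Y' i = Z2" unfolding X'_def Y'_def by auto
      have used': "?used X' Y' (insert i J) = W \<union> Z1 \<union> Z2"
      proof -
        have "?used X' Y' J = W" using old unfolding W_def by auto
        then show ?thesis using new by auto
      qed
      have JW: "X x \<union> Y x \<subseteq> W" if "x \<in> J" for x using that unfolding W_def by blast
      have "\<forall>x\<in>insert i J. ?ok X' Y' x"
      proof
        fix x assume "x \<in> insert i J"
        then show "?ok X' Y' x"
        proof
          assume "x = i"
          then show ?thesis using new Z(3,4,7) t(1) by auto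
        next
          assume "x \<in> J"
          then show ?thesis using XY(1) old by simp
        qed
      qed
      moreover have "\<forall>x\<in>insert i J. \<forall>y\<in>insert i J. x \<noteq> y \<longrightarrow> (X' x \<union> Y' x) \<inter> (X' y \<union> Y' y) = {}"
      proof (intro ballI impI)
        fix x y assume "x \<in> insert i J" "y \<in> insert i J" "x \<noteq> y"
        then consider "x = i" "y \<in> J" | "y = i" "x \<in> J" | "x \<in> J" "y \<in> J" by blast
        then show "(X' x \<union> Y' x) \<inter> (X' y \<union> Y' y) = {}"
        proof cases
          case 1
          then show ?thesis using Z(1,2) JW[of y] old[of y] new by blast
        next
          case 2
          then show ?thesis using Z(1,2) JW[of x] old[of x] new by blast
        next
          case 3
          then show ?thesis using XY(2) old \<open>x \<noteq> y\<close> by simp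
        qed
      qed
      moreover have "finite (?used X' Y' (insert i J))" unfolding used' using XY(3) Z(5,6) by blast
      moreover have "card (?used X' Y' (insert i J)) \<le> (\<Sum>x\<in>insert i J. a x + b x)"
      proof -
        have "card (W \<union> Z1 \<union> Z2) \<le> card W + card Z1 + card Z2"
          using card_Un_le[of "W \<union> Z1" Z2] card_Un_le[of W Z1] by linarith
        then show ?thesis unfolding used' using XY(4) Z(3,4) insert.hyps by simp
      qed
      moreover have "\<forall>u\<in>T. ?bal (?used X' Y' (insert i J)) u"
      proof
        fix u assume u: "u \<in> T"
        show "?bal (?used X' Y' (insert i J)) u"
        proof (cases "u = t")
          case True
          then show ?thesis unfolding used' using Z(8) by simp
        next
          case False
          then have "area u \<inter> area t = {}" using TD(6)[OF u tT] by simp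
          then have "(W \<union> Z1 \<union> Z2) \<inter> fst u = W \<inter> fst u" "(W \<union> Z1 \<union> Z2) \<inter> snd u = W \<inter> snd u" using Z(1,2) by blast+
          then show ?thesis unfolding used' using XY(5) u by simp
        qed
      qed
      ultimately show ?case by (rule_tac exI[of _ X'], rule_tac exI[of _ Y']) (intro conjI)
    qed
  qed
  from this[of I] show ?thesis by blast
qed

text \<open>The vertices of the separator \<open>S\<close> get small dominating branch sets. In a tile, a vertex of one of
  the two independent sets \<open>A\<close>, \<open>B\<close> occupies one vertex on the corresponding side, and every other
  vertex occupies an edge; so a part \<open>Q\<close> needs \<open>card (Q - B) + card (Q - A)\<close> vertices.\<close>

lemma embed_in_host:
  fixes K :: "'a sgraph" and F :: "'b sgraph" and k r R M D :: nat and \<delta> \<gamma> \<zeta> :: real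
  assumes host: "is_host K k \<delta> \<gamma>" and k: "k > 0" and \<delta>: "0 < \<delta>" "\<delta> \<le> 1 / 20"
    and F: "simple_graph F" and AB: "indep_set F A" "indep_set F B" "A \<inter> B = {}"
    and S: "S \<subseteq> verts F" "parts_of (adj F) (verts F - S) r \<Q>"
    and D: "\<And>Q. Q \<in> \<Q> \<Longrightarrow> card {s \<in> S. \<exists>x\<in>Q. adj F s x} \<le> D"
    and M: "(15 / 16) ^ M \<le> \<zeta>" "\<zeta> * 16 < 1"
    and w: "real (52 * ((M + 1) * card S + card {e \<in> edges F. e \<subseteq> S})) \<le> min \<gamma> \<delta> * real k"
    and R: "R > 0" "3 * real r \<le> \<delta> * (2 * real R)" "8 * real D * \<zeta> * real R \<le> \<delta>"
    and tiles: "\<And>V'. V' \<subseteq> verts K \<Longrightarrow> real (card (verts K - V')) \<le> \<delta> * real k \<Longrightarrow>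
      \<exists>T. tiling (adj K) R T \<and> (\<Union>t\<in>T. area t) \<subseteq> V' \<and> (1 - 3 * \<delta>) * real k \<le> real R * real (card T)"
    and m: "2 * real (card (verts F)) - real (card (A \<union> B)) \<le> (1 - 6 * \<delta>) * (2 * real k)"
  shows "\<exists>\<phi>. minor_model K F \<phi>"
proof -
  let ?V = "verts K" and ?E = "adj K"
  have K: "simple_graph K" "2 * (1 - \<delta>) * real k \<le> real (card ?V)" "card ?V \<le> 8 * k"
      "\<And>v. v \<in> ?V \<Longrightarrow> (1 - \<delta>) * real k \<le> real (card (nbrs K v))"
      "\<And>X. X \<subseteq> ?V \<Longrightarrow> real (card X) \<le> \<gamma> * real k \<Longrightarrow> conn ?E (?V - X)"
    using host unfolding is_host_def by simp_all
  have fK: "finite ?V" using finite_simple_graph[OF K(1)] by blast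
  have fF: "finite (verts F)" using finite_simple_graph[OF F] by blast
  have fS: "finite S" using S(1) fF finite_subset by blast
  have k0: "real k > 0" using k by simp
  have Kne: "?V \<noteq> {}"
  proof
    assume "?V = {}"
    then have "2 * (1 - \<delta>) * real k \<le> 0" using K(2) by simp
    moreover have "0 < 2 * (1 - \<delta>) * real k" using \<delta> k0 by (intro mult_pos_pos) auto
    ultimately show False by linarith
  qed
  have \<zeta>0: "0 \<le> \<zeta>" using M(1) zero_le_power[of "15 / 16 :: real" M] by linarith
  \<comment> \<open>Half of the degree is set aside: with d = k / 2 the order is at most 8 k = 16 d.
    Hence q = 16, which explains the ratio 15 / 16 and the factor 52 = 3 * 16 + 4.\<close>
  have "\<exists>T. (\<forall>s\<in>S. T s \<subseteq> ?V \<and> T s \<noteq> {} \<and> conn ?E (T s) \<and> real (card (undominated ?E ?V (T s))) \<le> \<zeta> * real (card ?V)) \<and>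
     (\<forall>s\<in>S. \<forall>s'\<in>S. s \<noteq> s' \<longrightarrow> T s \<inter> T s' = {}) \<and>
     (\<forall>s\<in>S. \<forall>s'\<in>S. adj F s s' \<longrightarrow> (\<exists>u\<in>T s. \<exists>v\<in>T s'. ?E u v)) \<and>
     card (\<Union>s\<in>S. T s) \<le> (3 * 16 + 4) * ((M + 1) * card S + card {e \<in> edges F. e \<subseteq> S})"
  proof (rule dominating_branch_sets[where d = "real k / 2" and w = "min \<gamma> \<delta> * real k", OF F fS fK symp_adj])
    show "real (card ?V) \<le> real 16 * (real k / 2)" using K(3) by simp
    show "conn ?E (?V - X)" if "X \<subseteq> ?V" "real (card X) \<le> min \<gamma> \<delta> * real k" for X
    proof (rule K(5)[OF that(1)])
      have "min \<gamma> \<delta> * real k \<le> \<gamma> * real k" using k0 by (intro mult_right_mono) auto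
      then show "real (card X) \<le> \<gamma> * real k" using that(2) by linarith
    qed
    show "real k / 2 + min \<gamma> \<delta> * real k \<le> real (card {y \<in> ?V. ?E v y})" if "v \<in> ?V" for v
    proof -
      have "{y \<in> ?V. ?E v y} = nbrs K v" using nbrs_subset[OF K(1), of v] unfolding nbrs_def by blast
      moreover have "min \<gamma> \<delta> * real k \<le> \<delta> * real k" using k0 by (intro mult_right_mono) auto
      moreover have "real k / 2 + \<delta> * real k \<le> (1 - \<delta>) * real k"
      proof -
        have "(1 / 2 + \<delta>) * real k \<le> (1 - \<delta>) * real k" using \<delta> k0 by (intro mult_right_mono) auto
        then show ?thesis by (simp add: algebra_simps)
      qed
      ultimately show ?thesis using K(4)[OF that] by simp
    qed
    show "(1 - 1 / real 16) ^ M \<le> \<zeta>" using M(1) by simp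
    show "real ((3 * 16 + 4) * ((M + 1) * card S + card {e \<in> edges F. e \<subseteq> S})) \<le> min \<gamma> \<delta> * real k" using w by simp
  qed (use k0 M(2) Kne in auto)
  then obtain Br where Br0: "\<forall>s\<in>S. Br s \<subseteq> ?V \<and> Br s \<noteq> {} \<and> conn ?E (Br s) \<and> real (card (undominated ?E ?V (Br s))) \<le> \<zeta> * real (card ?V)"
     "\<forall>s\<in>S. \<forall>s'\<in>S. s \<noteq> s' \<longrightarrow> Br s \<inter> Br s' = {}"
     "\<forall>s\<in>S. \<forall>s'\<in>S. adj F s s' \<longrightarrow> (\<exists>u\<in>Br s. \<exists>v\<in>Br s'. ?E u v)"
     "card (\<Union>s\<in>S. Br s) \<le> (3 * 16 + 4) * ((M + 1) * card S + card {e \<in> edges F. e \<subseteq> S})"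
    by (elim exE conjE)
  have Br: "Br s \<subseteq> ?V" "Br s \<noteq> {}" "conn ?E (Br s)" "real (card (undominated ?E ?V (Br s))) \<le> \<zeta> * real (card ?V)" if "s \<in> S" for s
    using Br0(1) that by simp_all
  have Brd: "Br s \<inter> Br s' = {}" if "s \<in> S" "s' \<in> S" "s \<noteq> s'" for s s' using Br0(2) that by simp
  have Bre: "\<exists>u\<in>Br s. \<exists>v\<in>Br s'. ?E u v" if "s \<in> S" "s' \<in> S" "adj F s s'" for s s' using Br0(3) that by simp
  let ?U = "\<Union>s\<in>S. Br s"
  have UV: "?U \<subseteq> ?V" using Br(1) by blast
  have "real (card ?U) \<le> \<delta> * real k"
  proof -
    have "real (card ?U) \<le> real (52 * ((M + 1) * card S + card {e \<in> edges F. e \<subseteq> S}))"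
      using Br0(4) unfolding of_nat_le_iff by simp
    also have "\<dots> \<le> min \<gamma> \<delta> * real k" by (rule w)
    also have "\<dots> \<le> \<delta> * real k" using k0 by (intro mult_right_mono) auto
    finally show ?thesis .
  qed
  moreover have "?V - (?V - ?U) = ?U" using UV by blast
  ultimately have "real (card (?V - (?V - ?U))) \<le> \<delta> * real k" by simp
  from tiles[OF Diff_subset this] obtain T where T: "tiling ?E R T" "(\<Union>t\<in>T. area t) \<subseteq> ?V - ?U"
      "(1 - 3 * \<delta>) * real k \<le> real R * real (card T)" by blast
  note TD = tilingD[OF T(1)] and Tf = tiling_finite_area[OF T(1) R(1)]
  have Q: "\<Union>\<Q> = verts F - S" "\<And>Q. Q \<in> \<Q> \<Longrightarrow> card Q \<le> r"
      "\<And>P Q x y. P \<in> \<Q> \<Longrightarrow> Q \<in> \<Q> \<Longrightarrow> P \<noteq> Q \<Longrightarrow> P \<inter> Q = {}"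
      "\<And>P Q x y. P \<in> \<Q> \<Longrightarrow> Q \<in> \<Q> \<Longrightarrow> P \<noteq> Q \<Longrightarrow> x \<in> P \<Longrightarrow> y \<in> Q \<Longrightarrow> \<not> adj F x y"
    using S(2) unfolding parts_of_def by simp_all
  have fQs: "finite \<Q>" using Q(1) fF by (metis finite_Diff finite_UnionD)
  have QF: "Q \<subseteq> verts F" "finite Q" if "Q \<in> \<Q>" for Q
  proof -
    show "Q \<subseteq> verts F" using Q(1) that by blast
    then show "finite Q" using fF finite_subset by blast
  qed
  let ?N = "\<lambda>Q. {s \<in> S. \<exists>x\<in>Q. adj F s x}"
  let ?undom = "\<lambda>s. undominated ?E ?V (Br s)"
  \<comment> \<open>Tiles containing a vertex not dominated by some separator neighbour of Q. Tiles
    are disjoint, so an undominated vertex spoils at most one tile; with at most D neighbours this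
    makes at most D \<open>\<zeta>\<close> 8 k bad tiles.\<close>
  define Bad where "Bad = (\<lambda>Q. {t \<in> T. area t \<inter> (\<Union>s\<in>?N Q. ?undom s) \<noteq> {}})"
  define z where "z = real D * (\<zeta> * (8 * real k))"
  have bad: "Bad Q \<subseteq> T \<and> real (card (Bad Q)) \<le> z" if Qin: "Q \<in> \<Q>" for Q
  proof
    show BT: "Bad Q \<subseteq> T" unfolding Bad_def by blast
    let ?W = "\<Union>s\<in>?N Q. ?undom s"
    have fW: "finite ?W" by (rule finite_subset[OF _ fK]) (auto simp: undominated_def)
    have "\<forall>t\<in>Bad Q. \<exists>v. v \<in> area t \<inter> ?W" unfolding Bad_def by blast
    from bchoice[OF this] obtain f where f: "\<forall>t\<in>Bad Q. f t \<in> area t \<inter> ?W" ..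
    have "inj_on f (Bad Q)"
    proof (rule inj_onI, rule ccontr)
      fix t t' assume t: "t \<in> Bad Q" "t' \<in> Bad Q" "f t = f t'" "t \<noteq> t'"
      then have "area t \<inter> area t' = {}" using TD(6)[of t t'] BT by blast
      moreover have "f t \<in> area t" "f t \<in> area t'" using f t by auto
      ultimately show False by blast
    qed
    moreover have "f ` Bad Q \<subseteq> ?W" using f by blast
    ultimately have "card (Bad Q) \<le> card ?W" using fW by (rule card_inj_on_le)
    also have "\<dots> \<le> (\<Sum>s\<in>?N Q. card (?undom s))" using fS by (intro card_UN_le) simp
    finally have "real (card (Bad Q)) \<le> (\<Sum>s\<in>?N Q. real (card (?undom s)))"
      unfolding of_nat_sum[symmetric] of_nat_le_iff .
    also have "\<dots> \<le> (\<Sum>s\<in>?N Q. \<zeta> * (8 * real k))"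
    proof (rule sum_mono)
      fix s assume "s \<in> ?N Q"
      then have "real (card (?undom s)) \<le> \<zeta> * real (card ?V)" using Br(4)[of s] by simp
      also have "\<dots> \<le> \<zeta> * (8 * real k)" using K(3) \<zeta>0 by (intro mult_left_mono) auto
      finally show "real (card (?undom s)) \<le> \<zeta> * (8 * real k)" .
    qed
    also have "\<dots> = real (card (?N Q)) * (\<zeta> * (8 * real k))" by simp
    also have "\<dots> \<le> z" unfolding z_def using D[OF Qin] \<zeta>0 k0 by (intro mult_right_mono) auto
    finally show "real (card (Bad Q)) \<le> z" .
  qed
  have sumle: "(\<Sum>Q\<in>\<Q>. card (Q - Z)) \<le> card (verts F) - card Z" if "Z \<subseteq> verts F" for Z
  proof -
    have "(\<Sum>Q\<in>\<Q>. card (Q - Z)) = card (\<Union>Q\<in>\<Q>. Q - Z)"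
    proof (rule card_UN_disjoint[symmetric, OF fQs])
      show "\<forall>Q\<in>\<Q>. finite (Q - Z)" using QF(2) by simp
      show "\<forall>Q\<in>\<Q>. \<forall>Q'\<in>\<Q>. Q \<noteq> Q' \<longrightarrow> (Q - Z) \<inter> (Q' - Z) = {}" using Q(3) by blast
    qed
    also have "\<dots> \<le> card (verts F - Z)" using QF(1) fF by (intro card_mono) auto
    also have "\<dots> = card (verts F) - card Z" using that fF finite_subset by (intro card_Diff_subset) auto
    finally show ?thesis .
  qed
  have ABF: "A \<subseteq> verts F" "B \<subseteq> verts F" using AB unfolding indep_set_def by auto
  have fAB: "finite A" "finite B" using ABF fF finite_subset by blast+
  have cAB: "card (A \<union> B) = card A + card B" "card A \<le> card (verts F)" "card B \<le> card (verts F)"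
    using fAB AB(3) ABF fF by (auto intro: card_Un_disjoint card_mono)
  have Tz: "(1 - 4 * \<delta>) * real k \<le> real R * (real (card T) - z)"
  proof -
    have "real R * z = (8 * real D * \<zeta> * real R) * real k" unfolding z_def by simp
    also have "\<dots> \<le> \<delta> * real k" using R(3) k0 by (intro mult_right_mono) auto
    finally show ?thesis using T(3) by (simp add: algebra_simps)
  qed
  \<comment> \<open>The parts need at most 2 card (verts F) - card (A \<open>\<union>\<close> B)
    vertices. Against a budget of (1 - 6 \<open>\<delta>\<close>) 2 k, the uncovered vertices and
    bad tiles cost 4 \<open>\<delta>\<close>, the unusable rest 3 r of a tile costs a factor 1 -
    \<open>\<delta>\<close>, and the remaining \<open>\<delta>\<close> makes the inequality
    strict.\<close>
  have room: "real (\<Sum>Q\<in>\<Q>. card (Q - B) + card (Q - A)) < (real (card T) - z) * (2 * real R - 3 * real r)"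
  proof -
    have "(\<Sum>Q\<in>\<Q>. card (Q - B) + card (Q - A)) \<le> (card (verts F) - card B) + (card (verts F) - card A)"
      using sumle[OF ABF(1)] sumle[OF ABF(2)] by (simp add: sum.distrib)
    then have "real (\<Sum>Q\<in>\<Q>. card (Q - B) + card (Q - A)) \<le> real ((card (verts F) - card B) + (card (verts F) - card A))"
      by (simp only: of_nat_le_iff)
    also have "\<dots> = 2 * real (card (verts F)) - real (card (A \<union> B))" using cAB by (simp add: of_nat_diff)
    also have "\<dots> \<le> (1 - 6 * \<delta>) * (2 * real k)" by (rule m)
    also have "\<dots> < (1 - 5 * \<delta>) * (2 * real k)" using \<delta> k0 by (intro mult_strict_right_mono) auto
    also have "\<dots> \<le> ((1 - 4 * \<delta>) * real k) * (2 * (1 - \<delta>))"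
    proof -
      have "1 - 5 * \<delta> \<le> (1 - 4 * \<delta>) * (1 - \<delta>)" using \<delta> by (simp add: algebra_simps)
      then have "(1 - 5 * \<delta>) * (2 * real k) \<le> ((1 - 4 * \<delta>) * (1 - \<delta>)) * (2 * real k)" using k0 by (intro mult_right_mono) auto
      then show ?thesis by (simp add: algebra_simps)
    qed
    also have "\<dots> \<le> (real R * (real (card T) - z)) * (2 * (1 - \<delta>))" using Tz \<delta> by (intro mult_right_mono) auto
    also have "\<dots> = (real (card T) - z) * ((1 - \<delta>) * (2 * real R))" by simp
    also have "\<dots> \<le> (real (card T) - z) * (2 * real R - 3 * real r)"
    proof (rule mult_left_mono)
      show "(1 - \<delta>) * (2 * real R) \<le> 2 * real R - 3 * real r" using R(2) by (simp add: algebra_simps)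
      have "0 \<le> (1 - 4 * \<delta>) * real k" using \<delta> k0 by (intro mult_nonneg_nonneg) auto
      then have "0 \<le> real R * (real (card T) - z)" using Tz by linarith
      then show "0 \<le> real (card T) - z" using R(1) by (simp add: zero_le_mult_iff)
    qed
    finally show ?thesis .
  qed
  have rR: "3 * r \<le> 2 * R"
  proof -
    have "\<delta> * (2 * real R) \<le> 1 * (2 * real R)" using \<delta> by (intro mult_right_mono) auto
    then show ?thesis using R(2) by linarith
  qed
  have small: "card (Q - B) \<le> r \<and> card (Q - A) \<le> r" if "Q \<in> \<Q>" for Q
    using Q(2)[OF that] card_mono[OF QF(2)[OF that], of "Q - B"] card_mono[OF QF(2)[OF that], of "Q - A"] by auto
  have "\<exists>X Y. (\<forall>Q\<in>\<Q>. card (X Q) = card (Q - B) \<and> card (Y Q) = card (Q - A) \<and>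
        (\<exists>t\<in>T - Bad Q. X Q \<subseteq> fst t \<and> Y Q \<subseteq> snd t \<or> X Q \<subseteq> snd t \<and> Y Q \<subseteq> fst t)) \<and>
      (\<forall>Q\<in>\<Q>. \<forall>Q'\<in>\<Q>. Q \<noteq> Q' \<longrightarrow> (X Q \<union> Y Q) \<inter> (X Q' \<union> Y Q') = {})"
    by (rule place_in_tiles[OF T(1) R(1) fQs _ _ rR room]) (fact small bad)+
  then obtain X Y where XY0: "\<forall>Q\<in>\<Q>. card (X Q) = card (Q - B) \<and> card (Y Q) = card (Q - A) \<and>
        (\<exists>t\<in>T - Bad Q. X Q \<subseteq> fst t \<and> Y Q \<subseteq> snd t \<or> X Q \<subseteq> snd t \<and> Y Q \<subseteq> fst t)"
      "\<forall>Q\<in>\<Q>. \<forall>Q'\<in>\<Q>. Q \<noteq> Q' \<longrightarrow> (X Q \<union> Y Q) \<inter> (X Q' \<union> Y Q') = {}"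
    by (elim exE conjE)
  have XY: "\<exists>t\<in>T - Bad Q. X Q \<subseteq> fst t \<and> Y Q \<subseteq> snd t \<or> X Q \<subseteq> snd t \<and> Y Q \<subseteq> fst t" if "Q \<in> \<Q>" for Q
    using XY0(1) that by simp
  have XYd: "(X Q \<union> Y Q) \<inter> (X Q' \<union> Y Q') = {}" if "Q \<in> \<Q>" "Q' \<in> \<Q>" "Q \<noteq> Q'" for Q Q' using XY0(2) that by simp
  have XYt: "X Q \<union> Y Q \<subseteq> ?V - ?U" "X Q \<inter> Y Q = {}" "finite (X Q)" "finite (Y Q)" if Qin: "Q \<in> \<Q>" for Q
  proof -
    obtain t where t: "t \<in> T - Bad Q" "X Q \<subseteq> fst t \<and> Y Q \<subseteq> snd t \<or> X Q \<subseteq> snd t \<and> Y Q \<subseteq> fst t" using XY[OF Qin] by blast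
    have "area t \<subseteq> ?V - ?U" using T(2) t(1) by blast
    then show "X Q \<union> Y Q \<subseteq> ?V - ?U" using t(2) by blast
    have "fst t \<inter> snd t = {}" using TD(4) t(1) by blast
    then show "X Q \<inter> Y Q = {}" using t(2) by blast
    show "finite (X Q)" "finite (Y Q)" using Tf(1,2)[of t] t finite_subset by blast+
  qed
  have XYe: "?E x y" if xy: "Q \<in> \<Q>" "x \<in> X Q" "y \<in> Y Q" for Q x y
  proof -
    obtain t where t: "t \<in> T - Bad Q" "X Q \<subseteq> fst t \<and> Y Q \<subseteq> snd t \<or> X Q \<subseteq> snd t \<and> Y Q \<subseteq> fst t" using XY[OF xy(1)] by blast
    have e: "?E u v" if "u \<in> fst t" "v \<in> snd t" for u v using TD(5)[of t u v] t(1) that by blast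
    show ?thesis using t(2) e[of x y] adj_sym[OF e[of y x]] xy(2,3) by blast
  qed
  have XYs: "\<exists>u\<in>Br s. ?E x u" if h: "Q \<in> \<Q>" "s \<in> S" "y \<in> Q" "adj F s y" "x \<in> X Q \<union> Y Q" for Q s x y
  proof -
    obtain t where t: "t \<in> T" "t \<notin> Bad Q" "x \<in> area t" using XY[OF h(1)] h(5) by blast
    have "s \<in> ?N Q" using h by blast
    then have "x \<notin> undominated ?E ?V (Br s)" using t unfolding Bad_def by blast
    moreover have "x \<in> ?V" using XYt(1)[OF h(1)] h(5) by blast
    ultimately show ?thesis unfolding undominated_def by blast
  qed
  have "\<forall>Q\<in>\<Q>. \<exists>g. bij_betw g (Q - B) (X Q)" using XY0(1) QF(2) XYt(3) by (simp add: finite_same_card_bij)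
  from bchoice[OF this] obtain \<alpha> where \<alpha>: "\<forall>Q\<in>\<Q>. bij_betw (\<alpha> Q) (Q - B) (X Q)" ..
  have "\<forall>Q\<in>\<Q>. \<exists>g. bij_betw g (Q - A) (Y Q)" using XY0(1) QF(2) XYt(4) by (simp add: finite_same_card_bij)
  from bchoice[OF this] obtain \<beta> where \<beta>: "\<forall>Q\<in>\<Q>. bij_betw (\<beta> Q) (Q - A) (Y Q)" ..
  have \<alpha>X: "\<alpha> Q x \<in> X Q" if "Q \<in> \<Q>" "x \<in> Q" "x \<notin> B" for Q x
    using \<alpha> that by (meson DiffI bij_betwE)
  have \<beta>Y: "\<beta> Q x \<in> Y Q" if "Q \<in> \<Q>" "x \<in> Q" "x \<notin> A" for Q x
    using \<beta> that by (meson DiffI bij_betwE)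
  have \<alpha>inj: "\<alpha> Q x \<noteq> \<alpha> Q y" if "Q \<in> \<Q>" "x \<in> Q - B" "y \<in> Q - B" "x \<noteq> y" for Q x y
    using \<alpha> that by (metis bij_betw_imp_inj_on inj_onD)
  have \<beta>inj: "\<beta> Q x \<noteq> \<beta> Q y" if "Q \<in> \<Q>" "x \<in> Q - A" "y \<in> Q - A" "x \<noteq> y" for Q x y
    using \<beta> that by (metis bij_betw_imp_inj_on inj_onD)
  have "\<forall>x\<in>verts F - S. \<exists>Q. Q \<in> \<Q> \<and> x \<in> Q" using Q(1) by blast
  from bchoice[OF this] obtain p where p0: "\<forall>x\<in>verts F - S. p x \<in> \<Q> \<and> x \<in> p x" ..
  have p: "p x \<in> \<Q>" "x \<in> p x" if "x \<in> verts F" "x \<notin> S" for x using p0 that by auto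
  \<comment> \<open>A vertex of A gets only a vertex on the X side, a vertex of B only one on the Y
    side, and every other vertex an edge between the sides.\<close>
  define \<phi> where "\<phi> = (\<lambda>x. if x \<in> S then Br x else (if x \<in> B then {} else {\<alpha> (p x) x}) \<union> (if x \<in> A then {} else {\<beta> (p x) x}))"
  have \<phi>S: "\<phi> x = Br x" if "x \<in> S" for x using that unfolding \<phi>_def by simp
  have \<phi>sub: "\<phi> x \<subseteq> X (p x) \<union> Y (p x)" if "x \<in> verts F" "x \<notin> S" for x
    using that \<alpha>X[OF p[OF that]] \<beta>Y[OF p[OF that]] unfolding \<phi>_def by auto
  have \<phi>ne: "\<phi> x \<noteq> {}" if "x \<notin> S" for x using that AB(3) unfolding \<phi>_def by auto
  have "minor_model K F \<phi>"
  proof (rule minor_modelI)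
    fix x assume x: "x \<in> verts F"
    show "\<phi> x \<subseteq> ?V"
    proof (cases "x \<in> S")
      case True
      then show ?thesis using Br(1) \<phi>S by simp
    next
      case False
      then show ?thesis using \<phi>sub[OF x False] XYt(1)[OF p(1)[OF x False]] by blast
    qed
    show "\<phi> x \<noteq> {}" using Br(2) \<phi>S \<phi>ne by (cases "x \<in> S") simp_all
    show "conn ?E (\<phi> x)"
    proof (cases "x \<in> S")
      case True
      then show ?thesis using Br(3) \<phi>S by simp
    next
      case False
      note px = p[OF x False]
      show ?thesis
      proof (cases "x \<in> A \<or> x \<in> B")
        case True
        then show ?thesis using False AB(3) unfolding \<phi>_def by auto
      next
        case nAB: False
        have "?E (\<alpha> (p x) x) (\<beta> (p x) x)" using XYe[OF px(1)] \<alpha>X[OF px] \<beta>Y[OF px] nAB by blast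
        moreover have "\<phi> x = {\<alpha> (p x) x, \<beta> (p x) x}" using False nAB unfolding \<phi>_def by auto
        ultimately show ?thesis using conn_edge[of ?E] adj_sym by metis
      qed
    qed
  next
    fix x y assume xy: "x \<in> verts F" "y \<in> verts F" "x \<noteq> y"
    have SQ: "\<phi> u \<inter> \<phi> v = {}" if "u \<in> S" "v \<in> verts F" "v \<notin> S" for u v
      using \<phi>S[OF that(1)] \<phi>sub[OF that(2,3)] XYt(1)[OF p(1)[OF that(2,3)]] that(1) by blast
    show "\<phi> x \<inter> \<phi> y = {}"
    proof (cases "x \<in> S")
      case xS: True
      show ?thesis
      proof (cases "y \<in> S")
        case True
        then show ?thesis using Brd[OF xS True xy(3)] \<phi>S xS by simp
      next
        case False
        then show ?thesis using SQ[OF xS xy(2)] by blast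
      qed
    next
      case xS: False
      show ?thesis
      proof (cases "y \<in> S")
        case True
        then show ?thesis using SQ[OF True xy(1) xS] by blast
      next
        case yS: False
        note px = p[OF xy(1) xS] and py = p[OF xy(2) yS]
        show ?thesis
        proof (cases "p x = p y")
          case False
          then show ?thesis using XYd[OF px(1) py(1)] \<phi>sub[OF xy(1) xS] \<phi>sub[OF xy(2) yS] by blast
        next
          case True
          have y': "y \<in> p x" using py(2) True by simp
          have aa: "\<alpha> (p x) x \<noteq> \<alpha> (p x) y" if "x \<notin> B" "y \<notin> B" using \<alpha>inj[OF px(1)] px(2) y' that xy(3) by simp
          have bb: "\<beta> (p x) x \<noteq> \<beta> (p x) y" if "x \<notin> A" "y \<notin> A" using \<beta>inj[OF px(1)] px(2) y' that xy(3) by simp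
          have ab: "\<alpha> (p x) u \<noteq> \<beta> (p x) v" if "u \<in> p x" "v \<in> p x" "u \<notin> B" "v \<notin> A" for u v
            using \<alpha>X[OF px(1) that(1,3)] \<beta>Y[OF px(1) that(2,4)] XYt(2)[OF px(1)] by (metis disjoint_iff)
          have "\<phi> y = (if y \<in> B then {} else {\<alpha> (p x) y}) \<union> (if y \<in> A then {} else {\<beta> (p x) y})"
            using yS True unfolding \<phi>_def by simp
          moreover have "\<phi> x = (if x \<in> B then {} else {\<alpha> (p x) x}) \<union> (if x \<in> A then {} else {\<beta> (p x) x})"
            using xS unfolding \<phi>_def by simp
          ultimately show ?thesis
            using aa bb ab[OF px(2) y'] ab[OF y' px(2)] by (simp split: if_splits)
        qed
      qed
    qed
  next
    fix x y assume xy: "x \<in> verts F" "y \<in> verts F" "adj F x y"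
    have SQ: "\<exists>u\<in>\<phi> u'. \<exists>v\<in>\<phi> v'. ?E u v \<and> ?E v u" if h: "u' \<in> S" "v' \<in> verts F" "v' \<notin> S" "adj F u' v'" for u' v'
    proof -
      note pv = p[OF h(2,3)]
      obtain v where v: "v \<in> \<phi> v'" using \<phi>ne[OF h(3)] by blast
      then have "v \<in> X (p v') \<union> Y (p v')" using \<phi>sub[OF h(2,3)] by blast
      from XYs[OF pv(1) h(1) pv(2) h(4) this] obtain u where "u \<in> Br u'" "?E v u" by blast
      then show ?thesis using v \<phi>S[OF h(1)] adj_sym[of K v u] by blast
    qed
    show "\<exists>u\<in>\<phi> x. \<exists>v\<in>\<phi> y. ?E u v"
    proof (cases "x \<in> S")
      case xS: True
      show ?thesis
      proof (cases "y \<in> S")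
        case True
        then show ?thesis using Bre[OF xS True xy(3)] \<phi>S xS by simp
      next
        case False
        then show ?thesis using SQ[OF xS xy(2) False xy(3)] by blast
      qed
    next
      case xS: False
      show ?thesis
      proof (cases "y \<in> S")
        case True
        then show ?thesis using SQ[OF True xy(1) xS adj_sym[OF xy(3)]] by blast
      next
        case yS: False
        note px = p[OF xy(1) xS] and py = p[OF xy(2) yS]
        have "p x = p y" using Q(4)[OF px(1) py(1) _ px(2) py(2)] xy(3) by blast
        then have y': "y \<in> p x" using py(2) by simp
        \<comment> \<open>Adjacent vertices are neither both in A nor both in B. Hence one of them
          has a representative on the X side and the other one on the Y side, and these are adjacent
          in the tile.\<close>
        have nA: "\<not> (x \<in> A \<and> y \<in> A)" and nB: "\<not> (x \<in> B \<and> y \<in> B)"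
          using AB(1,2) xy(3) unfolding indep_set_def adj_def by blast+
        show ?thesis
        proof (cases "x \<notin> B \<and> y \<notin> A")
          case True
          then have "?E (\<alpha> (p x) x) (\<beta> (p x) y)" using XYe[OF px(1)] \<alpha>X[OF px] \<beta>Y[OF px(1) y'] by blast
          moreover have "\<alpha> (p x) x \<in> \<phi> x" "\<beta> (p x) y \<in> \<phi> y" using True xS yS \<open>p x = p y\<close> unfolding \<phi>_def by auto
          ultimately show ?thesis by blast
        next
          case False
          then have xy': "x \<notin> A" "y \<notin> B" using nA nB AB(3) by blast+
          then have "?E (\<alpha> (p x) y) (\<beta> (p x) x)" using XYe[OF px(1)] \<alpha>X[OF px(1) y'] \<beta>Y[OF px] by blast
          then have "?E (\<beta> (p x) x) (\<alpha> (p x) y)" by (rule adj_sym)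
          moreover have "\<beta> (p x) x \<in> \<phi> x" "\<alpha> (p x) y \<in> \<phi> y" using xy' xS yS \<open>p x = p y\<close> unfolding \<phi>_def by auto
          ultimately show ?thesis by blast
        qed
      qed
    qed
  qed
  then show ?thesis by blast
qed

section \<open>The upper bound\<close>

lemma alpha2_witness:
  assumes "simple_graph F"
  obtains A B where "indep_set F A" "indep_set F B" "A \<inter> B = {}" "card (A \<union> B) = alpha2 F"
proof -
  let ?T = "{card (A \<union> B) | A B. indep_set F A \<and> indep_set F B}"
  have "finite ?T"
    by (rule finite_subset[of _ "{..card (verts F)}"])
      (use finite_simple_graph[OF assms] in \<open>auto simp: indep_set_def intro!: card_mono\<close>)
  moreover have "?T \<noteq> {}" by (auto intro!: exI[of _ "{}"] simp: indep_set_def)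
  ultimately have "Max ?T \<in> ?T" by (rule Max_in)
  then obtain A B where AB: "indep_set F A" "indep_set F B" "card (A \<union> B) = alpha2 F"
    unfolding alpha2_def by auto
  have "indep_set F (B - A)" using AB(2) unfolding indep_set_def by blast
  then show ?thesis using that[of A "B - A"] AB by auto
qed

lemma alpha2_le:
  assumes "simple_graph F"
  shows "alpha2 F \<le> card (verts F)"
proof -
  obtain A B where "indep_set F A" "indep_set F B" "card (A \<union> B) = alpha2 F" using alpha2_witness[OF assms] by metis
  moreover from this have "A \<union> B \<subseteq> verts F" unfolding indep_set_def by blast
  ultimately show ?thesis using card_mono[OF finite_simple_graph(1)[OF assms]] by metis
qed

text \<open>\<open>tile_cover\<close> is applied with a = (1 - 2 \<open>\<delta>\<close>) k: the
  host has minimum degree (1 - \<open>\<delta>\<close>) k, and the removed vertices cost at most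
  \<open>\<delta>\<close> k more. The loss in coverage is absorbed by (2 - \<open>\<delta>\<close>)
  (1 - 2 \<open>\<delta>\<close>), which is at least 2 - 6 \<open>\<delta>\<close>.\<close>

lemma host_tiles:
  fixes \<delta> :: real and R :: nat
  assumes \<delta>: "0 < \<delta>" "\<delta> \<le> 1 / 20" and R: "R > 0"
  shows "\<exists>k0. \<forall>k\<ge>k0. \<forall>(K :: 'a sgraph) \<gamma> V'. is_host K k \<delta> \<gamma> \<longrightarrow> V' \<subseteq> verts K \<longrightarrow> real (card (verts K - V')) \<le> \<delta> * real k \<longrightarrow>
    (\<exists>T. tiling (adj K) R T \<and> (\<Union>t\<in>T. area t) \<subseteq> V' \<and> (1 - 3 * \<delta>) * real k \<le> real R * real (card T))"
proof -
  have "0 < \<delta>" "\<delta> \<le> 1" using \<delta> by auto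
  from tile_cover[OF this R, where ?'a = 'a] obtain a0 where
    a0: "\<forall>a\<ge>a0. \<forall>(V :: 'a set) E. finite V \<longrightarrow> symp E \<longrightarrow> 2 * a \<le> real (card V) \<longrightarrow>
      real (card V) \<le> 10 * a \<longrightarrow> (\<forall>x\<in>V. a \<le> real (card {y \<in> V. E x y})) \<longrightarrow>
      (\<exists>X\<subseteq>V. tileable E R X \<and> (2 - \<delta>) * a \<le> real (card X))" by (elim exE)
  obtain k0 :: nat where k0: "2 * \<bar>a0\<bar> + 1 \<le> real k0" using real_arch_simple by blast
  show ?thesis
  proof (intro exI[of _ k0] allI impI)
    fix k :: nat and K :: "'a sgraph" and \<gamma> :: real and V'
    assume k: "k0 \<le> k" and host: "is_host K k \<delta> \<gamma>" and V': "V' \<subseteq> verts K" "real (card (verts K - V')) \<le> \<delta> * real k"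
    have K: "simple_graph K" "2 * (1 - \<delta>) * real k \<le> real (card (verts K))" "card (verts K) \<le> 8 * k"
        "\<And>v. v \<in> verts K \<Longrightarrow> (1 - \<delta>) * real k \<le> real (card (nbrs K v))"
      using host unfolding is_host_def by simp_all
    have fK: "finite (verts K)" using finite_simple_graph[OF K(1)] by blast
    have fV: "finite V'" using fK V'(1) finite_subset by blast
    have kk: "2 * \<bar>a0\<bar> + 1 \<le> real k" using k0 k by linarith
    define a where "a = (1 - 2 * \<delta>) * real k"
    have half: "real k / 2 \<le> a"
    proof -
      have "1 / 2 * real k \<le> (1 - 2 * \<delta>) * real k" using \<delta> by (intro mult_right_mono) auto
      then show ?thesis unfolding a_def by simp
    qed
    have aa: "a0 \<le> a" using half kk by linarith
    have dk: "\<delta> * real k \<le> 1 / 20 * real k" using \<delta> by (intro mult_right_mono) auto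
    have cV: "real (card (verts K)) = real (card V') + real (card (verts K - V'))"
    proof -
      have "card (verts K - V') = card (verts K) - card V'" using fV V'(1) by (rule card_Diff_subset)
      moreover have "card V' \<le> card (verts K)" using card_mono[OF fK V'(1)] .
      ultimately show ?thesis by simp
    qed
    have v1: "2 * a \<le> real (card V')" using cV K(2) V'(2) \<delta> unfolding a_def by (simp add: algebra_simps)
    have v2: "real (card V') \<le> 10 * a"
    proof -
      have "real (card V') \<le> 8 * real k" using cV K(3) by linarith
      then show ?thesis using dk unfolding a_def by (simp add: algebra_simps)
    qed
    have v3: "a \<le> real (card {y \<in> V'. adj K x y})" if "x \<in> V'" for x
    proof -
      have "nbrs K x \<subseteq> {y \<in> V'. adj K x y} \<union> (verts K - V')"
        using nbrs_subset[OF K(1), of x] unfolding nbrs_def by blast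
      then have "card (nbrs K x) \<le> card ({y \<in> V'. adj K x y} \<union> (verts K - V'))" using fK fV by (intro card_mono) auto
      also have "\<dots> \<le> card {y \<in> V'. adj K x y} + card (verts K - V')" by (rule card_Un_le)
      finally have "real (card (nbrs K x)) \<le> real (card {y \<in> V'. adj K x y}) + real (card (verts K - V'))" by linarith
      moreover have "(1 - \<delta>) * real k \<le> real (card (nbrs K x))" using K(4) that V'(1) by blast
      moreover have "a = (1 - \<delta>) * real k - \<delta> * real k" unfolding a_def by (simp add: algebra_simps)
      ultimately show ?thesis using V'(2) by linarith
    qed
    have "\<exists>X\<subseteq>V'. tileable (adj K) R X \<and> (2 - \<delta>) * a \<le> real (card X)"
      using a0[THEN spec, THEN mp, OF aa, THEN spec, THEN spec, THEN mp, OF fV, THEN mp, OF symp_adj, THEN mp, OF v1,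
          THEN mp, OF v2] v3 by blast
    then obtain X where X: "X \<subseteq> V'" "tileable (adj K) R X" "(2 - \<delta>) * a \<le> real (card X)" by blast
    obtain T where T: "tiling (adj K) R T" "(\<Union>t\<in>T. area t) = X" using tileable_imp_tiling[OF X(2) R] by blast
    have "real (card X) = 2 * (real R * real (card T))" using card_tiling[OF T(1) R] T(2) by simp
    moreover have "2 * ((1 - 3 * \<delta>) * real k) \<le> (2 - \<delta>) * a"
    proof -
      have "(2 - 6 * \<delta>) * real k \<le> ((2 - \<delta>) * (1 - 2 * \<delta>)) * real k"
        using \<delta> by (intro mult_right_mono) (auto simp: algebra_simps)
      then show ?thesis unfolding a_def by (simp add: algebra_simps)
    qed
    ultimately have "(1 - 3 * \<delta>) * real k \<le> real R * real (card T)" using X(3) by linarith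
    then show "\<exists>T. tiling (adj K) R T \<and> (\<Union>t\<in>T. area t) \<subseteq> V' \<and> (1 - 3 * \<delta>) * real k \<le> real R * real (card T)"
      using T X(1) by blast
  qed
qed

lemma clique_minor_free_edges:
  fixes F :: "'a sgraph"
  assumes "simple_graph F" "\<not> clique_minor (adj F) (verts F) h" "W \<subseteq> verts F"
  shows "card {e \<in> edges F. e \<subseteq> W} \<le> 2 ^ h * card W"
proof (cases "W = {}")
  case True
  have "e \<noteq> {}" if "e \<in> edges F" for e using assms(1) that unfolding simple_graph_def by fastforce
  then show ?thesis using True by auto
next
  case False
  have v: "verts (induced F W) = W" using assms(3) by auto
  have e: "edges (induced F W) = {e \<in> edges F. e \<subseteq> W}" unfolding induced_def by simp
  have "\<not> clique_minor (adj (induced F W)) (verts (induced F W)) h"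
    using assms(2) clique_minor_model[OF minor_model_induced] by blast
  then have "\<not> 2 ^ h * card W \<le> card {e \<in> edges F. e \<subseteq> W}"
    using dense_imp_clique_minor[OF simple_induced[OF assms(1)], of W h] False v e by metis
  then show ?thesis by simp
qed

text \<open>Parts with more than D neighbours in S are moved into the separator. F has at most 2^h
  edges per vertex, so there are at most 2^h t / D such parts, with at most r 2^h t / D vertices,
  which is within \<open>\<eta>\<close> t.\<close>

lemma clique_minor_free_decomposition:
  fixes F :: "'a sgraph" and h r D :: nat and \<eta> :: real
  assumes F: "simple_graph F" "\<not> clique_minor (adj F) (verts F) h"
    and S: "S \<subseteq> verts F" "parts_of (adj F) (verts F - S) r \<Q>" "real (card S) \<le> \<eta> * real (card (verts F))"
    and D: "real r * 2 ^ h \<le> \<eta> * real D" "D > 0"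
  shows "\<exists>S' \<Q>'. S' \<subseteq> verts F \<and> parts_of (adj F) (verts F - S') r \<Q>' \<and>
    real (card S') \<le> 2 * \<eta> * real (card (verts F)) \<and> (\<forall>Q\<in>\<Q>'. card {s \<in> S'. \<exists>x\<in>Q. adj F s x} \<le> D)"
proof -
  note fin = finite_simple_graph[OF F(1)]
  have fS: "finite S" using S(1) fin finite_subset by blast
  have Q: "\<Union>\<Q> = verts F - S" "\<And>Q. Q \<in> \<Q> \<Longrightarrow> card Q \<le> r"
      "\<And>P Q x y. P \<in> \<Q> \<Longrightarrow> Q \<in> \<Q> \<Longrightarrow> P \<noteq> Q \<Longrightarrow> P \<inter> Q = {}"
      "\<And>P Q x y. P \<in> \<Q> \<Longrightarrow> Q \<in> \<Q> \<Longrightarrow> P \<noteq> Q \<Longrightarrow> x \<in> P \<Longrightarrow> y \<in> Q \<Longrightarrow> \<not> adj F x y"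
    using S(2) unfolding parts_of_def by simp_all
  have fQ: "finite \<Q>" using Q(1) fin by (metis finite_Diff finite_UnionD)
  have QF: "Q \<subseteq> verts F - S" if "Q \<in> \<Q>" for Q using Q(1) that by blast
  let ?N = "\<lambda>Q. {s \<in> S. \<exists>x\<in>Q. adj F s x}"
  define Big where "Big = {Q \<in> \<Q>. D < card (?N Q)}"
  have fB: "finite Big" "Big \<subseteq> \<Q>" using fQ unfolding Big_def by auto
  have "(\<Sum>Q\<in>\<Q>. card (?N Q)) \<le> card (edges F)"
  proof -
    have "(\<Sum>Q\<in>\<Q>. card (?N Q)) = card (SIGMA Q:\<Q>. ?N Q)" using fQ fS by (subst card_SigmaI) auto
    also have "\<dots> \<le> card (edges F)"
    proof -
      \<comment> \<open>A pair of a part and a neighbour s of it is charged to an edge from s into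
        the part. The part is recovered from the end of the edge outside S.\<close>
      have "\<forall>p\<in>(SIGMA Q:\<Q>. ?N Q). \<exists>x. x \<in> fst p \<and> adj F (snd p) x" by auto
      from bchoice[OF this] obtain f where f: "\<forall>p\<in>(SIGMA Q:\<Q>. ?N Q). f p \<in> fst p \<and> adj F (snd p) (f p)" ..
      have "inj_on (\<lambda>p. {snd p, f p}) (SIGMA Q:\<Q>. ?N Q)"
      proof (rule inj_onI)
        fix p p' assume p: "p \<in> (SIGMA Q:\<Q>. ?N Q)" "p' \<in> (SIGMA Q:\<Q>. ?N Q)" "{snd p, f p} = {snd p', f p'}"
        have in1: "fst p \<in> \<Q>" "snd p \<in> S" "fst p' \<in> \<Q>" "snd p' \<in> S" using p by auto
        have in2: "f p \<in> fst p" "f p' \<in> fst p'" using bspec[OF f p(1)] bspec[OF f p(2)] by simp_all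
        have "f p \<notin> S" "f p' \<notin> S" using in1 in2 QF by blast+
        then have "snd p = snd p'" "f p = f p'" using p(3) in1 by (metis doubleton_eq_iff)+
        moreover have "fst p = fst p'" using Q(3)[OF in1(1,3)] in2 \<open>f p = f p'\<close> by auto
        ultimately show "p = p'" by (simp add: prod_eq_iff)
      qed
      moreover have "(\<lambda>p. {snd p, f p}) ` (SIGMA Q:\<Q>. ?N Q) \<subseteq> edges F" using f unfolding adj_def by blast
      ultimately show ?thesis using fin(2) by (rule card_inj_on_le)
    qed
    finally show ?thesis .
  qed
  also have "card (edges F) \<le> 2 ^ h * card (verts F)"
  proof -
    have "{e \<in> edges F. e \<subseteq> verts F} = edges F" using F(1) unfolding simple_graph_def by blast
    then show ?thesis using clique_minor_free_edges[OF F order_refl] by simp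
  qed
  finally have total: "(\<Sum>Q\<in>\<Q>. card (?N Q)) \<le> 2 ^ h * card (verts F)" .
  have "card Big * D = (\<Sum>Q\<in>Big. D)" by simp
  also have "\<dots> \<le> (\<Sum>Q\<in>Big. card (?N Q))" by (rule sum_mono) (auto simp: Big_def)
  also have "\<dots> \<le> (\<Sum>Q\<in>\<Q>. card (?N Q))" using fQ fB(2) by (intro sum_mono2) auto
  finally have cBig: "card Big * D \<le> 2 ^ h * card (verts F)" using total by linarith
  have "card (\<Union>Big) \<le> (\<Sum>Q\<in>Big. card Q)" by (rule card_Union_le_sum_card)
  also have "\<dots> \<le> (\<Sum>Q\<in>Big. r)" using Q(2) fB(2) by (intro sum_mono) auto
  finally have cU: "card (\<Union>Big) \<le> card Big * r" by simp
  have "real (card (\<Union>Big)) * real D \<le> (\<eta> * real (card (verts F))) * real D"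
  proof -
    have "card (\<Union>Big) * D \<le> (card Big * D) * r" using cU by (simp add: mult_ac)
    also have "\<dots> \<le> (2 ^ h * card (verts F)) * r" using cBig by (rule mult_le_mono1)
    finally have "real (card (\<Union>Big) * D) \<le> real ((2 ^ h * card (verts F)) * r)" by (simp only: of_nat_le_iff)
    then have "real (card (\<Union>Big)) * real D \<le> (real r * 2 ^ h) * real (card (verts F))" by (simp add: mult_ac)
    also have "\<dots> \<le> (\<eta> * real D) * real (card (verts F))" using D(1) by (intro mult_right_mono) auto
    finally show ?thesis by (simp add: mult_ac)
  qed
  then have cU2: "real (card (\<Union>Big)) \<le> \<eta> * real (card (verts F))" using D(2) by simp
  let ?S = "S \<union> \<Union>Big"
  have "card ?S \<le> card S + card (\<Union>Big)" by (rule card_Un_le)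
  then have "real (card ?S) \<le> 2 * \<eta> * real (card (verts F))" using S(3) cU2 by linarith
  moreover have "?S \<subseteq> verts F" using S(1) QF fB(2) by blast
  moreover have "parts_of (adj F) (verts F - ?S) r (\<Q> - Big)"
    unfolding parts_of_def
  proof (intro conjI ballI impI)
    have "\<Union>(\<Q> - Big) = \<Union>\<Q> - \<Union>Big"
    proof
      show "\<Union>(\<Q> - Big) \<subseteq> \<Union>\<Q> - \<Union>Big"
      proof
        fix x assume "x \<in> \<Union>(\<Q> - Big)"
        then obtain P where P: "P \<in> \<Q>" "P \<notin> Big" "x \<in> P" by blast
        have "x \<notin> P'" if "P' \<in> Big" for P' using Q(3)[of P P'] P that fB(2) by blast
        then show "x \<in> \<Union>\<Q> - \<Union>Big" using P by blast
      qed
    qed blast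
    then show "\<Union>(\<Q> - Big) = verts F - ?S" using Q(1) by blast
    show "card P \<le> r" if "P \<in> \<Q> - Big" for P using Q(2) that by blast
    show "P \<inter> P' = {}" if "P \<in> \<Q> - Big" "P' \<in> \<Q> - Big" "P \<noteq> P'" for P P' using Q(3) that by blast
    show "\<not> adj F x y" if "P \<in> \<Q> - Big" "P' \<in> \<Q> - Big" "P \<noteq> P'" "x \<in> P" "y \<in> P'" for P P' x y
      using Q(4)[of P P' x y] that by blast
  qed
  moreover have "\<forall>P\<in>\<Q> - Big. card {s \<in> ?S. \<exists>x\<in>P. adj F s x} \<le> D"
  proof
    fix P assume P: "P \<in> \<Q> - Big"
    \<comment> \<open>Distinct parts are not adjacent, so enlarging the separator by whole parts
      gives no remaining part a new neighbour in it.\<close>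
    have "\<not> adj F s x" if s: "s \<in> \<Union>Big" "x \<in> P" for s x
    proof -
      obtain P' where "P' \<in> Big" "s \<in> P'" using s(1) by blast
      then show ?thesis using Q(4)[of P' P s x] P s(2) fB(2) by blast
    qed
    then have eq: "{s \<in> ?S. \<exists>x\<in>P. adj F s x} = ?N P" by blast
    show "card {s \<in> ?S. \<exists>x\<in>P. adj F s x} \<le> D" unfolding eq using P unfolding Big_def by auto
  qed
  ultimately show ?thesis by blast
qed

text \<open>A logarithm of a polynomial in r against the power r^(-1/4). The two factors inside the
  logarithm bound D, of order r^(5/4), and R, of order r.\<close>

lemma small_separator_parameter:
  fixes a b c d e :: real
  assumes "a > 0" "b > 0" "c > 0" "d > 0" "e > 0"
  shows "\<exists>r::nat. r \<ge> 1 \<and>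
    (16 * ln (32 + 8 * (a * real r powr (5 / 4) + 1) * (b * real r + 1) / d) + 2 + e) * (c * real r powr (- 1 / 4)) \<le> d"
proof -
  have "((\<lambda>r::nat. (16 * ln (32 + 8 * (a * real r powr (5 / 4) + 1) * (b * real r + 1) / d) + 2 + e) *
      (c * real r powr (- 1 / 4))) \<longlongrightarrow> 0) sequentially"
    using assms by real_asymp
  then have "eventually (\<lambda>r::nat. (16 * ln (32 + 8 * (a * real r powr (5 / 4) + 1) * (b * real r + 1) / d) + 2 + e) *
      (c * real r powr (- 1 / 4)) < d) sequentially"
    using assms(4) by (rule order_tendstoD)
  from eventually_conj[OF this eventually_ge_at_top[of 1]] show ?thesis
    unfolding eventually_sequentially by (meson le_refl less_imp_le)
qed

text \<open>The threshold depends only on h and \<open>\<epsilon>\<close>, not on F. This uniformity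
  is what turns a bound for every \<open>\<epsilon>\<close> into an error term f(t) = o(t).\<close>

theorem clique_minor_free_upper:
  fixes h :: nat and \<epsilon> :: real
  assumes \<epsilon>: "0 < \<epsilon>" "\<epsilon> \<le> 1"
  shows "\<exists>t0. \<forall>(F :: 'b sgraph) (G :: 'a sgraph). simple_graph F \<longrightarrow> \<not> clique_minor (adj F) (verts F) h \<longrightarrow>
    t0 \<le> card (verts F) \<longrightarrow> simple_graph G \<longrightarrow>
    2 * real (card (verts F)) - real (alpha2 F) + \<epsilon> * real (card (verts F)) \<le> avg_degree G \<longrightarrow> G \<succ> F"
proof -
  \<comment> \<open>The embedding loses 12 \<open>\<delta>\<close> k. As 2 k is at most 3 t, this is
    at most 18 / 40 of \<open>\<epsilon>\<close> t, which leaves more than the 2 lost by rounding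
    k.\<close>
  define \<delta> where "\<delta> = \<epsilon> / 40"
  have \<delta>: "0 < \<delta>" "\<delta> \<le> 1 / 40" using \<epsilon> unfolding \<delta>_def by auto
  define c where "c = 8 * (1 + 6 * (real h)\<^sup>2) / ((2 / 3) powr (- 1 / 4) - 1)"
  have c0: "c > 0"
    using powr_two_thirds_gt_one unfolding c_def by (intro divide_pos_pos) (auto intro: add_pos_nonneg)
  define c' where "c' = c * (2 / 3) powr (- 1 / 4)"
  have c'0: "c' > 0" using c0 unfolding c'_def by simp
  \<comment> \<open>The factor 6656 is 52 * 2 * 2 * 32: 52 per terminal of a branch set, 2 from
    enlarging the separator, 2 from t being at most 2 k, and 32 from the connectivity
    \<open>\<delta>\<close> / 32 of the host.\<close>
  obtain r :: nat where r: "r \<ge> 1" and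
    small: "(16 * ln (32 + 8 * (2 ^ h / c' * real r powr (5 / 4) + 1) * (3 / (2 * \<delta>) * real r + 1) / \<delta>) + 2 + 2 ^ h) *
      (6656 * c' * real r powr (- 1 / 4)) \<le> \<delta>"
    using small_separator_parameter[of "2 ^ h / c'" "3 / (2 * \<delta>)" "6656 * c'" \<delta> "2 ^ h"] \<delta>(1) c'0 by auto
  define \<eta> where "\<eta> = c' * real r powr (- 1 / 4)"
  have r0: "real r > 0" using r by simp
  have \<eta>0: "\<eta> > 0" using c'0 r0 unfolding \<eta>_def by simp
  have \<eta>eq: "c * (2 * real r / 3) powr (- 1 / 4) = \<eta>"
    using powr_mult[of "2 / 3" "real r" "- 1 / 4"] r0 unfolding \<eta>_def c'_def by simp
  define D where "D = nat \<lceil>real r * 2 ^ h / \<eta>\<rceil>"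
  have D1: "real r * 2 ^ h / \<eta> \<le> real D" "real D \<le> real r * 2 ^ h / \<eta> + 1"
  proof -
    have "0 \<le> real r * 2 ^ h / \<eta>" using \<eta>0 by simp
    then show "real r * 2 ^ h / \<eta> \<le> real D" "real D \<le> real r * 2 ^ h / \<eta> + 1" unfolding D_def by linarith+
  qed
  have D0: "D > 0"
  proof -
    have "0 < real r * 2 ^ h / \<eta>" using \<eta>0 r0 by simp
    then show ?thesis using D1(1) by (cases D) auto
  qed
  define R where "R = nat \<lceil>3 / (2 * \<delta>) * real r\<rceil>"
  have R1: "3 / (2 * \<delta>) * real r \<le> real R" "real R \<le> 3 / (2 * \<delta>) * real r + 1"
  proof -
    have "0 \<le> 3 / (2 * \<delta>) * real r" using \<delta> by simp
    then show "3 / (2 * \<delta>) * real r \<le> real R" "real R \<le> 3 / (2 * \<delta>) * real r + 1" unfolding R_def by linarith+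
  qed
  have R0: "R > 0"
  proof -
    have "0 < 3 / (2 * \<delta>) * real r" using \<delta> r0 by simp
    then show ?thesis using R1(1) by (cases R) auto
  qed
  have R2: "3 * real r \<le> \<delta> * (2 * real R)" using R1(1) \<delta> by (simp add: field_simps)
  \<comment> \<open>With \<open>\<zeta>\<close> = 1 / y the summand 32 gives 16
    \<open>\<zeta>\<close> < 1, and the other summand limits the share of bad tiles to
    \<open>\<delta>\<close>.\<close>
  define y where "y = 32 + 8 * real D * real R / \<delta>"
  have y32: "32 < y" using D0 R0 \<delta> unfolding y_def by simp
  define \<zeta> where "\<zeta> = 1 / y"
  have \<zeta>: "\<zeta> * 16 < 1" "8 * real D * \<zeta> * real R \<le> \<delta>"
  proof -
    show "\<zeta> * 16 < 1" using y32 unfolding \<zeta>_def by (simp add: field_simps)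
    have "8 * real D * real R / \<delta> \<le> y" unfolding y_def by simp
    then have "8 * real D * real R \<le> \<delta> * y" using \<delta> by (simp add: field_simps)
    then show "8 * real D * \<zeta> * real R \<le> \<delta>" using y32 unfolding \<zeta>_def by (simp add: field_simps)
  qed
  define M where "M = nat \<lceil>16 * ln y\<rceil>"
  have M1: "16 * ln y \<le> real M" "real M \<le> 16 * ln y + 1"
  proof -
    have "0 \<le> 16 * ln y" using y32 by simp
    then show "16 * ln y \<le> real M" "real M \<le> 16 * ln y + 1" unfolding M_def by linarith+
  qed
  have M2: "(15 / 16) ^ M \<le> \<zeta>"
  proof -
    have "(15 / 16 :: real) \<le> exp (- (1 / 16))" using exp_ge_add_one_self[of "- (1 / 16) :: real"] by simp
    then have "(15 / 16 :: real) ^ M \<le> exp (- (1 / 16)) ^ M" by (rule power_mono) simp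
    also have "\<dots> = exp (- (real M / 16))" by (simp add: exp_of_nat_mult[symmetric])
    also have "\<dots> \<le> exp (- ln y)" using M1(1) by simp
    also have "\<dots> = \<zeta>" using y32 unfolding \<zeta>_def by (simp add: exp_minus inverse_eq_divide)
    finally show ?thesis .
  qed
  have y2: "y \<le> 32 + 8 * (2 ^ h / c' * real r powr (5 / 4) + 1) * (3 / (2 * \<delta>) * real r + 1) / \<delta>"
  proof -
    have "real r * 2 ^ h / \<eta> = 2 ^ h / c' * real r powr (5 / 4)"
    proof -
      have "real r powr (5 / 4) * real r powr (- 1 / 4) = real r" using r0 by (simp add: powr_add[symmetric])
      then show ?thesis using c'0 r0 unfolding \<eta>_def by (simp add: field_simps)
    qed
    then have "real D \<le> 2 ^ h / c' * real r powr (5 / 4) + 1" using D1(2) by simp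
    then have "8 * real D * real R \<le> 8 * (2 ^ h / c' * real r powr (5 / 4) + 1) * (3 / (2 * \<delta>) * real r + 1)"
      using R1(2) c'0 by (intro mult_mono) (auto intro: add_nonneg_nonneg)
    then show ?thesis using \<delta> unfolding y_def by (simp add: divide_right_mono)
  qed
  have budget: "6656 * (real M + 1 + 2 ^ h) * \<eta> \<le> \<delta>"
  proof -
    have "ln y \<le> ln (32 + 8 * (2 ^ h / c' * real r powr (5 / 4) + 1) * (3 / (2 * \<delta>) * real r + 1) / \<delta>)"
      using y2 y32 by simp
    then have "real M + 1 + 2 ^ h \<le> 16 * ln (32 + 8 * (2 ^ h / c' * real r powr (5 / 4) + 1) * (3 / (2 * \<delta>) * real r + 1) / \<delta>) + 2 + 2 ^ h"
      using M1(2) by linarith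
    then have "(real M + 1 + 2 ^ h) * (6656 * \<eta>) \<le> \<dots> * (6656 * \<eta>)" using \<eta>0 by (intro mult_right_mono) auto
    also have "\<dots> \<le> \<delta>" using small unfolding \<eta>_def by (simp add: mult_ac)
    finally show ?thesis by (simp add: mult_ac)
  qed
  have \<delta>20: "\<delta> \<le> 1 / 20" using \<delta> by simp
  from host_tiles[OF \<delta>(1) \<delta>20 R0, where ?'a = 'a] obtain k0 where
    k0: "\<forall>k\<ge>k0. \<forall>(K :: 'a sgraph) \<gamma> V'. is_host K k \<delta> \<gamma> \<longrightarrow> V' \<subseteq> verts K \<longrightarrow> real (card (verts K - V')) \<le> \<delta> * real k \<longrightarrow>
      (\<exists>T. tiling (adj K) R T \<and> (\<Union>t\<in>T. area t) \<subseteq> V' \<and> (1 - 3 * \<delta>) * real k \<le> real R * real (card T))" by (elim exE)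
  obtain t0 :: nat where t0: "max (4 / \<epsilon>) (max (65 / \<delta>) (2 * real k0 + 1)) \<le> real t0" using real_arch_simple by blast
  show ?thesis
  proof (intro exI[of _ t0] allI impI)
    fix F :: "'b sgraph" and G :: "'a sgraph"
    assume F: "simple_graph F" "\<not> clique_minor (adj F) (verts F) h" and tF: "t0 \<le> card (verts F)"
      and G: "simple_graph G"
      and avg: "2 * real (card (verts F)) - real (alpha2 F) + \<epsilon> * real (card (verts F)) \<le> avg_degree G"
    define t where "t = real (card (verts F))"
    have tt: "4 / \<epsilon> \<le> t" "65 / \<delta> \<le> t" "2 * real k0 + 1 \<le> t" using t0 tF unfolding t_def by linarith+
    have \<epsilon>t: "4 \<le> \<epsilon> * t" using tt(1) \<epsilon> by (simp add: field_simps)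
    have t1: "t \<ge> 1" using tt(3) by linarith
    define m where "m = 2 * t - real (alpha2 F)"
    have m: "t \<le> m" "m \<le> 2 * t" using alpha2_le[OF F(1)] unfolding m_def t_def by auto
    \<comment> \<open>Half of the assumed average degree bound. Its integer part k then satisfies:
      average degree at least 2 k, that is, at least k edges per vertex.\<close>
    define x where "x = (m + \<epsilon> * t) / 2"
    have x: "m + \<epsilon> * t = 2 * x" unfolding x_def by simp
    define k where "k = nat \<lfloor>x\<rfloor>"
    have kk: "2 * real k \<le> m + \<epsilon> * t" "m + \<epsilon> * t - 2 \<le> 2 * real k"
    proof -
      have "0 \<le> x" using m \<epsilon>t t1 unfolding x_def by simp
      then have "real k = of_int \<lfloor>x\<rfloor>" unfolding k_def by simp
      then show "2 * real k \<le> m + \<epsilon> * t" "m + \<epsilon> * t - 2 \<le> 2 * real k"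
        unfolding x using floor_correct[of x] by linarith+
    qed
    have tk: "t \<le> 2 * real k" using kk(2) m \<epsilon>t by linarith
    have k1: "k > 0" using tk t1 by (cases k) auto
    have k32: "32 < \<delta> * real k"
    proof -
      have "65 \<le> \<delta> * t" using tt(2) \<delta> by (simp add: field_simps)
      also have "\<dots> \<le> \<delta> * (2 * real k)" using tk \<delta> by (intro mult_left_mono) auto
      finally show ?thesis by simp
    qed
    have avg2: "2 * real k \<le> avg_degree G" using avg kk(1) unfolding m_def t_def by linarith
    have Gne: "verts G \<noteq> {}"
    proof
      assume "verts G = {}"
      then have "avg_degree G = 0" unfolding avg_degree_def by simp
      then show False using avg2 k1 by simp
    qed
    then have nG: "0 < real (card (verts G))" using finite_simple_graph(1)[OF G] by (simp add: card_gt_0_iff)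
    have "2 * real k * real (card (verts G)) \<le> 2 * real (card (edges G))"
      using avg2 nG unfolding avg_degree_def by (simp add: field_simps)
    then have "real (k * card (verts G)) \<le> real (card (edges G))" by simp
    then have eG: "k * card (verts G) \<le> card (edges G)" by (simp only: of_nat_le_iff)
    have "\<delta> < 1 / 2" using \<delta> by simp
    from dense_imp_host[OF G Gne eG \<delta>(1) this k32] obtain K :: "'a sgraph" and \<phi> where
      K: "minor_model G K \<phi>" "is_host K k \<delta> (\<delta> / 32)" by blast
    obtain A B where AB: "indep_set F A" "indep_set F B" "A \<inter> B = {}" "card (A \<union> B) = alpha2 F"
      using alpha2_witness[OF F(1)] .
    have fF: "finite (verts F)" using finite_simple_graph[OF F(1)] by blast
    have rpos: "r > 0" using r by simp
    obtain S0 Q0 where S0: "S0 \<subseteq> verts F" "parts_of (adj F) (verts F - S0) r Q0" "real (card S0) \<le> \<eta> * real (card (verts F))"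
      using clique_minor_free_parts[OF rpos fF symp_adj F(2)] unfolding c_def[symmetric] \<eta>eq by blast
    have "real r * 2 ^ h \<le> \<eta> * real D" using D1(1) \<eta>0 by (simp add: field_simps)
    from clique_minor_free_decomposition[OF F S0 this D0] obtain S \<Q> where
      S: "S \<subseteq> verts F" "parts_of (adj F) (verts F - S) r \<Q>" "real (card S) \<le> 2 * \<eta> * real (card (verts F))"
         "\<forall>Q\<in>\<Q>. card {s \<in> S. \<exists>x\<in>Q. adj F s x} \<le> D" by (elim exE conjE)
    have "\<exists>\<psi>. minor_model K F \<psi>"
    proof (rule embed_in_host[OF K(2) k1 \<delta>(1) \<delta>20 F(1) AB(1-3) S(1,2) _ M2 \<zeta>(1) _ R0 R2 \<zeta>(2)])
      show "card {s \<in> S. \<exists>x\<in>Q. adj F s x} \<le> D" if "Q \<in> \<Q>" for Q using S(4) that by simp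
      show "real (52 * ((M + 1) * card S + card {e \<in> edges F. e \<subseteq> S})) \<le> min (\<delta> / 32) \<delta> * real k"
      proof -
        have "card {e \<in> edges F. e \<subseteq> S} \<le> 2 ^ h * card S" by (rule clique_minor_free_edges[OF F S(1)])
        then have "52 * ((M + 1) * card S + card {e \<in> edges F. e \<subseteq> S}) \<le> 52 * ((M + 1) * card S + 2 ^ h * card S)" by simp
        then have "real (52 * ((M + 1) * card S + card {e \<in> edges F. e \<subseteq> S})) \<le> real (52 * ((M + 1) * card S + 2 ^ h * card S))"
          by (simp only: of_nat_le_iff)
        also have "\<dots> = 52 * (real M + 1 + 2 ^ h) * real (card S)" by (simp add: algebra_simps)
        also have "\<dots> \<le> 52 * (real M + 1 + 2 ^ h) * (2 * \<eta> * (2 * real k))"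
        proof (rule mult_left_mono)
          have "2 * \<eta> * real (card (verts F)) \<le> 2 * \<eta> * (2 * real k)"
            using tk \<eta>0 unfolding t_def by (intro mult_left_mono) auto
          then show "real (card S) \<le> 2 * \<eta> * (2 * real k)" using S(3) by linarith
        qed simp
        also have "\<dots> = (6656 * (real M + 1 + 2 ^ h) * \<eta>) / 32 * real k" by simp
        also have "\<dots> \<le> \<delta> / 32 * real k" using budget by (intro mult_right_mono divide_right_mono) auto
        also have "\<delta> / 32 = min (\<delta> / 32) \<delta>" using \<delta> by simp
        finally show ?thesis .
      qed
      show "\<exists>T. tiling (adj K) R T \<and> (\<Union>t\<in>T. area t) \<subseteq> V' \<and> (1 - 3 * \<delta>) * real k \<le> real R * real (card T)"
        if V': "V' \<subseteq> verts K" "real (card (verts K - V')) \<le> \<delta> * real k" for V'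
      proof -
        have "k0 \<le> k" using tk tt(3) by linarith
        from k0[THEN spec, THEN mp, OF this, THEN spec, THEN spec, THEN spec, THEN mp, OF K(2), THEN mp, OF V'(1), THEN mp, OF V'(2)]
        show ?thesis .
      qed
      show "2 * real (card (verts F)) - real (card (A \<union> B)) \<le> (1 - 6 * \<delta>) * (2 * real k)"
      proof -
        have "12 * (\<delta> * real k) \<le> \<epsilon> * t - 2"
        proof -
          have "2 * real k \<le> 3 * t"
          proof -
            have "\<epsilon> * t \<le> 1 * t" using \<epsilon> t1 by (intro mult_right_mono) auto
            then show ?thesis using kk(1) m by linarith
          qed
          then have "\<delta> * (2 * real k) \<le> \<delta> * (3 * t)" using \<delta> by (intro mult_left_mono) auto
          then have "12 * (\<delta> * real k) \<le> 18 * (\<delta> * t)" by simp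
          also have "\<dots> = 18 / 40 * (\<epsilon> * t)" unfolding \<delta>_def by simp
          finally show ?thesis using \<epsilon>t by linarith
        qed
        then show ?thesis using kk(2) AB(4) unfolding m_def t_def by (simp add: algebra_simps)
      qed
    qed
    then obtain \<psi> where "minor_model K F \<psi>" by blast
    from minor_model_trans[OF K(1) this] show "G \<succ> F" by (rule minor_model_imp_has_minor[OF _ G F(1)])
  qed
qed

section \<open>The lower bound\<close>

text \<open>Every edge of the bipartite graph meets the side of size s. So branch sets avoiding that
  side are pairwise nonadjacent and belong to an independent set, while the others are at most s in
  number because they are disjoint.\<close>

lemma minor_of_complete_bipartite:
  fixes F :: "'a sgraph" and s n :: nat
  defines "G \<equiv> SGraph {..<s + n} {{i, j} | i j. i < s \<and> s \<le> j \<and> j < s + n} :: nat sgraph"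
  assumes F: "simple_graph F" and m: "minor_model G F \<phi>"
  shows "card (verts F) \<le> s + indep_number F"
proof -
  note mD = minor_modelD[OF m]
  have adjG: "adj G u v \<Longrightarrow> u < s \<or> v < s" for u v
    unfolding G_def adj_def by (auto simp: doubleton_eq_iff)
  have fF: "finite (verts F)" using finite_simple_graph[OF F] by blast
  define I where "I = {x \<in> verts F. \<phi> x \<inter> {..<s} = {}}"
  have "indep_set F I"
    unfolding indep_set_def
  proof (intro conjI ballI)
    show "I \<subseteq> verts F" unfolding I_def by blast
    fix x y assume xy: "x \<in> I" "y \<in> I"
    show "{x, y} \<notin> edges F"
    proof
      assume "{x, y} \<in> edges F"
      then obtain u v where "u \<in> \<phi> x" "v \<in> \<phi> y" "adj G u v" using mD(5)[of x y] xy unfolding I_def adj_def by blast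
      then show False using adjG[of u v] xy unfolding I_def by blast
    qed
  qed
  moreover have "finite {card A | A. indep_set F A}"
    by (rule finite_subset[of _ "{..card (verts F)}"]) (auto simp: indep_set_def intro!: card_mono fF)
  ultimately have cI: "card I \<le> indep_number F" unfolding indep_number_def by (intro Max_ge) auto
  have "\<forall>x\<in>verts F - I. \<exists>i. i \<in> \<phi> x \<and> i < s" unfolding I_def by blast
  from bchoice[OF this] obtain g where g: "\<forall>x\<in>verts F - I. g x \<in> \<phi> x \<and> g x < s" ..
  have "inj_on g (verts F - I)"
  proof (rule inj_onI, rule ccontr)
    fix x y assume xy: "x \<in> verts F - I" "y \<in> verts F - I" "g x = g y" "x \<noteq> y"
    then have "\<phi> x \<inter> \<phi> y = {}" using mD(4)[of x y] by blast
    moreover have "g x \<in> \<phi> x" "g x \<in> \<phi> y" using bspec[OF g xy(1)] bspec[OF g xy(2)] xy(3) by simp_all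
    ultimately show False by blast
  qed
  moreover have "g ` (verts F - I) \<subseteq> {..<s}" using g by blast
  ultimately have "card (verts F - I) \<le> s" using card_inj_on_le[of g "verts F - I" "{..<s}"] by simp
  moreover have "card (verts F) \<le> card (verts F - I) + card I"
  proof -
    have "verts F = (verts F - I) \<union> I" unfolding I_def by blast
    then show ?thesis by (metis card_Un_le)
  qed
  ultimately show ?thesis using cI by linarith
qed

lemma complete_bipartite_avg_degree:
  fixes s n :: nat
  defines "G \<equiv> SGraph {..<s + n} {{i, j} | i j. i < s \<and> s \<le> j \<and> j < s + n} :: nat sgraph"
  shows "simple_graph G" "avg_degree G = 2 * (real s * real n) / (real s + real n)"
proof -
  show "simple_graph G" unfolding G_def simple_graph_def by auto
  have "edges G = (\<lambda>(i, j). {i, j}) ` ({..<s} \<times> {s..<s + n})"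
  proof (intro equalityI subsetI)
    fix e assume "e \<in> edges G"
    then obtain i j where "e = {i, j}" "i < s" "s \<le> j" "j < s + n" unfolding G_def by auto
    then show "e \<in> (\<lambda>(i, j). {i, j}) ` ({..<s} \<times> {s..<s + n})" by (intro image_eqI[of _ _ "(i, j)"]) auto
  next
    fix e assume "e \<in> (\<lambda>(i, j). {i, j}) ` ({..<s} \<times> {s..<s + n})"
    then obtain i j where "e = {i, j}" "i < s" "s \<le> j" "j < s + n" by auto
    then show "e \<in> edges G" unfolding G_def by auto
  qed
  moreover have "inj_on (\<lambda>(i, j). {i, j}) ({..<s} \<times> {s..<s + n})"
    by (auto simp: inj_on_def doubleton_eq_iff)
  ultimately have "card (edges G) = s * n" by (simp add: card_image card_cartesian_product)
  then show "avg_degree G = 2 * (real s * real n) / (real s + real n)" unfolding avg_degree_def by (simp add: G_def)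
qed

text \<open>With one side fixed at s, the average degree of complete bipartite graphs tends to 2 s
  as the other side grows. So c is at least 2 s for every s too small to allow F as a minor.\<close>

lemma forced_minor_bound_lower:
  fixes F :: "'a sgraph" and c :: real
  assumes F: "simple_graph F" and c: "0 \<le> c" "\<And>G :: nat sgraph. simple_graph G \<Longrightarrow> c \<le> avg_degree G \<Longrightarrow> G \<succ> F"
  shows "2 * real (card (verts F)) - 2 * real (indep_number F) - 2 \<le> c"
proof (cases "card (verts F) \<le> indep_number F")
  case True
  then show ?thesis using c(1) by linarith
next
  case False
  \<comment> \<open>The largest s excluded by \<open>minor_of_complete_bipartite\<close>. The 1
    subtracted here becomes the constant 2 of the lower bound.\<close>
  define s where "s = card (verts F) - indep_number F - 1"
  have s: "real s = real (card (verts F)) - real (indep_number F) - 1" using False unfolding s_def by linarith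
  let ?G = "\<lambda>n. SGraph {..<s + n} {{i, j} | i j. i < s \<and> s \<le> j \<and> j < s + n} :: nat sgraph"
  have "avg_degree (?G n) \<le> c" for n
  proof (rule ccontr)
    assume "\<not> ?thesis"
    then have "?G n \<succ> F" using c(2)[OF complete_bipartite_avg_degree(1)] by force
    from has_minor_imp_model[OF this complete_bipartite_avg_degree(1)] obtain \<phi> where "minor_model (?G n) F \<phi>" by blast
    from minor_of_complete_bipartite[OF F this] show False using s False by linarith
  qed
  then have "2 * (real s * real n) / (real s + real n) \<le> c" for n using complete_bipartite_avg_degree(2) by metis
  moreover have "((\<lambda>n::nat. 2 * (real s * real n) / (real s + real n)) \<longlongrightarrow> 2 * real s) sequentially" by real_asymp
  ultimately have "2 * real s \<le> c" by (intro LIMSEQ_le_const2) auto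
  then show ?thesis using s by linarith
qed

section \<open>A crude average degree that forces any given graph\<close>

lemma clique_minor_imp_has_minor:
  fixes F :: "'a sgraph" and G :: "'b sgraph"
  assumes "clique_minor (adj G) (verts G) (card (verts F))" and G: "simple_graph G" and F: "simple_graph F"
  shows "G \<succ> F"
proof -
  obtain \<A> where A: "finite \<A>" "card \<A> = card (verts F)"
      "\<forall>A\<in>\<A>. A \<subseteq> verts G \<and> A \<noteq> {} \<and> conn (adj G) A"
      "\<forall>A\<in>\<A>. \<forall>B\<in>\<A>. A \<noteq> B \<longrightarrow> A \<inter> B = {} \<and> (\<exists>a\<in>A. \<exists>b\<in>B. adj G a b)"
    using assms(1) unfolding clique_minor_def by (elim exE conjE)
  have "\<exists>g. bij_betw g (verts F) \<A>" using A(1,2) finite_simple_graph(1)[OF F] by (intro finite_same_card_bij) auto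
  then obtain g where g: "bij_betw g (verts F) \<A>" ..
  have gA: "g x \<in> \<A>" if "x \<in> verts F" for x using g that by (rule bij_betwE[rule_format])
  have gne: "g x \<noteq> g y" if "x \<in> verts F" "y \<in> verts F" "x \<noteq> y" for x y
    using g that by (metis bij_betw_imp_inj_on inj_onD)
  have "minor_model G F g"
  proof (rule minor_modelI)
    fix x assume "x \<in> verts F"
    then show "g x \<subseteq> verts G" "g x \<noteq> {}" "conn (adj G) (g x)" using A(3) gA by simp_all
  next
    fix x y assume "x \<in> verts F" "y \<in> verts F" "x \<noteq> y"
    then show "g x \<inter> g y = {}" using A(4) gA gne by simp
  next
    fix x y assume xy: "x \<in> verts F" "y \<in> verts F" "adj F x y"
    then have "x \<noteq> y" using adj_simple(3)[OF F] by blast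
    then show "\<exists>u\<in>g x. \<exists>v\<in>g y. adj G u v" using A(4) gA gne xy by simp
  qed
  then show ?thesis by (rule minor_model_imp_has_minor[OF _ G F])
qed

text \<open>Guarantees that the infimum in \<open>d_minor\<close> is taken over a nonempty set, and
  bounds \<open>d_minor\<close> in terms of the number of vertices alone, so that the supremum
  defining the error term is finite.\<close>

lemma forced_minor_bound_exists:
  fixes F :: "'a sgraph" and G :: "'b sgraph"
  assumes F: "simple_graph F" and G: "simple_graph G" "2 ^ (card (verts F) + 1) \<le> avg_degree G"
  shows "G \<succ> F"
proof -
  let ?t = "card (verts F)"
  have Gne: "verts G \<noteq> {}"
  proof
    assume "verts G = {}"
    then have "avg_degree G = 0" unfolding avg_degree_def by simp
    moreover have "(0 :: real) < 2 ^ (?t + 1)" by simp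
    ultimately show False using G(2) by linarith
  qed
  then have "0 < real (card (verts G))" using finite_simple_graph(1)[OF G(1)] by (simp add: card_gt_0_iff)
  then have "2 ^ ?t * real (card (verts G)) \<le> real (card (edges G))" using G(2) unfolding avg_degree_def by (simp add: field_simps)
  then have "real (2 ^ ?t * card (verts G)) \<le> real (card (edges G))" by simp
  then have "2 ^ ?t * card (verts G) \<le> card (edges G)" by (simp only: of_nat_le_iff)
  from clique_minor_imp_has_minor[OF dense_imp_clique_minor[OF G(1) Gne this] G(1) F] show ?thesis .
qed

theorem theorem2p3:
  fixes \<F> :: "nat sgraph set"
  assumes "\<And>F. F \<in> \<F> \<Longrightarrow> simple_graph F"
    and "minor_closed \<F>"
    and "nontrivial_family \<F>"
  shows "\<exists>(C::real) (f::nat \<Rightarrow> real).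
           (\<lambda>t. f t / real t) \<longlonglongrightarrow> 0 \<and>
           (\<forall>t. \<forall>F\<in>\<F>. card (verts F) = t \<longrightarrow>
              2 * real t - 2 * real (indep_number F) - C \<le> d_minor F \<and>
              d_minor F \<le> 2 * real t - real (alpha2 F) + f t)"
proof -
  obtain G0 :: "nat sgraph" where G0: "simple_graph G0" "G0 \<notin> \<F>" using assms(3) unfolding nontrivial_family_def by blast
  define h where "h = card (verts G0)"
  \<comment> \<open>A clique minor on as many vertices as some graph outside the family contains
    that graph as a minor, so no member of the family has one.\<close>
  have free: "\<not> clique_minor (adj F) (verts F) h" if F: "F \<in> \<F>" for F
  proof
    assume "clique_minor (adj F) (verts F) h"
    then have "F \<succ> G0" unfolding h_def by (rule clique_minor_imp_has_minor[OF _ assms(1)[OF F] G0(1)])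
    then show False using assms(2) F G0 unfolding minor_closed_def by blast
  qed
  define forcing where "forcing = (\<lambda>F :: nat sgraph. {c :: real. 0 \<le> c \<and>
    (\<forall>G :: nat sgraph. simple_graph G \<longrightarrow> c \<le> avg_degree G \<longrightarrow> G \<succ> F)})"
  have d_eq: "d_minor F = Inf (forcing F)" for F unfolding d_minor_def forcing_def ..
  have bdd: "bdd_below (forcing F)" for F unfolding forcing_def by (rule bdd_belowI[of _ 0]) simp
  have large: "2 ^ (card (verts F) + 1) \<in> forcing F" if "F \<in> \<F>" for F
    unfolding forcing_def
    by (intro CollectI conjI allI impI forced_minor_bound_exists[OF assms(1)[OF that]]) auto
  have upper: "d_minor F \<le> c" if "c \<in> forcing F" for F c
    unfolding d_eq using that bdd by (rule cInf_lower)
  have lower: "2 * real (card (verts F)) - 2 * real (indep_number F) - 2 \<le> d_minor F" if F: "F \<in> \<F>" for F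
    unfolding d_eq
  proof (rule cInf_greatest)
    show "forcing F \<noteq> {}" using large[OF F] by blast
    fix c assume "c \<in> forcing F"
    then show "2 * real (card (verts F)) - 2 * real (indep_number F) - 2 \<le> c"
      unfolding forcing_def by (intro forced_minor_bound_lower assms(1)[OF F]) auto
  qed
  define excess where "excess = (\<lambda>t. {d_minor F - (2 * real t - real (alpha2 F)) | F. F \<in> \<F> \<and> card (verts F) = t})"
  \<comment> \<open>The smallest nonnegative error that works for all members with t vertices.
    Inserting 0 makes it nonnegative and covers orders t that do not occur in the family.\<close>
  define f where "f = (\<lambda>t. Sup (insert 0 (excess t)))"
  have bddf: "bdd_above (insert 0 (excess t))" for t
  proof (rule bdd_aboveI[of _ "2 ^ (t + 1)"])
    fix x assume "x \<in> insert 0 (excess t)"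
    then show "x \<le> 2 ^ (t + 1)"
    proof
      assume "x \<in> excess t"
      then obtain F where F: "F \<in> \<F>" "card (verts F) = t" "x = d_minor F - (2 * real t - real (alpha2 F))"
        unfolding excess_def by blast
      then show ?thesis using upper[OF large[OF F(1)]] alpha2_le[OF assms(1)[OF F(1)]] by simp
    qed simp
  qed
  have f_upper: "d_minor F \<le> 2 * real t - real (alpha2 F) + f t" if "F \<in> \<F>" "card (verts F) = t" for F t
  proof -
    have "d_minor F - (2 * real t - real (alpha2 F)) \<in> insert 0 (excess t)" using that unfolding excess_def by blast
    from cSup_upper[OF this bddf] show ?thesis unfolding f_def by linarith
  qed
  have f0: "0 \<le> f t" for t unfolding f_def by (rule cSup_upper[OF _ bddf]) simp
  \<comment> \<open>For large t, \<open>clique_minor_free_upper\<close> puts 2 t - alpha2(F) +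
    \<open>\<epsilon>\<close> t into the set whose infimum is \<open>d_minor F\<close>,
    simultaneously for all members with t vertices.\<close>
  have f_small: "\<exists>t0. \<forall>t\<ge>t0. f t \<le> \<epsilon> * real t" if \<epsilon>: "0 < \<epsilon>" "\<epsilon> \<le> 1" for \<epsilon>
  proof -
    obtain t0 where t0: "\<forall>(F :: nat sgraph) (G :: nat sgraph). simple_graph F \<longrightarrow> \<not> clique_minor (adj F) (verts F) h \<longrightarrow>
        t0 \<le> card (verts F) \<longrightarrow> simple_graph G \<longrightarrow>
        2 * real (card (verts F)) - real (alpha2 F) + \<epsilon> * real (card (verts F)) \<le> avg_degree G \<longrightarrow> G \<succ> F"
      using clique_minor_free_upper[OF \<epsilon>, of h] by (elim exE)
    have "f t \<le> \<epsilon> * real t" if t: "t0 \<le> t" for t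
      unfolding f_def
    proof (rule cSup_least)
      fix x assume "x \<in> insert 0 (excess t)"
      then show "x \<le> \<epsilon> * real t"
      proof
        assume "x \<in> excess t"
        then obtain F where F: "F \<in> \<F>" "card (verts F) = t" "x = d_minor F - (2 * real t - real (alpha2 F))"
          unfolding excess_def by blast
        have sF: "simple_graph F" using assms(1)[OF F(1)] .
        have "0 \<le> 2 * real t - real (alpha2 F) + \<epsilon> * real t" using alpha2_le[OF sF] F(2) \<epsilon> by simp
        moreover have "G \<succ> F" if "simple_graph G" "2 * real t - real (alpha2 F) + \<epsilon> * real t \<le> avg_degree G" for G :: "nat sgraph"
          using t0 sF free[OF F(1)] t that F(2) by blast
        ultimately have "2 * real t - real (alpha2 F) + \<epsilon> * real t \<in> forcing F" unfolding forcing_def by simp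
        from upper[OF this] show ?thesis unfolding F(3) by linarith
      qed (use \<epsilon> in simp)
    qed simp
    then show ?thesis by blast
  qed
  have "(\<lambda>t. f t / real t) \<longlonglongrightarrow> 0"
  proof (rule LIMSEQ_I)
    fix e :: real assume e: "0 < e"
    define \<epsilon> where "\<epsilon> = min 1 (e / 2)"
    have \<epsilon>: "0 < \<epsilon>" "\<epsilon> \<le> 1" "\<epsilon> < e" using e unfolding \<epsilon>_def by auto
    obtain t0 where t0: "\<And>t. t0 \<le> t \<Longrightarrow> f t \<le> \<epsilon> * real t" using f_small[OF \<epsilon>(1,2)] by blast
    show "\<exists>no. \<forall>n\<ge>no. norm (f n / real n - 0) < e"
    proof (intro exI[of _ "max 1 t0"] allI impI)
      fix n assume "max 1 t0 \<le> n"
      then have n: "0 < real n" "t0 \<le> n" by auto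
      have "f n / real n \<le> \<epsilon>" using t0[OF n(2)] n(1) by (simp add: field_simps)
      moreover have "0 \<le> f n / real n" using f0 n by simp
      ultimately show "norm (f n / real n - 0) < e" using \<epsilon>(3) by simp
    qed
  qed
  then show ?thesis using lower f_upper by (intro exI[of _ 2] exI[of _ f]) blast
qed

end
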